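(* Let $\Delta$ be a $(d-1)$-dimensional Cohen–Macaulay simplicial complex and let $\Gamma_1,\dots,\Gamma_m$ be pairwise disjoint full subcomplexes of $\Delta$, each Cohen–Macaulay of dimension $d-2$. Then for $0\le k\le d$, \[ h_k(\Delta,\Gamma_1\cup\cdots\cup\Gamma_m)\le\binom{f_0(\Delta)-d+k-1}{k}-\sum_{i=1}^m\binom{f_0(\Gamma_i)-d+k-1}{k}+(m-1)\binom{-d+k-1}{k}. \] Equality holds for some $k_0$ if and only if every non-face of $\Delta$ of dimension $<k_0$ has all its vertices in some $\Gamma_i$.
   Context: Work over an infinite field $k$. A simplicial complex (or relative complex $(\Delta,\Gamma)$) is Cohen–Macaulay if its Stanley–Reisner ring (face module $I_\Gamma/I_\Delta$) has depth equal to its Krull dimension. A subcomplex $\Gamma\subseteq\Delta$ is full if every face of $\Delta$ with all vertices in $\Gamma$ belongs to $\Gamma$. For a relative complex of dimension $d-1$ with $f_i$ the number of $i$-faces of $\Delta$ not in $\Gamma$, $h$ is defined by $\sum_{k=0}^df_{k-1}t^k(1-t)^{d-k}=\sum_kh_kt^k$. $f_0$ counts vertices. Binomial coefficients $\binom{a}{b}$ for integer $a$ and $b\ge0$ mean $a(a-1)\cdots(a-b+1)/b!$ (so $\binom{-d+k-1}{k}=(-1)^k\binom{d}{k}$). *)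

theory Defs
  imports "HOL-Algebra.QuotRing" "HOL-Library.Poly_Mapping" "HOL-Library.Extended_Nat"
    "HOL-Computational_Algebra.Polynomial"
begin

section \<open>Abstract simplicial complexes\<close>

definition vertices :: "'v set set \<Rightarrow> 'v set" where
  "vertices \<Delta> = \<Union>\<Delta>"

text \<open>Complexes are finite and contain the empty face, so the void complex is excluded.\<close>

definition abs_simplicial_complex :: "'v set set \<Rightarrow> bool" where
  "abs_simplicial_complex \<Delta> \<longleftrightarrow>
     finite (vertices \<Delta>) \<and> {} \<in> \<Delta> \<and> (\<forall>\<sigma>\<in>\<Delta>. \<forall>\<tau>. \<tau> \<subseteq> \<sigma> \<longrightarrow> \<tau> \<in> \<Delta>)"

definition full_subcomplex :: "'v set set \<Rightarrow> 'v set set \<Rightarrow> bool" where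
  "full_subcomplex \<Gamma> \<Delta> \<longleftrightarrow>
     abs_simplicial_complex \<Gamma> \<and> \<Gamma> \<subseteq> \<Delta> \<and> (\<forall>\<sigma>\<in>\<Delta>. \<sigma> \<subseteq> vertices \<Gamma> \<longrightarrow> \<sigma> \<in> \<Gamma>)"

definition face_dim :: "'v set \<Rightarrow> int" where
  "face_dim \<sigma> = int (card \<sigma>) - 1"

text \<open>
  The relative complex \<open>(\<Delta>, \<Gamma>)\<close> is represented by the two sets of faces; its faces are the
  elements of \<open>\<Delta> - \<Gamma>\<close>. Taking \<open>\<Gamma> = {}\<close> (the void complex) gives the complex \<open>\<Delta>\<close> itself.
  The dimension is unspecified if \<open>\<Delta> \<subseteq> \<Gamma>\<close>.
\<close>

definition rel_dim :: "'v set set \<Rightarrow> 'v set set \<Rightarrow> int" where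
  "rel_dim \<Delta> \<Gamma> = Max (face_dim ` (\<Delta> - \<Gamma>))"

definition complex_dim :: "'v set set \<Rightarrow> int" where
  "complex_dim \<Delta> = rel_dim \<Delta> {}"

definition rel_face_number :: "'v set set \<Rightarrow> 'v set set \<Rightarrow> int \<Rightarrow> nat" where
  "rel_face_number \<Delta> \<Gamma> i = card {\<sigma> \<in> \<Delta> - \<Gamma>. face_dim \<sigma> = i}"

definition face_number :: "'v set set \<Rightarrow> int \<Rightarrow> nat" where
  "face_number \<Delta> i = rel_face_number \<Delta> {} i"

text \<open>
  With \<open>d - 1 = dim (\<Delta>, \<Gamma>)\<close>, the polynomial \<open>\<Sum>k=0..d. f\<^bsub>k-1\<^esub> t\<^sup>k (1 - t)\<^bsup>d-k\<^esup>\<close> in \<open>t\<close>;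
  the numbers \<open>h\<^sub>k\<close> are its coefficients.
\<close>

definition rel_h_poly :: "'v set set \<Rightarrow> 'v set set \<Rightarrow> int poly" where
  "rel_h_poly \<Delta> \<Gamma> = (let d = nat (rel_dim \<Delta> \<Gamma> + 1) in
     \<Sum>k = 0..d. smult (int (rel_face_number \<Delta> \<Gamma> (int k - 1)))
                  ([:0, 1:] ^ k * [:1, - 1:] ^ (d - k)))"

definition rel_h_number :: "'v set set \<Rightarrow> 'v set set \<Rightarrow> nat \<Rightarrow> int" where
  "rel_h_number \<Delta> \<Gamma> k = coeff (rel_h_poly \<Delta> \<Gamma>) k"


section \<open>Krull dimension and depth\<close>

definition krull_dim :: "('a, 'b) ring_scheme \<Rightarrow> enat" where
  "krull_dim R = Sup {enat n | n. \<exists>P :: nat \<Rightarrow> 'a set.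
     (\<forall>i\<le>n. primeideal (P i) R) \<and> (\<forall>i<n. P i \<subset> P (Suc i))}"

definition regular_sequence :: "('a, 'b) ring_scheme \<Rightarrow> 'a list \<Rightarrow> bool" where
  "regular_sequence R xs \<longleftrightarrow>
     set xs \<subseteq> carrier R \<and>
     (\<forall>i<length xs. \<forall>r\<in>carrier R.
        r \<otimes>\<^bsub>R\<^esub> (xs ! i) \<in> genideal R (set (take i xs)) \<longrightarrow> r \<in> genideal R (set (take i xs))) \<and>
     genideal R (set xs) \<noteq> carrier R"

text \<open>The depth of a ring \<open>R\<close> with respect to an ideal \<open>m\<close>.\<close>

definition ring_depth :: "('a, 'b) ring_scheme \<Rightarrow> 'a set \<Rightarrow> enat" where
  "ring_depth R m = Sup {enat (length xs) | xs. set xs \<subseteq> m \<and> regular_sequence R xs}"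


section \<open>Stanley-Reisner rings and the Cohen-Macaulay property\<close>

text \<open>
  The type \<open>('v \<Rightarrow>\<^sub>0 nat) \<Rightarrow>\<^sub>0 'k\<close> is the polynomial ring over \<open>'k\<close> whose variables are all the
  elements of \<open>'v\<close>: an element maps exponent vectors to coefficients.
  Below, only the variables in \<open>V\<close> are allowed.
\<close>

definition polynomial_ring :: "'v set \<Rightarrow> (('v \<Rightarrow>\<^sub>0 nat) \<Rightarrow>\<^sub>0 'k::field) ring" where
  "polynomial_ring V =
     \<lparr> carrier = {p. \<forall>a\<in>Poly_Mapping.keys p. Poly_Mapping.keys a \<subseteq> V},
       monoid.mult = (*), one = 1, ring.zero = 0, add = (+) \<rparr>"

definition variable :: "'v \<Rightarrow> ('v \<Rightarrow>\<^sub>0 nat) \<Rightarrow>\<^sub>0 'k::field" where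
  "variable v = Poly_Mapping.single (Poly_Mapping.single v 1) 1"

definition squarefree_monomial :: "'v set \<Rightarrow> ('v \<Rightarrow>\<^sub>0 nat) \<Rightarrow>\<^sub>0 'k::field" where
  "squarefree_monomial \<sigma> = (\<Prod>v\<in>\<sigma>. variable v)"

definition stanley_reisner_ideal :: "'v set set \<Rightarrow> (('v \<Rightarrow>\<^sub>0 nat) \<Rightarrow>\<^sub>0 'k::field) set" where
  "stanley_reisner_ideal \<Delta> =
     genideal (polynomial_ring (vertices \<Delta>))
       (squarefree_monomial ` {\<sigma>. \<sigma> \<subseteq> vertices \<Delta> \<and> \<sigma> \<notin> \<Delta>})"

definition stanley_reisner_ring :: "'v set set \<Rightarrow> (('v \<Rightarrow>\<^sub>0 nat) \<Rightarrow>\<^sub>0 'k::field) set ring" where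
  "stanley_reisner_ring \<Delta> = polynomial_ring (vertices \<Delta>) Quot stanley_reisner_ideal \<Delta>"

text \<open>The graded maximal ideal of the Stanley-Reisner ring, generated by the classes of the variables.\<close>

definition irrelevant_ideal :: "'v set set \<Rightarrow> (('v \<Rightarrow>\<^sub>0 nat) \<Rightarrow>\<^sub>0 'k::field) set set" where
  "irrelevant_ideal \<Delta> =
     genideal (stanley_reisner_ring \<Delta>)
       ((\<lambda>v. stanley_reisner_ideal \<Delta> +>\<^bsub>polynomial_ring (vertices \<Delta>)\<^esub> variable v) ` vertices \<Delta>)"

text \<open>Depth is taken, as usual for graded rings, with respect to the graded maximal ideal.\<close>

definition cohen_macaulay :: "'k::field itself \<Rightarrow> 'v set set \<Rightarrow> bool" where
  "cohen_macaulay K \<Delta> \<longleftrightarrow>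
     ring_depth (stanley_reisner_ring \<Delta> :: (('v \<Rightarrow>\<^sub>0 nat) \<Rightarrow>\<^sub>0 'k) set ring) (irrelevant_ideal \<Delta>) =
     krull_dim (stanley_reisner_ring \<Delta> :: (('v \<Rightarrow>\<^sub>0 nat) \<Rightarrow>\<^sub>0 'k) set ring)"

end

theory Submission
  imports Defs "HOL-Computational_Algebra.Formal_Power_Series"
begin

text \<open>
  Let \<open>V\<close>, \<open>W\<^sub>i\<close> be the vertex sets of \<open>\<Delta>\<close>, \<open>\<Gamma>\<^sub>i\<close>, let \<open>E = \<Delta> \<union> \<Union>\<^sub>i Pow W\<^sub>i\<close>, and let \<open>K\<close> be the ideal of
  \<open>R = k[V]\<close> spanned by the monomials with support outside \<open>E\<close>. Counting faces shows that right hand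
  side minus left hand side of the inequality is the \<open>k\<close>-th coefficient of \<open>(1 - t)\<^sup>d Hilb(K)\<close>.

  Adding the simplices \<open>Pow W\<^sub>i\<close> to \<open>\<Delta>\<close> one at a time, the ideals are intersected, while their sum
  is the ideal of \<open>\<Gamma>\<^sub>i\<close>, because \<open>\<Gamma>\<^sub>i\<close> is full and the \<open>W\<^sub>i\<close> are disjoint. If \<open>\<theta>\<^sub>1, \<dots>, \<theta>\<^sub>d\<close> is regular
  modulo \<open>A\<close> and \<open>B\<close>, and \<open>\<theta>\<^sub>1, \<dots>, \<theta>\<^bsub>d-1\<^esub>\<close> is regular modulo \<open>A + B\<close>, then \<open>\<theta>\<^sub>1, \<dots>, \<theta>\<^sub>d\<close> is regular modulo
  \<open>A \<inter> B\<close>. Hence \<open>d\<close> generic linear forms are regular both on \<open>R\<close> and on \<open>R / K\<close>, and the coefficient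
  is the dimension of the image of \<open>K\<close> in \<open>R / (\<theta>\<^sub>1, \<dots>, \<theta>\<^sub>d)\<close> in degree \<open>k\<close>. It is nonnegative. Since one
  further linear form is regular on this quotient (unless \<open>K = 0\<close>), once the image of \<open>K\<close> is nonzero
  in some degree it stays nonzero in all higher degrees, which gives the equality case.

  The Cohen-Macaulay hypothesis provides regular sequences of possibly inhomogeneous elements only;
  an exchange argument replaces them by generic linear forms.
\<close>

section \<open>Ideals and regular sequences\<close>

locale comm_subring =
  fixes S :: "'a::comm_ring_1 set"
  assumes zero_S [simp, intro]: "0 \<in> S"
    and one_S [simp, intro]: "1 \<in> S"
    and add_S [simp, intro]: "x \<in> S \<Longrightarrow> y \<in> S \<Longrightarrow> x + y \<in> S"
    and uminus_S [simp, intro]: "x \<in> S \<Longrightarrow> - x \<in> S"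
    and mult_S [simp, intro]: "x \<in> S \<Longrightarrow> y \<in> S \<Longrightarrow> x * y \<in> S"
begin

lemma diff_S [simp, intro]: "x \<in> S \<Longrightarrow> y \<in> S \<Longrightarrow> x - y \<in> S"
  using add_S[of x "- y"] by simp

lemma power_S [simp, intro]: "x \<in> S \<Longrightarrow> x ^ n \<in> S"
  by (induction n) auto

lemma sum_S: "(\<And>i. i \<in> A \<Longrightarrow> f i \<in> S) \<Longrightarrow> sum f A \<in> S"
  by (induction A rule: infinite_finite_induct) auto

definition idl :: "'a set \<Rightarrow> bool" where
  "idl L \<longleftrightarrow> L \<subseteq> S \<and> 0 \<in> L \<and> (\<forall>a\<in>L. \<forall>b\<in>L. a + b \<in> L) \<and> (\<forall>a\<in>L. \<forall>s\<in>S. s * a \<in> L)"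

definition adjoin :: "'a set \<Rightarrow> 'a \<Rightarrow> 'a set" where
  "adjoin L x = {l + x * f | l f. l \<in> L \<and> f \<in> S}"

definition reg :: "'a set \<Rightarrow> 'a \<Rightarrow> bool" where
  "reg L x \<longleftrightarrow> (\<forall>f\<in>S. x * f \<in> L \<longrightarrow> f \<in> L)"

fun adjoins :: "'a set \<Rightarrow> 'a list \<Rightarrow> 'a set" where
  "adjoins L [] = L"
| "adjoins L (x # xs) = adjoins (adjoin L x) xs"

text \<open>Weaker than \<open>regular_sequence\<close>: the ideal reached at the end may be all of
  \<open>S\<close>.\<close>

fun reg_seq :: "'a set \<Rightarrow> 'a list \<Rightarrow> bool" where
  "reg_seq L [] \<longleftrightarrow> True"
| "reg_seq L (x # xs) \<longleftrightarrow> reg L x \<and> reg_seq (adjoin L x) xs"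

lemma idlI:
  assumes "L \<subseteq> S" "0 \<in> L" "\<And>a b. a \<in> L \<Longrightarrow> b \<in> L \<Longrightarrow> a + b \<in> L"
    "\<And>a s. a \<in> L \<Longrightarrow> s \<in> S \<Longrightarrow> s * a \<in> L"
  shows "idl L"
  using assms by (auto simp: idl_def)

lemma idl_sub: "idl L \<Longrightarrow> x \<in> L \<Longrightarrow> x \<in> S"
  and idl_0: "idl L \<Longrightarrow> 0 \<in> L"
  and idl_add: "idl L \<Longrightarrow> x \<in> L \<Longrightarrow> y \<in> L \<Longrightarrow> x + y \<in> L"
  and idl_mult: "idl L \<Longrightarrow> x \<in> L \<Longrightarrow> s \<in> S \<Longrightarrow> s * x \<in> L"
  by (auto simp: idl_def)

lemma idl_mult2: "idl L \<Longrightarrow> x \<in> L \<Longrightarrow> s \<in> S \<Longrightarrow> x * s \<in> L"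
  by (metis idl_mult mult.commute)

lemma idl_uminus: "idl L \<Longrightarrow> x \<in> L \<Longrightarrow> - x \<in> L"
  using idl_mult[of L x "- 1"] by simp

lemma idl_diff: "idl L \<Longrightarrow> x \<in> L \<Longrightarrow> y \<in> L \<Longrightarrow> x - y \<in> L"
  using idl_add[of L x "- y"] idl_uminus[of L y] by simp

lemma idl_eqI: "x - y \<in> L \<Longrightarrow> idl L \<Longrightarrow> y \<in> L \<Longrightarrow> x \<in> L"
  using idl_add[of L "x - y" y] by simp

lemma adjoinI: "l \<in> L \<Longrightarrow> f \<in> S \<Longrightarrow> l + x * f \<in> adjoin L x"
  by (auto simp: adjoin_def)

lemma adjoinE:
  assumes "p \<in> adjoin L x" obtains l f where "l \<in> L" "f \<in> S" "p = l + x * f"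
  using assms by (auto simp: adjoin_def)

lemma adjoin_base: "l \<in> L \<Longrightarrow> l \<in> adjoin L x"
  using adjoinI[of l L 0 x] by simp

lemma idl_adjoin:
  assumes "idl L" "x \<in> S"
  shows "idl (adjoin L x)"
proof (rule idlI)
  show "adjoin L x \<subseteq> S"
    using assms by (auto simp: adjoin_def intro: idl_sub)
  show "0 \<in> adjoin L x"
    using assms by (simp add: adjoin_base idl_0)
next
  fix a b assume "a \<in> adjoin L x" "b \<in> adjoin L x"
  then obtain l f l' f' where "l \<in> L" "f \<in> S" "l' \<in> L" "f' \<in> S" "a = l + x * f" "b = l' + x * f'"
    by (metis adjoinE)
  then show "a + b \<in> adjoin L x"
    using adjoinI[of "l + l'" L "f + f'" x] assms by (simp add: idl_add algebra_simps)
next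
  fix a s assume "a \<in> adjoin L x" "s \<in> S"
  then obtain l f where "l \<in> L" "f \<in> S" "a = l + x * f"
    by (metis adjoinE)
  then show "s * a \<in> adjoin L x"
    using adjoinI[of "s * l" L "s * f" x] assms \<open>s \<in> S\<close>
    by (simp add: idl_mult distrib_left mult.left_commute)
qed

lemma adjoin_commute: "adjoin (adjoin L x) y = adjoin (adjoin L y) x"
proof -
  have "adjoin (adjoin L x) y \<subseteq> adjoin (adjoin L y) x" for x y
  proof
    fix p assume "p \<in> adjoin (adjoin L x) y"
    then obtain l f g where "l \<in> L" "f \<in> S" "g \<in> S" "p = l + x * f + y * g"
      by (metis adjoinE)
    moreover from this have "(l + y * g) + x * f \<in> adjoin (adjoin L y) x"
      by (intro adjoinI)
    ultimately show "p \<in> adjoin (adjoin L y) x" by (simp add: algebra_simps)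
  qed
  then show ?thesis by blast
qed

lemma idl_adjoins: "idl L \<Longrightarrow> set xs \<subseteq> S \<Longrightarrow> idl (adjoins L xs)"
  by (induction xs arbitrary: L) (auto simp: idl_adjoin)

lemma adjoins_base: "l \<in> L \<Longrightarrow> l \<in> adjoins L xs"
  by (induction xs arbitrary: L) (auto simp: adjoin_base)

lemma adjoin_mono: "A \<subseteq> B \<Longrightarrow> adjoin A x \<subseteq> adjoin B x"
  by (auto simp: adjoin_def)

lemma adjoins_mono: "A \<subseteq> B \<Longrightarrow> adjoins A xs \<subseteq> adjoins B xs"
  by (induction xs arbitrary: A B) (simp_all add: adjoin_mono)

lemma adjoins_snoc: "adjoins L (xs @ [x]) = adjoin (adjoins L xs) x"
  by (induction xs arbitrary: L) auto

lemma reg_seq_append: "reg_seq L (xs @ ys) \<longleftrightarrow> reg_seq L xs \<and> reg_seq (adjoins L xs) ys"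
  by (induction xs arbitrary: L) auto

lemma reg_seq_take: "reg_seq L xs \<Longrightarrow> reg_seq L (take n xs)"
  using reg_seq_append[of L "take n xs" "drop n xs"] by simp

lemma regD: "reg L x \<Longrightarrow> f \<in> S \<Longrightarrow> x * f \<in> L \<Longrightarrow> f \<in> L"
  by (auto simp: reg_def)

lemma regI: "(\<And>f. f \<in> S \<Longrightarrow> x * f \<in> L \<Longrightarrow> f \<in> L) \<Longrightarrow> reg L x"
  by (auto simp: reg_def)

lemma reg_power: "reg L x \<Longrightarrow> x \<in> S \<Longrightarrow> f \<in> S \<Longrightarrow> x ^ n * f \<in> L \<Longrightarrow> f \<in> L"
proof (induction n)
  case (Suc n)
  then have "x * (x ^ n * f) \<in> L" by (simp add: mult.assoc)
  then show ?case using Suc regD[of L x "x ^ n * f"] by simp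
qed simp

text \<open>A relation \<open>x * f = l + z * g\<close> makes \<open>z * g\<close> vanish modulo
  \<open>L\<close> and \<open>x\<close>; hence \<open>g\<close> is a multiple of \<open>x\<close>
  modulo \<open>L\<close>, and \<open>x\<close> cancels. Only this half of permutability holds
  without Nakayama; regularity of \<open>z\<close> modulo \<open>L\<close> has to be secured by a
  generic choice of \<open>z\<close>.\<close>

lemma reg_adjoin_swap:
  assumes "idl L" "x \<in> S" "z \<in> S" "reg L x" "reg (adjoin L x) z"
  shows "reg (adjoin L z) x"
proof (rule regI)
  fix f assume f: "f \<in> S" and "x * f \<in> adjoin L z"
  then obtain l g where lg: "l \<in> L" "g \<in> S" "x * f = l + z * g"
    by (metis adjoinE)
  have "z * g = - l + x * f" using lg by (simp add: algebra_simps)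
  then have "z * g \<in> adjoin L x"
    using adjoinI[of "- l" L f x] idl_uminus[OF assms(1)] lg(1) f by simp
  then have "g \<in> adjoin L x" using assms lg regD by blast
  then obtain l' g' where g': "l' \<in> L" "g' \<in> S" "g = l' + x * g'"
    by (metis adjoinE)
  have "x * (f - z * g') = l + z * l'" using lg(3) g'(3) by (simp add: algebra_simps)
  then have "x * (f - z * g') \<in> L" using assms g' lg by (simp add: idl_add idl_mult)
  then have "f - z * g' \<in> L"
    using regD[OF assms(4), of "f - z * g'"] f g' assms by simp
  then have "(f - z * g') + z * g' \<in> adjoin L z" using g' by (intro adjoinI)
  then show "f \<in> adjoin L z" by simp
qed

section \<open>Intersections\<close>

definition ideal_sum :: "'a set \<Rightarrow> 'a set \<Rightarrow> 'a set" where
  "ideal_sum A B = {a + b | a b. a \<in> A \<and> b \<in> B}"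

lemma ideal_sum_adjoin:
  assumes "idl A" "idl B" "x \<in> S"
  shows "ideal_sum (adjoin A x) (adjoin B x) = adjoin (ideal_sum A B) x"
proof (intro equalityI subsetI)
  fix p assume "p \<in> ideal_sum (adjoin A x) (adjoin B x)"
  then obtain a f b g where *: "a \<in> A" "f \<in> S" "b \<in> B" "g \<in> S" "p = (a + x * f) + (b + x * g)"
    by (auto simp: ideal_sum_def adjoin_def)
  then have "(a + b) + x * (f + g) \<in> adjoin (ideal_sum A B) x"
    by (intro adjoinI) (auto simp: ideal_sum_def)
  then show "p \<in> adjoin (ideal_sum A B) x" using * by (simp add: algebra_simps)
next
  fix p assume "p \<in> adjoin (ideal_sum A B) x"
  then obtain a b f where *: "a \<in> A" "b \<in> B" "f \<in> S" "p = (a + b) + x * f"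
    by (auto simp: ideal_sum_def adjoin_def)
  then have "p = (a + x * f) + b" "a + x * f \<in> adjoin A x" "b \<in> adjoin B x"
    by (auto simp: adjoinI adjoin_base)
  then show "p \<in> ideal_sum (adjoin A x) (adjoin B x)" unfolding ideal_sum_def by blast
qed

text \<open>The exact sequence 0 -> S/(A \<inter> B) -> S/A \<oplus> S/B -> S/(A + B) -> 0 stays
  exact modulo \<open>x\<close> because \<open>x\<close> is regular on the last term.\<close>

lemma adjoin_Int:
  assumes "idl A" "idl B" "x \<in> S" "reg (ideal_sum A B) x"
  shows "adjoin A x \<inter> adjoin B x = adjoin (A \<inter> B) x"
proof (intro equalityI subsetI)
  fix p assume "p \<in> adjoin A x \<inter> adjoin B x"
  then obtain a f b g where *: "a \<in> A" "f \<in> S" "b \<in> B" "g \<in> S" "p = a + x * f" "p = b + x * g"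
    by (metis IntE adjoinE)
  then have "x * (g - f) = a + (- b)" by (simp add: algebra_simps)
  then have "x * (g - f) \<in> ideal_sum A B" using * assms idl_uminus unfolding ideal_sum_def by blast
  then have "g - f \<in> ideal_sum A B" using * assms by (auto intro: regD)
  then obtain a' b' where ab: "a' \<in> A" "b' \<in> B" "g - f = a' + b'"
    by (auto simp: ideal_sum_def)
  \<comment> \<open>The two representations of \<open>p\<close> are corrected by \<open>a'\<close>
    and \<open>b'\<close> until their parts in \<open>A\<close> and \<open>B\<close> agree; the
    common value is \<open>a - x * a' = b + x * b'\<close>.\<close>
  define c where "c = a - x * a'"
  have g: "g = f + a' + b'" using ab(3) by (simp add: algebra_simps)
  have "c = b + x * b'" using *(5,6) unfolding c_def g by (simp add: algebra_simps)
  moreover have "c \<in> A" unfolding c_def using * ab assms by (auto intro: idl_diff idl_mult)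
  ultimately have "c \<in> A \<inter> B" using * ab assms by (auto intro: idl_add idl_mult)
  then have "c + x * (f + a') \<in> adjoin (A \<inter> B) x"
    using * ab assms by (intro adjoinI) (auto intro: idl_sub)
  then show "p \<in> adjoin (A \<inter> B) x" using * by (simp add: c_def algebra_simps)
qed (auto simp: adjoin_def)

text \<open>The last element only has to be regular modulo \<open>A \<inter> B\<close>, which
  follows from \<open>A\<close> and \<open>B\<close>; each earlier one must also make the
  intersection commute with adjoining it, and this needs regularity modulo the sum. Hence
  \<open>butlast\<close>.\<close>

lemma reg_seq_Int:
  assumes "idl A" "idl B" "set xs \<subseteq> S" "reg_seq A xs" "reg_seq B xs"
    "reg_seq (ideal_sum A B) (butlast xs)"
  shows "reg_seq (A \<inter> B) xs"
  using assms
proof (induction xs arbitrary: A B)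
  case Nil
  then show ?case by simp
next
  case (Cons x xs)
  have r: "reg (A \<inter> B) x" using Cons.prems by (auto simp: reg_def)
  show ?case
  proof (cases "xs = []")
    case True
    then show ?thesis using r by simp
  next
    case False
    then have *: "reg (ideal_sum A B) x" "reg_seq (adjoin (ideal_sum A B) x) (butlast xs)"
      using Cons.prems by auto
    have "reg_seq (adjoin A x \<inter> adjoin B x) xs"
      using Cons.prems * by (intro Cons.IH) (auto simp: idl_adjoin ideal_sum_adjoin)
    then show ?thesis using r * Cons.prems adjoin_Int[of A B x] by simp
  qed
qed

section \<open>Noetherian subrings\<close>

definition noetherian :: bool where
  "noetherian \<longleftrightarrow> wf {(J, I). idl I \<and> idl J \<and> I \<subset> J}"

lemma noetherian_maximal:
  assumes noetherian "I \<in> \<I>" "\<And>J. J \<in> \<I> \<Longrightarrow> idl J"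
  obtains J where "J \<in> \<I>" "I \<subseteq> J" "\<And>J'. J' \<in> \<I> \<Longrightarrow> J \<subseteq> J' \<Longrightarrow> J' = J"
proof -
  have "I \<in> {J \<in> \<I>. I \<subseteq> J}" using assms by auto
  from wfE_min[OF assms(1)[unfolded noetherian_def] this]
  obtain J where "J \<in> {J \<in> \<I>. I \<subseteq> J}"
    "\<And>J'. (J', J) \<in> {(J, I). idl I \<and> idl J \<and> I \<subset> J} \<Longrightarrow> J' \<notin> {J \<in> \<I>. I \<subseteq> J}"
    by blast
  then have "J \<in> \<I>" "I \<subseteq> J" "\<And>J'. J' \<in> \<I> \<Longrightarrow> J \<subseteq> J' \<Longrightarrow> J' = J"
    using assms(3) by blast+
  then show thesis by (rule that)
qed

lemma noetherian_chain:
  assumes noetherian "\<And>n. idl (J n)" "\<And>n. J n \<subseteq> J (Suc n)"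
  obtains N where "\<And>n. n \<ge> N \<Longrightarrow> J n = J N"
proof -
  obtain M where M: "M \<in> range J" "\<And>J'. J' \<in> range J \<Longrightarrow> M \<subseteq> J' \<Longrightarrow> J' = M"
  proof (rule noetherian_maximal[OF assms(1), of "J 0" "range J"])
    show "idl J'" if "J' \<in> range J" for J' using that assms(2) by auto
  qed auto
  then obtain N where "M = J N" by blast
  have "J n = J N" if "n \<ge> N" for n
    using M(2)[of "J n"] lift_Suc_mono_le[of J N n] assms(3) that \<open>M = J N\<close> by auto
  then show thesis by (rule that)
qed

definition colon :: "'a set \<Rightarrow> 'a \<Rightarrow> 'a set" where
  "colon L g = {u \<in> S. u * g \<in> L}"

lemma idl_colon: "idl L \<Longrightarrow> g \<in> S \<Longrightarrow> idl (colon L g)"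
  by (rule idlI) (auto simp: colon_def idl_0 idl_add idl_mult distrib_right mult.assoc)

text \<open>Vanishing of the socle of \<open>S / L\<close> with respect to \<open>M\<close>. In the
  Noetherian setting it stands for the existence of a regular element in \<open>M\<close>, without
  naming one.\<close>

definition socle_free :: "'a set \<Rightarrow> 'a set \<Rightarrow> bool" where
  "socle_free M L \<longleftrightarrow> (\<forall>f\<in>S. (\<forall>x\<in>M. x * f \<in> L) \<longrightarrow> f \<in> L)"

text \<open>A Noetherian substitute for "finitely many associated primes": if the \<open>z a\<close> were zero
  divisors for infinitely many \<open>a\<close>, they would lie in infinitely many distinct maximal colon
  ideals \<open>P j\<close>, and the ideals \<open>L : (P 0 \<inter> \<dots> \<inter> P (j - 1))\<close> would form a strictly ascending chain.\<close>

lemma finite_not_reg: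
  fixes z :: "'k \<Rightarrow> 'a"
  assumes noeth: noetherian and L: "idl L" and sf: "socle_free M L"
    and zS: "\<And>a. z a \<in> S"
    and gen: "\<And>P. idl P \<Longrightarrow> infinite {a. z a \<in> P} \<Longrightarrow> M \<subseteq> P"
  shows "finite {a. \<not> reg L (z a)}"
proof (rule ccontr)
  let ?B = "{a. \<not> reg L (z a)}"
  assume inf: "infinite ?B"
  define \<C> where "\<C> = {colon L g | g. g \<in> S \<and> g \<notin> L}"
  have C_idl: "idl J" if "J \<in> \<C>" for J using that L by (auto simp: \<C>_def idl_colon)
  define \<P> where "\<P> = {P \<in> \<C>. \<forall>J\<in>\<C>. P \<subseteq> J \<longrightarrow> J = P}"
  have P_colon: "\<exists>g\<in>S. g \<notin> L \<and> P = colon L g" if "P \<in> \<P>" for P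
    using that by (auto simp: \<P>_def \<C>_def)
  have cover: "\<exists>P\<in>\<P>. z a \<in> P" if "a \<in> ?B" for a
  proof -
    from that obtain f where f: "f \<in> S" "z a * f \<in> L" "f \<notin> L" by (auto simp: reg_def)
    then have "colon L f \<in> \<C>" by (auto simp: \<C>_def)
    then obtain J where "J \<in> \<C>" "colon L f \<subseteq> J" "\<And>J'. J' \<in> \<C> \<Longrightarrow> J \<subseteq> J' \<Longrightarrow> J' = J"
      using noetherian_maximal[OF noeth _ C_idl] by metis
    moreover have "z a \<in> colon L f" using f zS by (auto simp: colon_def)
    ultimately show ?thesis by (auto simp: \<P>_def)
  qed
  have fin: "finite {a. z a \<in> P}" if Pin: "P \<in> \<P>" for P
  proof (rule ccontr)
    assume "infinite {a. z a \<in> P}"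
    then have "M \<subseteq> P" using gen Pin C_idl by (auto simp: \<P>_def)
    moreover obtain g where "P = colon L g" "g \<in> S" "g \<notin> L" using P_colon Pin by blast
    ultimately show False using sf unfolding socle_free_def colon_def by blast
  qed
  \<comment> \<open>Multiplying \<open>g\<close> by \<open>u\<close> can only enlarge the colon
    ideal, and \<open>u * g\<close> stays outside \<open>L\<close>; maximality then forces
    equality.\<close>
  have prime: "v \<in> P" if P: "P \<in> \<P>" and uv: "u \<in> S" "v \<in> S" "u * v \<in> P" "u \<notin> P" for P u v
  proof -
    obtain g where g: "P = colon L g" "g \<in> S" "g \<notin> L" using P_colon P by blast
    then have "u * g \<notin> L" using uv by (auto simp: colon_def)
    then have "colon L (u * g) \<in> \<C>" using g uv by (auto simp: \<C>_def)
    moreover have "P \<subseteq> colon L (u * g)"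
    proof
      fix w assume "w \<in> P"
      then have "w \<in> S" "u * (w * g) \<in> L" using g uv L by (auto simp: colon_def idl_mult)
      then show "w \<in> colon L (u * g)" by (simp add: colon_def mult.left_commute)
    qed
    ultimately have "colon L (u * g) = P" using P by (auto simp: \<P>_def)
    moreover have "v \<in> colon L (u * g)" using g uv by (auto simp: colon_def mult_ac)
    ultimately show ?thesis by simp
  qed
  have "infinite \<P>"
  proof
    assume "finite \<P>"
    then have "finite (\<Union>P\<in>\<P>. {a. z a \<in> P})" using fin by auto
    moreover have "?B \<subseteq> (\<Union>P\<in>\<P>. {a. z a \<in> P})" using cover by auto
    ultimately show False using inf finite_subset by blast
  qed
  then obtain P :: "nat \<Rightarrow> 'a set" where P: "inj P" "range P \<subseteq> \<P>"
    using infinite_countable_subset by metis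
  then have PP: "P j \<in> \<P>" for j by auto
  have Pne: "1 \<notin> P j" for j
    using PP[of j] by (auto simp: \<P>_def \<C>_def colon_def)
  have Pidl: "idl (P j)" for j using PP C_idl by (auto simp: \<P>_def)
  define Q where "Q j = {u \<in> S. \<forall>i<j. u \<in> P i}" for j :: nat
  define J where "J j = {f \<in> S. \<forall>u\<in>Q j. u * f \<in> L}" for j
  have "idl (J j)" for j
    by (rule idlI) (use L in \<open>auto simp: J_def Q_def idl_0 idl_add idl_mult distrib_left mult.left_commute\<close>)
  moreover have "J j \<subseteq> J (Suc j)" for j by (auto simp: J_def Q_def)
  ultimately obtain N where N: "J (Suc N) = J N"
    using noetherian_chain[OF noeth, of J] by (metis lessI less_imp_le)
  obtain g where g: "P N = colon L g" "g \<in> S" "g \<notin> L" using P_colon PP[of N] by blast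
  \<comment> \<open>\<open>P N\<close> annihilates \<open>g\<close> modulo \<open>L\<close>, hence
    so does the smaller ideal \<open>Q (Suc N)\<close>. As the chain is stationary, already
    \<open>Q N\<close> annihilates \<open>g\<close>.\<close>
  have "g \<in> J (Suc N)" using g by (auto simp: J_def Q_def colon_def)
  then have "g \<in> J N" using N by simp
  then have sub: "Q N \<subseteq> P N" using g by (auto simp: J_def Q_def colon_def)
  \<comment> \<open>A prime containing a finite intersection contains one of the ideals: otherwise a
    product of elements \<open>u i\<close>, taken from \<open>P i\<close> but outside
    \<open>P N\<close>, lies in \<open>Q N\<close> and not in \<open>P N\<close>.\<close>
  have "\<exists>i<N. P i \<subseteq> P N"
  proof (rule ccontr)
    assume "\<not> (\<exists>i<N. P i \<subseteq> P N)"
    then have "\<forall>i. \<exists>u. i < N \<longrightarrow> u \<in> P i \<and> u \<notin> P N" by blast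
    then obtain u where u: "\<And>i. i < N \<Longrightarrow> u i \<in> P i \<and> u i \<notin> P N" by metis
    have "prod u {..<n} \<in> Q n \<and> prod u {..<n} \<notin> P N" if "n \<le> N" for n
      using that
    proof (induction n)
      case 0
      then show ?case using Pne by (auto simp: Q_def)
    next
      case (Suc n)
      have un: "u n \<in> S" "u n \<in> P n" "u n \<notin> P N" using Suc.prems u[of n] Pidl idl_sub by auto
      have IH: "prod u {..<n} \<in> Q n" "prod u {..<n} \<notin> P N" using Suc by auto
      then have "u n * prod u {..<n} \<in> Q (Suc n)"
        using un Pidl by (auto simp: Q_def less_Suc_eq intro: idl_mult idl_mult2)
      moreover have "u n * prod u {..<n} \<notin> P N"
        using prime[OF PP[of N], of "u n" "prod u {..<n}"] IH un by (auto simp: Q_def)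
      ultimately show ?case by (simp add: mult.commute)
    qed
    from this[of N] show False using sub by auto
  qed
  then obtain i where i: "i < N" "P i \<subseteq> P N" by blast
  then have "P N = P i" using PP[of i] PP[of N] by (auto simp: \<P>_def)
  then show False using P(1) i by (auto dest: injD)
qed

end

section \<open>Generic regular sequences\<close>

text \<open>By \<open>z_gen\<close>, an ideal that does not contain \<open>M\<close> catches only
  finitely many members of the family \<open>z\<close>; as there are infinitely many parameters, one
  member can be chosen to suit finitely many ideals at once. \<open>M\<close> stands for the graded
  maximal ideal, but no grading is mentioned, so that inhomogeneous regular sequences are
  covered.\<close>

locale generic_forms = comm_subring S for S :: "'a::comm_ring_1 set" +
  fixes M :: "'a set" and z :: "'k \<Rightarrow> 'a"
  assumes M_sub: "M \<subseteq> S"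
    and noeth: noetherian
    and z_in: "z a \<in> M"
    and z_gen: "idl P \<Longrightarrow> infinite {a. z a \<in> P} \<Longrightarrow> M \<subseteq> P"
    and inf_k: "infinite (UNIV :: 'k set)"
begin

definition depth_ge :: "nat \<Rightarrow> 'a set \<Rightarrow> bool" where
  "depth_ge r L \<longleftrightarrow> (\<exists>xs. length xs = r \<and> set xs \<subseteq> M \<and> reg_seq L xs)"

lemma depth_ge_0: "depth_ge 0 L"
  by (auto simp: depth_ge_def)

lemma depth_ge_Suc: "depth_ge (Suc r) L \<longleftrightarrow> (\<exists>x\<in>M. reg L x \<and> depth_ge r (adjoin L x))"
proof
  assume "depth_ge (Suc r) L"
  then obtain x xs where "length xs = r" "set (x # xs) \<subseteq> M" "reg_seq L (x # xs)"
    unfolding depth_ge_def length_Suc_conv by blast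
  then show "\<exists>x\<in>M. reg L x \<and> depth_ge r (adjoin L x)" by (auto simp: depth_ge_def)
next
  assume "\<exists>x\<in>M. reg L x \<and> depth_ge r (adjoin L x)"
  then obtain x xs where "length (x # xs) = Suc r" "set (x # xs) \<subseteq> M" "reg_seq L (x # xs)"
    by (auto simp: depth_ge_def)
  then show "depth_ge (Suc r) L" unfolding depth_ge_def by blast
qed

lemma depth_ge_mono: "depth_ge r L \<Longrightarrow> s \<le> r \<Longrightarrow> depth_ge s L"
  unfolding depth_ge_def using reg_seq_take set_take_subset
  by (metis length_take min.absorb2 subset_trans)

lemma MS: "x \<in> M \<Longrightarrow> x \<in> S"
  using M_sub by auto

lemma reg_socle_free: "x \<in> M \<Longrightarrow> reg L x \<Longrightarrow> socle_free M L"
  by (auto simp: socle_free_def reg_def)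

text \<open>Sending \<open>f\<close> to \<open>g\<close>, where \<open>x * f = y * g\<close> modulo
  \<open>L\<close>, carries the socle modulo \<open>L\<close> and \<open>y\<close> to the socle
  modulo \<open>L\<close> and \<open>x\<close>; both compute the same first Ext module of
  \<open>S / L\<close>.\<close>

lemma socle_free_exchange:
  assumes "idl L" "x \<in> M" "y \<in> M" "reg L x" "reg L y" "socle_free M (adjoin L x)"
  shows "socle_free M (adjoin L y)"
  unfolding socle_free_def
proof (intro ballI impI)
  fix f assume f: "f \<in> S" and fM: "\<forall>u\<in>M. u * f \<in> adjoin L y"
  have xy: "x \<in> S" "y \<in> S" using assms MS by auto
  obtain l g where lg: "l \<in> L" "g \<in> S" "x * f = l + y * g"
    using fM assms(2) by (metis adjoinE)
  have "u * g \<in> adjoin L x" if u: "u \<in> M" for u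
  proof -
    obtain l' h where h: "l' \<in> L" "h \<in> S" "u * f = l' + y * h"
      using fM u by (metis adjoinE)
    \<comment> \<open>The product is expanded in two ways, through \<open>u * f\<close> and through
      \<open>x * f\<close>; then \<open>y\<close> is cancelled modulo \<open>L\<close>.\<close>
    have "x * (u * f) = u * (x * f)" by (simp add: mult_ac)
    then have "y * (u * g - x * h) = x * l' - u * l"
      unfolding h(3) lg(3) by (simp add: algebra_simps)
    then have "y * (u * g - x * h) \<in> L"
      using assms(1) lg(1) h(1) MS[OF u] xy by (simp add: idl_diff idl_mult)
    then have "u * g - x * h \<in> L"
      using regD[OF assms(5), of "u * g - x * h"] lg(2) h(2) MS[OF u] xy by simp
    then have "(u * g - x * h) + x * h \<in> adjoin L x" using h by (intro adjoinI)
    then show ?thesis by simp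
  qed
  then have "g \<in> adjoin L x" using assms(6) lg by (auto simp: socle_free_def)
  then obtain l'' h where h: "l'' \<in> L" "h \<in> S" "g = l'' + x * h" by (metis adjoinE)
  have "x * (f - y * h) = l + y * l''" using lg(3) unfolding h(3) by (simp add: algebra_simps)
  then have "x * (f - y * h) \<in> L" using assms(1) lg(1) h xy by (simp add: idl_add idl_mult)
  then have "f - y * h \<in> L" using regD[OF assms(4), of "f - y * h"] f h xy by simp
  then have "(f - y * h) + y * h \<in> adjoin L y" using h by (intro adjoinI)
  then show "f \<in> adjoin L y" by simp
qed

lemma finite_bad:
  "idl L \<Longrightarrow> socle_free M L \<Longrightarrow> finite {a. \<not> reg L (z a)}"
  using finite_not_reg[OF noeth, of L M z] z_in z_gen MS by blast

lemma generic_reg: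
  assumes "finite \<L>" "\<And>L. L \<in> \<L> \<Longrightarrow> idl L \<and> socle_free M L"
  obtains a where "\<And>L. L \<in> \<L> \<Longrightarrow> reg L (z a)"
proof -
  have "finite (\<Union>L\<in>\<L>. {a. \<not> reg L (z a)})" using assms finite_bad by auto
  then obtain a where "a \<notin> (\<Union>L\<in>\<L>. {a. \<not> reg L (z a)})"
    using inf_k ex_new_if_finite by metis
  then show thesis using that by blast
qed

text \<open>A generic \<open>w\<close> is regular modulo \<open>L\<close>, \<open>L + x\<close> and \<open>L + y\<close>; passing through \<open>L + w\<close>
  exchanges \<open>x\<close> for \<open>y\<close> one level deeper.\<close>

lemma depth_ge_adjoin:
  "idl L \<Longrightarrow> y \<in> M \<Longrightarrow> reg L y \<Longrightarrow> depth_ge (Suc r) L \<Longrightarrow> depth_ge r (adjoin L y)"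
proof (induction r arbitrary: L y)
  case 0
  then show ?case by (simp add: depth_ge_0)
next
  case (Suc r)
  obtain x where x: "x \<in> M" "reg L x" "depth_ge (Suc r) (adjoin L x)"
    using Suc.prems(4) depth_ge_Suc by blast
  have S: "x \<in> S" "y \<in> S" using x Suc.prems MS by auto
  have id: "idl (adjoin L x)" "idl (adjoin L y)" using Suc.prems S by (auto simp: idl_adjoin)
  have "socle_free M (adjoin L x)" using x(3) depth_ge_Suc reg_socle_free by blast
  then have sf: "socle_free M (adjoin L y)" "socle_free M L" "socle_free M (adjoin L x)"
    using socle_free_exchange x Suc.prems reg_socle_free by blast+
  obtain a where a: "reg L (z a)" "reg (adjoin L x) (z a)" "reg (adjoin L y) (z a)"
  proof (rule generic_reg[of "{L, adjoin L x, adjoin L y}"])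
    show "idl J \<and> socle_free M J" if "J \<in> {L, adjoin L x, adjoin L y}" for J
      using that sf Suc.prems(1) id by blast
  qed auto
  define w where "w = z a"
  have w: "w \<in> M" "w \<in> S" using z_in MS by (auto simp: w_def)
  note a = a[folded w_def]
  have "depth_ge r (adjoin (adjoin L x) w)" using Suc.IH id x w a by blast
  then have "depth_ge r (adjoin (adjoin L w) x)" by (simp add: adjoin_commute)
  moreover have "reg (adjoin L w) x" "reg (adjoin L w) y"
    using reg_adjoin_swap Suc.prems x S w a by blast+
  \<comment> \<open>The induction hypothesis is used again, now at \<open>adjoin L w\<close>: there
    \<open>x\<close> starts a sequence of length \<open>Suc r\<close>, and \<open>y\<close> may take
    its place.\<close>
  ultimately have "depth_ge r (adjoin (adjoin L w) y)"
    using Suc.IH[of "adjoin L w" y] Suc.prems x w by (auto simp: depth_ge_Suc idl_adjoin)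
  then have "depth_ge r (adjoin (adjoin L y) w)" by (simp add: adjoin_commute)
  then show ?case using a w depth_ge_Suc by blast
qed

text \<open>The lengths \<open>r i\<close> differ because the ideals to be treated have different
  depths. Once \<open>r i\<close> is used up, the later forms are unconstrained modulo
  \<open>L i\<close>; for the other ideals a generic form is regular and costs one unit of depth by
  \<open>depth_ge_adjoin\<close>.\<close>

lemma common_reg_seq:
  fixes L :: "'i \<Rightarrow> 'a set"
  assumes "finite I" "\<And>i. i \<in> I \<Longrightarrow> idl (L i)" "\<And>i. i \<in> I \<Longrightarrow> depth_ge (r i) (L i)"
  shows "\<exists>xs. length xs = N \<and> set xs \<subseteq> range z \<and> (\<forall>i\<in>I. reg_seq (L i) (take (r i) xs))"
  using assms(2,3)
proof (induction N arbitrary: L r)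
  case 0
  then show ?case by simp
next
  case (Suc N)
  have sf: "socle_free M (L i)" if "i \<in> I" "r i > 0" for i
    using Suc.prems(2)[OF that(1)] that(2) depth_ge_Suc[of "r i - 1" "L i"] reg_socle_free
    by auto
  obtain a where a: "\<And>i. i \<in> I \<Longrightarrow> r i > 0 \<Longrightarrow> reg (L i) (z a)"
  proof (rule generic_reg[of "L ` {i \<in> I. r i > 0}"])
    show "idl J \<and> socle_free M J" if "J \<in> L ` {i \<in> I. r i > 0}" for J
      using that sf Suc.prems(1) by auto
  qed (use assms(1) in auto)
  define L' where "L' i = adjoin (L i) (z a)" for i
  define r' where "r' i = r i - 1" for i
  have "idl (L' i)" if "i \<in> I" for i using Suc.prems(1) that z_in MS by (auto simp: L'_def idl_adjoin)
  moreover have "depth_ge (r' i) (L' i)" if i: "i \<in> I" for i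
  proof (cases "r i")
    case 0
    then show ?thesis by (simp add: r'_def depth_ge_0)
  next
    case (Suc s)
    then have "depth_ge (Suc s) (L i)" "reg (L i) (z a)" using Suc.prems(2)[OF i] a[OF i] by auto
    then show ?thesis using depth_ge_adjoin[of "L i" "z a" s] Suc.prems(1)[OF i] z_in Suc
      by (simp add: L'_def r'_def)
  qed
  ultimately obtain xs where xs: "length xs = N" "set xs \<subseteq> range z"
    "\<forall>i\<in>I. reg_seq (L' i) (take (r' i) xs)"
    using Suc.IH[of L' r'] by blast
  have "reg_seq (L i) (take (r i) (z a # xs))" if "i \<in> I" for i
    using xs(3) that a by (cases "r i") (auto simp: L'_def r'_def)
  then show ?case using xs by (intro exI[of _ "z a # xs"]) auto
qed

end

section \<open>Hilbert's basis theorem\<close>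

context comm_subring
begin

lemma noetherianI:
  assumes "\<And>J. (\<And>i. idl (J i)) \<Longrightarrow> (\<And>i. J i \<subset> J (Suc i)) \<Longrightarrow> False"
  shows noetherian
  unfolding noetherian_def wf_iff_no_infinite_down_chain
proof
  assume "\<exists>J. \<forall>i. (J (Suc i), J i) \<in> {(J, I). idl I \<and> idl J \<and> I \<subset> J}"
  then obtain J where "\<And>i. idl (J i) \<and> J i \<subset> J (Suc i)" by blast
  then show False using assms[of J] by blast
qed

text \<open>No algebraic independence of \<open>x\<close> over \<open>S\<close> is required: the "degree" of an element is just
  an upper bound for one of its representations.\<close>

fun deg_lt :: "'a \<Rightarrow> nat \<Rightarrow> 'a set" where
  "deg_lt x 0 = {0}"
| "deg_lt x (Suc n) = {r + s * x ^ n | r s. r \<in> deg_lt x n \<and> s \<in> S}"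

definition lead :: "'a \<Rightarrow> 'a set \<Rightarrow> nat \<Rightarrow> 'a set" where
  "lead x I n = {s \<in> S. \<exists>r\<in>deg_lt x n. r + s * x ^ n \<in> I}"

lemma deg_lt_SucI: "r \<in> deg_lt x n \<Longrightarrow> s \<in> S \<Longrightarrow> r + s * x ^ n \<in> deg_lt x (Suc n)"
  by auto

lemma deg_lt_0: "0 \<in> deg_lt x n"
proof (induction n)
  case (Suc n)
  then show ?case using deg_lt_SucI[of 0 x n 0] by simp
qed simp

lemma deg_lt_add: "p \<in> deg_lt x n \<Longrightarrow> q \<in> deg_lt x n \<Longrightarrow> p + q \<in> deg_lt x n"
proof (induction n arbitrary: p q)
  case (Suc n)
  then obtain r s r' s' where "p = r + s * x ^ n" "q = r' + s' * x ^ n"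
    "r \<in> deg_lt x n" "s \<in> S" "r' \<in> deg_lt x n" "s' \<in> S" by auto
  then have "p + q = (r + r') + (s + s') * x ^ n" "r + r' \<in> deg_lt x n" "s + s' \<in> S"
    using Suc.IH by (auto simp: algebra_simps)
  then show ?case using deg_lt_SucI by metis
qed simp

lemma deg_lt_mult: "p \<in> deg_lt x n \<Longrightarrow> t \<in> S \<Longrightarrow> t * p \<in> deg_lt x n"
proof (induction n arbitrary: p)
  case (Suc n)
  then obtain r s where "p = r + s * x ^ n" "r \<in> deg_lt x n" "s \<in> S" by auto
  then have "t * p = t * r + (t * s) * x ^ n" "t * r \<in> deg_lt x n" "t * s \<in> S"
    using Suc by (auto simp: algebra_simps)
  then show ?case using deg_lt_SucI by metis
qed simp

lemma deg_lt_shift: "p \<in> deg_lt x n \<Longrightarrow> x * p \<in> deg_lt x (Suc n)"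
proof (induction n arbitrary: p)
  case 0
  then show ?case using deg_lt_0 by simp
next
  case (Suc n)
  then obtain r s where "p = r + s * x ^ n" "r \<in> deg_lt x n" "s \<in> S" by auto
  then have "x * p = x * r + s * x ^ Suc n" "x * r \<in> deg_lt x (Suc n)"
    using Suc.IH by (auto simp: algebra_simps)
  then show ?case using deg_lt_SucI \<open>s \<in> S\<close> by metis
qed

lemma deg_lt_mono: "m \<le> n \<Longrightarrow> deg_lt x m \<subseteq> deg_lt x n"
proof (induction rule: dec_induct)
  case (step n)
  then show ?case using deg_lt_SucI[of _ x n 0] by auto
qed simp

lemma deg_lt_sum:
  assumes "finite A" "\<And>i. i \<in> A \<Longrightarrow> f i \<in> (\<Union>n. deg_lt x n)"
  shows "sum f A \<in> (\<Union>n. deg_lt x n)"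
  using assms
proof (induction A rule: finite_induct)
  case empty
  then show ?case using deg_lt_0 by auto
next
  case (insert i A)
  have "f i \<in> (\<Union>n. deg_lt x n)" "sum f A \<in> (\<Union>n. deg_lt x n)" using insert by auto
  then obtain n m where "f i \<in> deg_lt x n" "sum f A \<in> deg_lt x m" by blast
  then have "f i \<in> deg_lt x (max n m)" "sum f A \<in> deg_lt x (max n m)"
    using deg_lt_mono[of n "max n m"] deg_lt_mono[of m "max n m"] by auto
  then have "f i + sum f A \<in> deg_lt x (max n m)" by (rule deg_lt_add)
  then show ?case using insert.hyps by auto
qed

theorem noetherian_extension:
  assumes T: "comm_subring T" and "S \<subseteq> T" "x \<in> T" "T \<subseteq> (\<Union>n. deg_lt x n)"
    and noeth: noetherian
  shows "comm_subring.noetherian T"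
proof -
  interpret T: comm_subring T by fact
  have lead_idl: "idl (lead x I n)" if I: "T.idl I" for I n
  proof (rule idlI)
    show "0 \<in> lead x I n" using deg_lt_0 T.idl_0[OF I] by (force simp: lead_def)
  next
    fix a b assume "a \<in> lead x I n" "b \<in> lead x I n"
    then obtain r r' where *: "a \<in> S" "b \<in> S" "r \<in> deg_lt x n" "r' \<in> deg_lt x n"
      "r + a * x ^ n \<in> I" "r' + b * x ^ n \<in> I" by (auto simp: lead_def)
    have e: "(r + r') + (a + b) * x ^ n = (r + a * x ^ n) + (r' + b * x ^ n)"
      by (simp add: algebra_simps)
    have "(r + r') + (a + b) * x ^ n \<in> I" unfolding e using * T.idl_add[OF I] by blast
    then show "a + b \<in> lead x I n" using * deg_lt_add by (auto simp: lead_def)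
  next
    fix a s assume "a \<in> lead x I n" and s: "s \<in> S"
    then obtain r where *: "a \<in> S" "r \<in> deg_lt x n" "r + a * x ^ n \<in> I" by (auto simp: lead_def)
    have "s * r + (s * a) * x ^ n = s * (r + a * x ^ n)" by (simp add: algebra_simps)
    then have "s * r + (s * a) * x ^ n \<in> I" using * s T.idl_mult[OF I] assms(2) by auto
    then show "s * a \<in> lead x I n" using * s deg_lt_mult by (auto simp: lead_def)
  qed (auto simp: lead_def)
  have lead_Suc: "lead x I n \<subseteq> lead x I (Suc n)" if I: "T.idl I" for I n
  proof
    fix a assume "a \<in> lead x I n"
    then obtain r where *: "a \<in> S" "r \<in> deg_lt x n" "r + a * x ^ n \<in> I" by (auto simp: lead_def)
    have "x * r + a * x ^ Suc n = x * (r + a * x ^ n)" by (simp add: algebra_simps)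
    then have "x * r + a * x ^ Suc n \<in> I" using * T.idl_mult[OF I] assms(3) by auto
    then show "a \<in> lead x I (Suc n)" using * deg_lt_shift unfolding lead_def by blast
  qed
  have lead_mono: "lead x I n \<subseteq> lead x J n" if "I \<subseteq> J" for I J n
    using that by (auto simp: lead_def)
  \<comment> \<open>An element of \<open>J\<close> has a partner in \<open>I\<close> with the same
    leading coefficient, and their difference has a representation of lower degree.\<close>
  have lead_eq: "J \<subseteq> I" if IJ: "T.idl I" "T.idl J" "I \<subseteq> J" "\<And>n. lead x J n = lead x I n" for I J
  proof -
    have "p \<in> I" if "p \<in> deg_lt x n" "p \<in> J" for n p
      using that
    proof (induction n arbitrary: p)
      case 0
      then show ?case using T.idl_0[OF IJ(1)] by simp
    next
      case (Suc n)
      then obtain r s where p: "p = r + s * x ^ n" "r \<in> deg_lt x n" "s \<in> S" by auto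
      then have "s \<in> lead x J n" using Suc.prems by (auto simp: lead_def)
      then have "s \<in> lead x I n" using IJ(4) by simp
      then obtain r' where r': "r' \<in> deg_lt x n" "r' + s * x ^ n \<in> I" by (auto simp: lead_def)
      have e: "r + (- 1) * r' = p - (r' + s * x ^ n)" using p by simp
      have "p - (r' + s * x ^ n) \<in> J"
        using Suc.prems(2) r'(2) IJ(3) by (intro T.idl_diff[OF IJ(2)]) auto
      then have "r + (- 1) * r' \<in> J" unfolding e .
      moreover have "r + (- 1) * r' \<in> deg_lt x n"
        using deg_lt_add[OF p(2) deg_lt_mult[OF r'(1), of "- 1"]] by simp
      ultimately have "r + (- 1) * r' \<in> I" using Suc.IH by blast
      then have "(r + (- 1) * r') + (r' + s * x ^ n) \<in> I" using T.idl_add[OF IJ(1)] r' by blast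
      then show ?case using e by simp
    qed
    then show ?thesis using assms(4) IJ(2) T.idl_sub by blast
  qed
  have False if J: "\<And>i. T.idl (J i)" "\<And>i. J i \<subset> J (Suc i)" for J :: "nat \<Rightarrow> 'a set"
  proof -
    have Jm: "J i \<subseteq> J j" if "i \<le> j" for i j using lift_Suc_mono_le[of J i j] J(2) that by blast
    have nm: "lead x (J i) n \<subseteq> lead x (J i) m" if "n \<le> m" for i n m
      using lift_Suc_mono_le[of "lead x (J i)" n m] lead_Suc J(1) that by blast
    \<comment> \<open>The leading ideals form a grid, increasing both in the ideal and in the
      degree. The diagonal settles all degrees from \<open>N\<close> on; the finitely many lower
      degrees get bounds \<open>A n\<close> of their own.\<close>
    obtain N where N: "\<And>n. n \<ge> N \<Longrightarrow> lead x (J n) n = lead x (J N) N"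
    proof (rule noetherian_chain[OF noeth, of "\<lambda>n. lead x (J n) n"])
      show "lead x (J n) n \<subseteq> lead x (J (Suc n)) (Suc n)" for n
        using nm[of n "Suc n" n] lead_mono[OF Jm[of n "Suc n"], of "Suc n"] by auto
    qed (use lead_idl J in auto)
    have "\<exists>A. \<forall>a\<ge>A. lead x (J a) n = lead x (J A) n" for n
    proof (rule noetherian_chain[OF noeth, of "\<lambda>a. lead x (J a) n"])
      show "lead x (J a) n \<subseteq> lead x (J (Suc a)) n" for a
        using lead_mono[OF Jm[of a "Suc a"]] by auto
    qed (use lead_idl J in auto)
    then obtain A where A: "\<And>n a. a \<ge> A n \<Longrightarrow> lead x (J a) n = lead x (J (A n)) n" by metis
    define B where "B = Max (insert N (A ` {..<N}))"
    have B: "B \<ge> N" "\<And>n. n < N \<Longrightarrow> B \<ge> A n" by (auto simp: B_def intro: Max_ge)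
    \<comment> \<open>Every such entry of the grid is squeezed between the diagonal entries at
      \<open>N\<close> and at \<open>max b n\<close>.\<close>
    have big: "lead x (J b) n = lead x (J N) N" if "b \<ge> N" "n \<ge> N" for b n
    proof
      have "lead x (J N) N \<subseteq> lead x (J b) N" using lead_mono Jm that by blast
      then show "lead x (J N) N \<subseteq> lead x (J b) n" using nm that by blast
      have "lead x (J b) n \<subseteq> lead x (J (max b n)) (max b n)"
        using nm[of n "max b n" b] lead_mono[OF Jm[of b "max b n"], of "max b n"] by auto
      then show "lead x (J b) n \<subseteq> lead x (J N) N" using N[of "max b n"] that by auto
    qed
    have "lead x (J (Suc B)) n = lead x (J B) n" for n
    proof (cases "n < N")
      case True
      then have "A n \<le> B" "A n \<le> Suc B" using B(2)[of n] by auto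
      then show ?thesis using A[of n "Suc B"] A[of n B] by simp
    next
      case False
      then show ?thesis using big[of B n] big[of "Suc B" n] B(1) by simp
    qed
    then have "J (Suc B) \<subseteq> J B" using lead_eq[OF J(1) J(1)] J(2) by blast
    then show False using J(2) by blast
  qed
  then show ?thesis by (rule T.noetherianI)
qed

end

section \<open>Polynomials in the variables of \<open>V\<close>\<close>

type_synonym ('v, 'k) mpoly = "('v \<Rightarrow>\<^sub>0 nat) \<Rightarrow>\<^sub>0 'k"

definition poly_in :: "'v set \<Rightarrow> ('v, 'k::field) mpoly set" where
  "poly_in V = {p. \<forall>a\<in>Poly_Mapping.keys p. Poly_Mapping.keys a \<subseteq> V}"

definition irr :: "'v set \<Rightarrow> ('v, 'k::field) mpoly set" where
  "irr V = {p \<in> poly_in V. 0 \<notin> Poly_Mapping.keys p}"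

abbreviation const :: "'k::field \<Rightarrow> ('v, 'k) mpoly" where
  "const c \<equiv> Poly_Mapping.single 0 c"

lemma keys_plus_nat: "Poly_Mapping.keys (a + b) = Poly_Mapping.keys a \<union> Poly_Mapping.keys b"
  for a b :: "'v \<Rightarrow>\<^sub>0 nat"
  by (auto simp: in_keys_iff lookup_add)

lemma keys_multE:
  assumes "c \<in> Poly_Mapping.keys (p * q)"
  obtains a b where "a \<in> Poly_Mapping.keys p" "b \<in> Poly_Mapping.keys q" "c = a + b"
  using assms keys_mult[of p q] by auto

lemma comm_subring_poly_in: "comm_subring (poly_in V)"
proof
  fix x y :: "('a, 'b) mpoly"
  assume *: "x \<in> poly_in V" "y \<in> poly_in V"
  then show "x + y \<in> poly_in V" using keys_add[of x y] by (fastforce simp: poly_in_def)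
  show "x * y \<in> poly_in V" using *
    by (force simp: poly_in_def keys_plus_nat elim!: keys_multE)
qed (auto simp: poly_in_def in_keys_iff)

lemma poly_mapping_sum_single: "(\<Sum>a\<in>Poly_Mapping.keys p. Poly_Mapping.single a (Poly_Mapping.lookup p a)) = p"
proof (rule poly_mapping_eqI)
  fix b
  have "Poly_Mapping.lookup (\<Sum>a\<in>Poly_Mapping.keys p. Poly_Mapping.single a (Poly_Mapping.lookup p a)) b =
    (\<Sum>a\<in>Poly_Mapping.keys p. if a = b then Poly_Mapping.lookup p a else 0)"
    by (simp add: lookup_sum lookup_single when_def)
  also have "\<dots> = Poly_Mapping.lookup p b" by (simp add: in_keys_iff)
  finally show "Poly_Mapping.lookup (\<Sum>a\<in>Poly_Mapping.keys p. Poly_Mapping.single a (Poly_Mapping.lookup p a)) b = \<dots>" .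
qed

lemma variable_power: "(variable v :: ('v, 'k::field) mpoly) ^ n = Poly_Mapping.single (Poly_Mapping.single v n) 1"
  by (induction n) (simp_all add: variable_def mult_single flip: single_add)

lemma variable_in: "v \<in> V \<Longrightarrow> variable v \<in> poly_in V"
  by (simp add: variable_def poly_in_def)

lemma const_in: "const c \<in> poly_in V"
  by (simp add: poly_in_def)

lemma single_in: "Poly_Mapping.keys a \<subseteq> V \<Longrightarrow> Poly_Mapping.single a c \<in> poly_in V"
  by (simp add: poly_in_def)

lemma noetherian_poly_in_empty: "comm_subring.noetherian (poly_in {} :: ('v, 'k::field) mpoly set)"
proof -
  interpret comm_subring "poly_in {} :: ('v, 'k) mpoly set" by (rule comm_subring_poly_in)
  have const: "\<exists>c. p = const c" if "p \<in> poly_in {}" for p :: "('v, 'k) mpoly"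
  proof -
    have "Poly_Mapping.keys p \<subseteq> {0}" using that by (auto simp: poly_in_def)
    then have "p = const (Poly_Mapping.lookup p 0)"
      by (intro poly_mapping_eqI) (auto simp: lookup_single when_def in_keys_iff)
    then show ?thesis by blast
  qed
  have full: "J = poly_in {}" if J: "idl J" "p \<in> J" "p \<noteq> 0" for J and p :: "('v, 'k) mpoly"
  proof -
    obtain c where c: "p = const c" "c \<noteq> 0" using const idl_sub[OF J(1,2)] J(3) by fastforce
    then have "const (1 / c) * p \<in> J" using J const_in idl_mult by blast
    then have "1 \<in> J" using c by (simp add: mult_single)
    then show ?thesis using idl_mult[OF J(1), of 1] idl_sub[OF J(1)] by auto
  qed
  have False if J: "\<And>i. idl (J i)" "\<And>i. J i \<subset> J (Suc i)" for J :: "nat \<Rightarrow> ('v, 'k) mpoly set"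
  proof -
    obtain p where "p \<in> J (Suc 0)" "p \<noteq> 0" using J(2)[of 0] idl_0[OF J(1)] by blast
    then have "J (Suc 0) = poly_in {}" using full J by blast
    then show False using J(2)[of "Suc 0"] idl_sub[OF J(1)] by blast
  qed
  then show ?thesis by (rule noetherianI)
qed

theorem noetherian_poly_in:
  assumes "finite V"
  shows "comm_subring.noetherian (poly_in V :: ('v, 'k::field) mpoly set)"
  using assms
proof (induction V rule: finite_induct)
  case empty
  show ?case by (rule noetherian_poly_in_empty)
next
  case (insert v V)
  interpret comm_subring "poly_in V :: ('v, 'k) mpoly set" by (rule comm_subring_poly_in)
  have "p \<in> (\<Union>n. deg_lt (variable v) n)" if p: "p \<in> poly_in (insert v V)" for p :: "('v, 'k) mpoly"
  proof -
    have "Poly_Mapping.single a c \<in> (\<Union>n. deg_lt (variable v) n)" if "Poly_Mapping.keys a \<subseteq> insert v V" for a c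
    proof -
      define b where "b = Poly_Mapping.update v 0 a"
      have "a = b + Poly_Mapping.single v (Poly_Mapping.lookup a v)"
        by (rule poly_mapping_eqI) (auto simp: b_def lookup_add lookup_update lookup_single when_def)
      then have "Poly_Mapping.single a c =
        0 + Poly_Mapping.single b c * variable v ^ Poly_Mapping.lookup a v"
        by (simp add: variable_power mult_single)
      moreover have "Poly_Mapping.single b c \<in> poly_in V"
        using that by (intro single_in) (auto simp: b_def keys_update)
      ultimately have "Poly_Mapping.single a c \<in> deg_lt (variable v) (Suc (Poly_Mapping.lookup a v))"
        using deg_lt_SucI deg_lt_0 by metis
      then show ?thesis by blast
    qed
    then have "(\<Sum>a\<in>Poly_Mapping.keys p. Poly_Mapping.single a (Poly_Mapping.lookup p a)) \<in> (\<Union>n. deg_lt (variable v) n)"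
      using p by (intro deg_lt_sum) (auto simp: poly_in_def)
    then show ?thesis by (simp add: poly_mapping_sum_single)
  qed
  then show ?case
    by (intro noetherian_extension[OF _ _ _ _ insert.IH, of _ "variable v"] comm_subring_poly_in
        variable_in subsetI) (auto simp: poly_in_def)
qed

section \<open>Generic linear forms\<close>

text \<open>The coefficients run along the moment curve, so that by a Vandermonde argument any
  infinite set of these forms generates all variables in \<open>vs\<close>. This is what
  \<open>z_gen\<close> demands.\<close>

definition lin_form :: "'v list \<Rightarrow> 'k \<Rightarrow> ('v, 'k::field) mpoly" where
  "lin_form vs a = (\<Sum>i<length vs. const (a ^ i) * variable (vs ! i))"

text \<open>Modulo \<open>P\<close> the polynomial has infinitely many zeros whose differences are
  units. Division by the linear factor of one zero lowers the degree, and the quotient again has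
  infinitely many such zeros.\<close>

lemma (in comm_subring) coeffs_in_ideal:
  fixes C :: "'k::field \<Rightarrow> 'a" and p :: "'a poly"
  assumes P: "idl P" and CS: "\<And>a. C a \<in> S"
    and C: "C 1 = 1" "\<And>a b. C (a - b) = C a - C b" "\<And>a b. C (a * b) = C a * C b"
    and inf: "infinite {a. poly p (C a) \<in> P}"
  shows "coeff p i \<in> P"
  using inf
proof (induction "degree p" arbitrary: p i)
  case 0
  then obtain c where p: "p = [:c:]" by (metis degree_eq_zeroE)
  obtain a where "poly p (C a) \<in> P" using 0(2) not_finite_existsD by blast
  then show ?case using p idl_0[OF P] by (cases i) auto
next
  case (Suc n)
  obtain b where b: "poly p (C b) \<in> P" using Suc.prems not_finite_existsD by blast
  define q where "q = synthetic_div p (C b)"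
  have pq: "p + smult (C b) q = pCons (poly p (C b)) q"
    unfolding q_def by (rule synthetic_div_correct)
  have "poly q (C a) \<in> P" if a: "poly p (C a) \<in> P" "a \<noteq> b" for a
  proof -
    have "poly p (C a) + C b * poly q (C a) = poly p (C b) + C a * poly q (C a)"
      using arg_cong[OF pq, of "\<lambda>r. poly r (C a)"] by simp
    then have "C (a - b) * poly q (C a) = poly p (C a) - poly p (C b)"
      unfolding C(2) left_diff_distrib by (simp add: algebra_simps)
    then have "C (1 / (a - b)) * (C (a - b) * poly q (C a)) \<in> P"
      using a b P CS by (simp add: idl_mult idl_diff)
    moreover have "C (1 / (a - b)) * C (a - b) = 1" using a C(1,3) by (metis (no_types, lifting) divide_self_if eq_iff_diff_eq_0 mult.commute times_divide_eq_right mult_1_right)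
    ultimately show ?thesis by (simp flip: mult.assoc)
  qed
  then have "{a. poly p (C a) \<in> P} - {b} \<subseteq> {a. poly q (C a) \<in> P}" by auto
  then have "infinite {a. poly q (C a) \<in> P}"
    using Suc.prems by (meson finite_subset infinite_remove)
  moreover have "n = degree q" using Suc.hyps(2) by (simp add: q_def degree_synthetic_div)
  ultimately have q: "coeff q j \<in> P" for j using Suc.hyps(1) by blast
  have "p = pCons (poly p (C b)) q - smult (C b) q" using pq by (simp add: algebra_simps)
  then have "coeff p i = coeff (pCons (poly p (C b)) q) i - C b * coeff q i"
    by (metis coeff_diff coeff_smult)
  moreover have "coeff (pCons (poly p (C b)) q) i \<in> P" using b q by (cases i) auto
  ultimately show ?case using q P CS by (simp add: idl_mult idl_diff)
qed

lemma irr_subset_ideal: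
  assumes P: "comm_subring.idl (poly_in V) P" and var: "\<And>v. v \<in> V \<Longrightarrow> variable v \<in> P"
  shows "irr V \<subseteq> (P :: ('v, 'k::field) mpoly set)"
proof
  interpret comm_subring "poly_in V :: ('v, 'k) mpoly set" by (rule comm_subring_poly_in)
  fix p :: "('v, 'k) mpoly" assume p: "p \<in> irr V"
  have mono: "Poly_Mapping.single a c \<in> P" if "Poly_Mapping.keys a \<subseteq> V" "a \<noteq> 0" for a c
  proof -
    have "Poly_Mapping.keys a \<noteq> {}"
      using that(2) by (metis empty_iff in_keys_iff lookup_zero poly_mapping_eqI)
    then obtain v where v: "v \<in> Poly_Mapping.keys a" by blast
    define b where "b = a - Poly_Mapping.single v 1"
    have a: "a = b + Poly_Mapping.single v 1"
      using v by (intro poly_mapping_eqI) (auto simp: b_def lookup_add lookup_minus lookup_single when_def in_keys_iff)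
    then have "Poly_Mapping.single a c = Poly_Mapping.single b c * variable v"
      by (simp add: variable_def mult_single)
    moreover have "Poly_Mapping.keys b \<subseteq> V" using that(1) unfolding a keys_plus_nat by auto
    ultimately show ?thesis using idl_mult[OF P var single_in] v that(1) by auto
  qed
  have sums: "sum f A \<in> P" if "\<And>a. a \<in> A \<Longrightarrow> f a \<in> P" for f and A :: "('v \<Rightarrow>\<^sub>0 nat) set"
    using that by (induction A rule: infinite_finite_induct) (auto simp: idl_0[OF P] idl_add[OF P])
  have "(\<Sum>a\<in>Poly_Mapping.keys p. Poly_Mapping.single a (Poly_Mapping.lookup p a)) \<in> P"
    using p by (intro sums mono) (auto simp: irr_def poly_in_def)
  then show "p \<in> P" by (simp add: poly_mapping_sum_single)
qed

lemma generic_forms_lin_form: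
  assumes inf: "infinite (UNIV :: 'k::field set)" and vs: "set vs = V" "distinct vs"
  shows "generic_forms (poly_in V) (irr V) (lin_form vs :: 'k \<Rightarrow> ('v, 'k) mpoly)"
proof -
  interpret comm_subring "poly_in V :: ('v, 'k) mpoly set" by (rule comm_subring_poly_in)
  have lin_in: "lin_form vs a \<in> poly_in V" for a :: 'k
    unfolding lin_form_def using vs by (intro sum_S mult_S const_in variable_in) auto
  show ?thesis
  proof (unfold_locales)
    show "irr V \<subseteq> poly_in V" by (auto simp: irr_def)
    show noetherian using noetherian_poly_in vs(1) by blast
    show "lin_form vs a \<in> irr V" for a :: 'k
    proof -
      have "Poly_Mapping.lookup (lin_form vs a) 0 = 0"
        by (auto simp: lin_form_def lookup_sum variable_def mult_single lookup_single when_def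
            dest!: arg_cong[of _ 0 Poly_Mapping.keys] intro!: sum.neutral)
      then show ?thesis using lin_in by (simp add: irr_def in_keys_iff)
    qed
    show "infinite (UNIV :: 'k set)" by fact
    fix P :: "('v, 'k) mpoly set"
    assume P: "idl P" and infP: "infinite {a. lin_form vs a \<in> P}"
    \<comment> \<open>The parameter becomes an indeterminate: \<open>p\<close> has the variables as
      coefficients and takes the value \<open>lin_form vs a\<close> at
      \<open>const a\<close>.\<close>
    define p where "p = (\<Sum>i<length vs. monom (variable (vs ! i) :: ('v, 'k) mpoly) i)"
    have const_power: "(const a :: ('v, 'k) mpoly) ^ i = const (a ^ i)" for a :: 'k and i
      by (induction i) (simp_all add: mult_single)
    have "poly p (const a) = lin_form vs a" for a
      by (simp add: p_def lin_form_def poly_sum poly_monom const_power mult.commute)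
    then have "coeff p i \<in> P" for i
      using infP by (intro coeffs_in_ideal[OF P, where C = const])
        (simp_all add: const_in single_diff mult_single)
    moreover have "coeff p i = variable (vs ! i)" if "i < length vs" for i
      using that by (simp add: p_def coeff_sum)
    ultimately have "variable v \<in> P" if "v \<in> V" for v
      using that vs by (metis in_set_conv_nth)
    then show "irr V \<subseteq> P" by (rule irr_subset_ideal[OF P])
  qed
qed

section \<open>Stanley-Reisner ideals\<close>

text \<open>Projection onto the span of the monomials satisfying \<open>P\<close>. Conditions on the
  support split monomial ideals; conditions on the degree give homogeneous components.\<close>

definition part :: "('a \<Rightarrow> bool) \<Rightarrow> ('a \<Rightarrow>\<^sub>0 'b::zero) \<Rightarrow> ('a \<Rightarrow>\<^sub>0 'b)" where
  "part P p = Poly_Mapping.mapp (\<lambda>a c. if P a then c else 0) p"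

lemma lookup_part: "Poly_Mapping.lookup (part P p) a = (if P a then Poly_Mapping.lookup p a else 0)"
  by (simp add: part_def lookup_mapp when_def in_keys_iff)

lemma keys_part: "Poly_Mapping.keys (part P p) = {a \<in> Poly_Mapping.keys p. P a}"
  by (auto simp: in_keys_iff lookup_part split: if_splits)

lemma part_split: "p = part P p + part (\<lambda>a. \<not> P a) p" for p :: "'a \<Rightarrow>\<^sub>0 'b::monoid_add"
  by (rule poly_mapping_eqI) (simp add: lookup_add lookup_part)

lemma part_add: "part P (p + q) = part P p + part P q" for p q :: "'a \<Rightarrow>\<^sub>0 'b::monoid_add"
  by (rule poly_mapping_eqI) (simp add: lookup_add lookup_part)

lemma part_in: "p \<in> poly_in V \<Longrightarrow> part P p \<in> poly_in V"
  by (auto simp: poly_in_def keys_part)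

lemma poly_in_mono: "V \<subseteq> W \<Longrightarrow> poly_in V \<subseteq> poly_in W"
  by (auto simp: poly_in_def)

lemma single_times: "Poly_Mapping.single b c * p =
    (\<Sum>a\<in>Poly_Mapping.keys p. Poly_Mapping.single (b + a) (c * Poly_Mapping.lookup p a))"
  for p :: "('v, 'k::field) mpoly"
proof -
  have "Poly_Mapping.single b c * p = Poly_Mapping.single b c *
    (\<Sum>a\<in>Poly_Mapping.keys p. Poly_Mapping.single a (Poly_Mapping.lookup p a))"
    by (simp add: poly_mapping_sum_single)
  then show ?thesis by (simp add: sum_distrib_left mult_single)
qed

lemma lookup_single_times:
  "Poly_Mapping.lookup (Poly_Mapping.single b c * p) (b + a) = c * Poly_Mapping.lookup p a"
  for p :: "('v, 'k::field) mpoly"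
proof -
  have "Poly_Mapping.lookup (Poly_Mapping.single b c * p) (b + a) =
    (\<Sum>x\<in>Poly_Mapping.keys p. if x = a then c * Poly_Mapping.lookup p x else 0)"
    unfolding single_times by (simp add: lookup_sum lookup_single when_def)
  then show ?thesis by (simp add: in_keys_iff)
qed

lemma variable_factor:
  fixes p :: "('v, 'k::field) mpoly"
  assumes "p \<in> poly_in V" "\<And>a. a \<in> Poly_Mapping.keys p \<Longrightarrow> v \<in> Poly_Mapping.keys a"
  obtains f where "f \<in> poly_in V" "p = variable v * f"
proof
  interpret comm_subring "poly_in V :: ('v, 'k) mpoly set" by (rule comm_subring_poly_in)
  define f where "f = (\<Sum>a\<in>Poly_Mapping.keys p.
    Poly_Mapping.single (a - Poly_Mapping.single v 1) (Poly_Mapping.lookup p a))"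
  have a: "Poly_Mapping.single v 1 + (a - Poly_Mapping.single v 1) = a" if "a \<in> Poly_Mapping.keys p" for a
    using assms(2)[OF that] by (intro poly_mapping_eqI)
      (auto simp: lookup_add lookup_minus lookup_single when_def in_keys_iff)
  show "f \<in> poly_in V"
    unfolding f_def
  proof (intro sum_S single_in)
    fix a assume "a \<in> Poly_Mapping.keys p"
    then have "Poly_Mapping.keys a \<subseteq> V" using assms(1) by (auto simp: poly_in_def)
    then show "Poly_Mapping.keys (a - Poly_Mapping.single v 1) \<subseteq> V"
      by (auto simp: in_keys_iff lookup_minus)
  qed
  have "variable v * f = (\<Sum>a\<in>Poly_Mapping.keys p. Poly_Mapping.single a (Poly_Mapping.lookup p a))"
    unfolding f_def variable_def sum_distrib_left
    by (intro sum.cong) (simp_all add: mult_single a del: One_nat_def)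
  then show "p = variable v * f" by (simp add: poly_mapping_sum_single)
qed

definition down_closed :: "'v set set \<Rightarrow> bool" where
  "down_closed E \<longleftrightarrow> (\<forall>\<sigma>\<in>E. \<forall>\<tau>. \<tau> \<subseteq> \<sigma> \<longrightarrow> \<tau> \<in> E)"

lemma down_closed_Pow: "down_closed (Pow W)"
  by (auto simp: down_closed_def)

lemma down_closed_Un: "down_closed A \<Longrightarrow> down_closed B \<Longrightarrow> down_closed (A \<union> B)"
  by (auto simp: down_closed_def)

locale sr_ring =
  fixes V :: "'v set" and vs :: "'v list" and K :: "'k::field itself"
  assumes vs: "set vs = V" "distinct vs"
    and infinite_field: "infinite (UNIV :: 'k set)"

sublocale sr_ring \<subseteq> generic_forms "poly_in V :: ('v, 'k) mpoly set" "irr V" "lin_form vs"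
  using infinite_field vs by (rule generic_forms_lin_form)

context sr_ring
begin

text \<open>For a complex with vertices in \<open>V\<close> this is its Stanley-Reisner ideal
  enlarged by the variables that are not among its vertices, so the quotient is the usual
  Stanley-Reisner ring.\<close>

definition sri :: "'v set set \<Rightarrow> ('v, 'k) mpoly set" where
  "sri E = {p \<in> poly_in V. \<forall>a\<in>Poly_Mapping.keys p. Poly_Mapping.keys a \<notin> E}"

lemma finite_V: "finite V"
  using vs by auto

lemma idl_sri: assumes "down_closed E" shows "idl (sri E)"
proof (rule idlI)
  fix a b assume "a \<in> sri E" "b \<in> sri E"
  then show "a + b \<in> sri E" using keys_add[of a b] by (auto simp: sri_def)
next
  fix p s :: "('v, 'k) mpoly" assume p: "p \<in> sri E" and s: "s \<in> poly_in V"
  have "Poly_Mapping.keys c \<notin> E" if c: "c \<in> Poly_Mapping.keys (s * p)" for c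
  proof -
    obtain a b where "a \<in> Poly_Mapping.keys s" "b \<in> Poly_Mapping.keys p" "c = a + b"
      using keys_multE[OF c] by metis
    moreover from this have "Poly_Mapping.keys b \<notin> E" using p by (auto simp: sri_def)
    ultimately show ?thesis using assms by (auto simp: down_closed_def keys_plus_nat)
  qed
  then show "s * p \<in> sri E" using p s by (auto simp: sri_def)
qed (auto simp: sri_def)

lemma sri_Int: "sri A \<inter> sri B = sri (A \<union> B)"
  by (auto simp: sri_def)

lemma sri_antimono: "A \<subseteq> B \<Longrightarrow> sri B \<subseteq> sri A"
  by (auto simp: sri_def)

lemma sri_sum: "ideal_sum (sri A) (sri B) = sri (A \<inter> B)"
proof (intro equalityI subsetI)
  fix p assume "p \<in> ideal_sum (sri A) (sri B)"
  then obtain a b where "a \<in> sri A" "b \<in> sri B" "p = a + b" by (auto simp: ideal_sum_def)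
  then show "p \<in> sri (A \<inter> B)" using keys_add[of a b] by (fastforce simp: sri_def)
next
  fix p assume p: "p \<in> sri (A \<inter> B)"
  let ?P = "\<lambda>a. Poly_Mapping.keys a \<notin> A"
  have "part ?P p \<in> sri A" "part (\<lambda>a. \<not> ?P a) p \<in> sri B"
    using p by (auto simp: sri_def part_in keys_part)
  then show "p \<in> ideal_sum (sri A) (sri B)" using part_split[of p ?P] unfolding ideal_sum_def by blast
qed

lemma variable_irr: "v \<in> V \<Longrightarrow> variable v \<in> irr V"
proof -
  have "(0 :: 'v \<Rightarrow>\<^sub>0 nat) \<noteq> Poly_Mapping.single v 1"
    by (metis keys_single keys_zero insert_not_empty one_neq_zero)
  then show "v \<in> V \<Longrightarrow> variable v \<in> irr V" by (auto simp: irr_def variable_in) (simp add: variable_def)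
qed

lemma reg_variable_sri:
  assumes "v \<in> W" shows "reg (sri (Pow W)) (variable v)"
proof (rule regI)
  fix f :: "('v, 'k) mpoly" assume f: "f \<in> poly_in V" and vf: "variable v * f \<in> sri (Pow W)"
  have "\<not> Poly_Mapping.keys a \<subseteq> W" if "a \<in> Poly_Mapping.keys f" for a
  proof
    assume a: "Poly_Mapping.keys a \<subseteq> W"
    have "Poly_Mapping.single v 1 + a \<in> Poly_Mapping.keys (variable v * f)"
      using that by (simp add: in_keys_iff variable_def lookup_single_times)
    moreover have "Poly_Mapping.keys (Poly_Mapping.single v 1 + a) \<subseteq> W"
      using a assms by (simp add: keys_plus_nat)
    ultimately show False using vf unfolding sri_def by blast
  qed
  then show "f \<in> sri (Pow W)" using f by (auto simp: sri_def)
qed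

lemma adjoin_variable_sri:
  assumes "v \<in> V" shows "adjoin (sri (Pow W)) (variable v) = sri (Pow (W - {v}))"
proof (intro equalityI subsetI)
  fix p assume "p \<in> adjoin (sri (Pow W)) (variable v)"
  then obtain l f where lf: "l \<in> sri (Pow W)" "f \<in> poly_in V" "p = l + variable v * f"
    by (metis adjoinE)
  have "variable v * f \<in> sri (Pow (W - {v}))"
    using lf(2) assms variable_in[of v V]
    by (auto simp: sri_def variable_def keys_plus_nat elim!: keys_multE split: if_splits)
  then show "p \<in> sri (Pow (W - {v}))"
    using lf(1,3) sri_antimono[of "Pow (W - {v})" "Pow W"]
    by (auto intro!: idl_add idl_sri down_closed_Pow)
next
  fix p assume p: "p \<in> sri (Pow (W - {v}))"
  let ?P = "\<lambda>a. v \<in> Poly_Mapping.keys a"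
  have "part ?P p \<in> poly_in V" using p by (auto simp: sri_def part_in)
  then obtain f where f: "f \<in> poly_in V" "part ?P p = variable v * f"
    by (rule variable_factor[of _ V v]) (auto simp: keys_part)
  have "part (\<lambda>a. \<not> ?P a) p \<in> sri (Pow W)"
    using p by (auto simp: sri_def part_in keys_part)
  then have "part (\<lambda>a. \<not> ?P a) p + variable v * f \<in> adjoin (sri (Pow W)) (variable v)"
    using f by (intro adjoinI)
  then show "p \<in> adjoin (sri (Pow W)) (variable v)"
    using part_split[of p ?P] f by (simp add: add.commute)
qed

text \<open>Modulo \<open>sri (Pow W)\<close> the ring is \<open>k[W]\<close>, and killing one
  variable leaves the polynomial ring in the others: the variables in \<open>W\<close> form a
  regular sequence.\<close>

lemma depth_sri_Pow: "W \<subseteq> V \<Longrightarrow> depth_ge (card W) (sri (Pow W))"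
proof -
  assume W: "W \<subseteq> V"
  then have "finite W" using finite_V finite_subset by blast
  then show ?thesis using W
  proof (induction W rule: finite_induct)
    case empty
    then show ?case by (simp add: depth_ge_0)
  next
    case (insert v W)
    then have "reg (sri (Pow (insert v W))) (variable v)" "variable v \<in> irr V"
      "adjoin (sri (Pow (insert v W))) (variable v) = sri (Pow W)"
      using reg_variable_sri variable_irr adjoin_variable_sri[of v "insert v W"] by auto
    then show ?case using insert by (auto simp: depth_ge_Suc)
  qed
qed

lemma sri_Pow_V: "sri (Pow V) = {0}"
proof -
  have "p = 0" if "p \<in> sri (Pow V)" for p
  proof -
    have "Poly_Mapping.keys p = {}" using that by (auto simp: sri_def poly_in_def)
    then show ?thesis by (metis empty_iff in_keys_iff lookup_zero poly_mapping_eqI)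
  qed
  then show ?thesis by (auto simp: sri_def)
qed

end

text \<open>Replaces leading monomials, since \<open>'v\<close> carries no order: extremal elements of \<open>A\<close> and \<open>B\<close>
  are found one coordinate at a time.\<close>

lemma unique_sum:
  fixes A B :: "('v \<Rightarrow>\<^sub>0 nat) set"
  assumes "finite W" "finite A" "finite B" "A \<noteq> {}" "B \<noteq> {}"
    "\<And>a a' v. a \<in> A \<Longrightarrow> a' \<in> A \<Longrightarrow> v \<notin> W \<Longrightarrow> Poly_Mapping.lookup a v = Poly_Mapping.lookup a' v"
    "\<And>b b' v. b \<in> B \<Longrightarrow> b' \<in> B \<Longrightarrow> v \<notin> W \<Longrightarrow> Poly_Mapping.lookup b v = Poly_Mapping.lookup b' v"
  shows "\<exists>\<alpha>\<in>A. \<exists>\<beta>\<in>B. \<forall>a\<in>A. \<forall>b\<in>B. a + b = \<alpha> + \<beta> \<longrightarrow> a = \<alpha> \<and> b = \<beta>"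
  using assms
proof (induction W arbitrary: A B rule: finite_induct)
  case empty
  have "a = a'" if "a \<in> A" "a' \<in> A" for a a' 
    using that by (intro poly_mapping_eqI empty.prems(5)) simp_all
  moreover have "b = b'" if "b \<in> B" "b' \<in> B" for b b' 
    using that by (intro poly_mapping_eqI empty.prems(6)) simp_all
  ultimately show ?case using empty.prems(3,4) by blast
next
  case (insert w W)
  define f where "f a = Poly_Mapping.lookup a w" for a :: "'v \<Rightarrow>\<^sub>0 nat"
  define A' where "A' = {a \<in> A. f a = Max (f ` A)}"
  define B' where "B' = {b \<in> B. f b = Max (f ` B)}"
  have ne: "A' \<noteq> {}" "B' \<noteq> {}"
  proof -
    have "Max (f ` A) \<in> f ` A" "Max (f ` B) \<in> f ` B" using insert.prems by (auto intro!: Max_in)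
    then show "A' \<noteq> {}" "B' \<noteq> {}" by (fastforce simp: A'_def B'_def)+
  qed
  have le: "f a \<le> Max (f ` A)" "f b \<le> Max (f ` B)" if "a \<in> A" "b \<in> B" for a b
    using that insert.prems by auto
  have "\<exists>\<alpha>\<in>A'. \<exists>\<beta>\<in>B'. \<forall>a\<in>A'. \<forall>b\<in>B'. a + b = \<alpha> + \<beta> \<longrightarrow> a = \<alpha> \<and> b = \<beta>"
  proof (rule insert.IH)
    fix a a' v assume *: "a \<in> A'" "a' \<in> A'" "v \<notin> W"
    show "Poly_Mapping.lookup a v = Poly_Mapping.lookup a' v"
      using * insert.prems(5)[of a a' v] by (cases "v = w") (auto simp: A'_def f_def)
  next
    fix b b' v assume *: "b \<in> B'" "b' \<in> B'" "v \<notin> W"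
    show "Poly_Mapping.lookup b v = Poly_Mapping.lookup b' v"
      using * insert.prems(6)[of b b' v] by (cases "v = w") (auto simp: B'_def f_def)
  qed (use insert.prems ne in \<open>auto simp: A'_def B'_def\<close>)
  then obtain \<alpha> \<beta> where ab: "\<alpha> \<in> A'" "\<beta> \<in> B'"
    "\<And>a b. a \<in> A' \<Longrightarrow> b \<in> B' \<Longrightarrow> a + b = \<alpha> + \<beta> \<Longrightarrow> a = \<alpha> \<and> b = \<beta>" by blast
  have "a = \<alpha> \<and> b = \<beta>" if "a \<in> A" "b \<in> B" "a + b = \<alpha> + \<beta>" for a b
  proof -
    have "f a + f b = f \<alpha> + f \<beta>" using arg_cong[OF that(3), of f] by (simp add: f_def lookup_add)
    then have "f a = Max (f ` A)" "f b = Max (f ` B)"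
      using ab(1,2) le[OF that(1,2)] by (auto simp: A'_def B'_def)
    then show ?thesis using ab(3) that by (auto simp: A'_def B'_def)
  qed
  then show ?case using ab(1,2) by (auto simp: A'_def B'_def)
qed

lemma lookup_times:
  "Poly_Mapping.lookup (p * q) c = (\<Sum>(a, b)\<in>{(a, b) \<in> Poly_Mapping.keys p \<times> Poly_Mapping.keys q. a + b = c}.
     Poly_Mapping.lookup p a * Poly_Mapping.lookup q b)"
  for p q :: "('v, 'k::field) mpoly"
proof -
  have "p * q = (\<Sum>a\<in>Poly_Mapping.keys p. Poly_Mapping.single a (Poly_Mapping.lookup p a)) * q"
    by (simp add: poly_mapping_sum_single)
  also have "\<dots> = (\<Sum>a\<in>Poly_Mapping.keys p. \<Sum>b\<in>Poly_Mapping.keys q.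
      Poly_Mapping.single (a + b) (Poly_Mapping.lookup p a * Poly_Mapping.lookup q b))"
    by (simp add: sum_distrib_right single_times)
  also have "\<dots> = (\<Sum>(a, b)\<in>Poly_Mapping.keys p \<times> Poly_Mapping.keys q.
      Poly_Mapping.single (a + b) (Poly_Mapping.lookup p a * Poly_Mapping.lookup q b))"
    by (simp add: sum.cartesian_product)
  finally have "Poly_Mapping.lookup (p * q) c = (\<Sum>(a, b)\<in>Poly_Mapping.keys p \<times> Poly_Mapping.keys q.
      if a + b = c then Poly_Mapping.lookup p a * Poly_Mapping.lookup q b else 0)"
    by (simp add: lookup_sum lookup_single when_def case_prod_beta)
  also have "\<dots> = (\<Sum>(a, b)\<in>{(a, b) \<in> Poly_Mapping.keys p \<times> Poly_Mapping.keys q. a + b = c}.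
     Poly_Mapping.lookup p a * Poly_Mapping.lookup q b)"
    by (intro sum.mono_neutral_cong_right) (auto split: if_splits)
  finally show ?thesis .
qed

context sr_ring
begin

text \<open>The quotient is \<open>k[W]\<close>, a domain: a monomial of \<open>f * g\<close> that
  arises from exactly one pair of monomials cannot cancel.\<close>

lemma sri_Pow_prime:
  assumes f: "f \<in> poly_in V" and g: "g \<in> poly_in V" and fg: "f * g \<in> sri (Pow W)"
  shows "f \<in> sri (Pow W) \<or> g \<in> sri (Pow W)"
proof (rule ccontr)
  assume contra: "\<not> (f \<in> sri (Pow W) \<or> g \<in> sri (Pow W))"
  define A where "A = {a \<in> Poly_Mapping.keys f. Poly_Mapping.keys a \<subseteq> W}"
  define B where "B = {b \<in> Poly_Mapping.keys g. Poly_Mapping.keys b \<subseteq> W}"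
  have AV: "Poly_Mapping.keys a \<subseteq> V" if "a \<in> A \<union> B" for a
    using that f g by (auto simp: A_def B_def poly_in_def)
  have 0: "Poly_Mapping.lookup a v = 0" if "a \<in> A \<union> B" "v \<notin> V" for a v
    using AV[OF that(1)] that(2) by (metis in_keys_iff subsetD)
  have ne: "A \<noteq> {}" "B \<noteq> {}" using contra f g by (auto simp: A_def B_def sri_def)
  have "\<exists>\<alpha>\<in>A. \<exists>\<beta>\<in>B. \<forall>a\<in>A. \<forall>b\<in>B. a + b = \<alpha> + \<beta> \<longrightarrow> a = \<alpha> \<and> b = \<beta>"
  proof (rule unique_sum[OF finite_V _ _ ne])
    show "finite A" "finite B" by (auto simp: A_def B_def)
  qed (simp_all add: 0)
  then obtain \<alpha> \<beta> where ab: "\<alpha> \<in> A" "\<beta> \<in> B"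
    "\<And>a b. a \<in> A \<Longrightarrow> b \<in> B \<Longrightarrow> a + b = \<alpha> + \<beta> \<Longrightarrow> a = \<alpha> \<and> b = \<beta>" by blast
  have sub: "Poly_Mapping.keys (\<alpha> + \<beta>) \<subseteq> W" using ab(1,2) by (auto simp: A_def B_def keys_plus_nat)
  have "a = \<alpha> \<and> b = \<beta>"
    if "a \<in> Poly_Mapping.keys f" "b \<in> Poly_Mapping.keys g" "a + b = \<alpha> + \<beta>" for a b
  proof -
    have "Poly_Mapping.keys a \<union> Poly_Mapping.keys b \<subseteq> W" using sub that(3) keys_plus_nat by metis
    then show ?thesis using that ab(3) by (auto simp: A_def B_def)
  qed
  moreover have k: "\<alpha> \<in> Poly_Mapping.keys f" "\<beta> \<in> Poly_Mapping.keys g"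
    using ab by (auto simp: A_def B_def)
  ultimately have "{(a, b) \<in> Poly_Mapping.keys f \<times> Poly_Mapping.keys g. a + b = \<alpha> + \<beta>} = {(\<alpha>, \<beta>)}"
    by auto
  then have "Poly_Mapping.lookup (f * g) (\<alpha> + \<beta>) = Poly_Mapping.lookup f \<alpha> * Poly_Mapping.lookup g \<beta>"
    by (simp add: lookup_times)
  then have "\<alpha> + \<beta> \<in> Poly_Mapping.keys (f * g)" using k by (simp add: in_keys_iff)
  then show False using fg sub by (auto simp: sri_def)
qed

end

section \<open>Passing to the Stanley-Reisner ring\<close>

text \<open>Bridge between subsets of a ring type and the ring records in which Krull dimension and
  depth are defined. Prime ideals are pushed forward from \<open>S\<close> to \<open>Q\<close>;
  regular sequences are pulled back from \<open>Q\<close> to \<open>S\<close>.\<close>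

locale ring_surj = comm_subring S + Q: cring Q
  for S :: "'a::comm_ring_1 set" and Q :: "('q, 'm) ring_scheme" (structure) +
  fixes \<phi> :: "'a \<Rightarrow> 'q"
  assumes phi_closed: "p \<in> S \<Longrightarrow> \<phi> p \<in> carrier Q"
    and phi_add: "p \<in> S \<Longrightarrow> q \<in> S \<Longrightarrow> \<phi> (p + q) = \<phi> p \<oplus> \<phi> q"
    and phi_mult: "p \<in> S \<Longrightarrow> q \<in> S \<Longrightarrow> \<phi> (p * q) = \<phi> p \<otimes> \<phi> q"
    and phi_surj: "x \<in> carrier Q \<Longrightarrow> \<exists>p\<in>S. x = \<phi> p"
begin

definition ker :: "'a set" where
  "ker = {p \<in> S. \<phi> p = \<zero>}"

lemma phi_zero: "\<phi> 0 = \<zero>"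
  using phi_add[of 0 0] phi_closed[of 0] Q.add.l_cancel_one' by simp

lemma phi_uminus: "p \<in> S \<Longrightarrow> \<phi> (- p) = \<ominus> \<phi> p"
  using phi_add[of "- p" p] phi_closed[of p] phi_closed[of "- p"] phi_zero Q.minus_equality by simp

lemma phi_diff: "p \<in> S \<Longrightarrow> q \<in> S \<Longrightarrow> \<phi> (p - q) = \<phi> p \<ominus> \<phi> q"
  using phi_add[of p "- q"] phi_uminus[of q] by (simp add: a_minus_def)

lemma phi_eq_iff:
  assumes *: "p \<in> S" "q \<in> S" shows "\<phi> p = \<phi> q \<longleftrightarrow> p - q \<in> ker"
proof
  show "p - q \<in> ker" if "\<phi> p = \<phi> q"
    using that * phi_closed by (simp add: ker_def phi_diff a_minus_def Q.r_neg)
  show "\<phi> p = \<phi> q" if "p - q \<in> ker"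
    using phi_add[of "p - q" q] that * phi_closed by (simp add: ker_def)
qed

lemma image_ideal:
  assumes P: "idl P" shows "ideal (\<phi> ` P) Q"
proof (rule idealI)
  show "ring Q" by (rule Q.ring_axioms)
  show "subgroup (\<phi> ` P) (add_monoid Q)"
  proof (rule subgroup.intro)
    show "\<phi> ` P \<subseteq> carrier (add_monoid Q)" using P idl_sub phi_closed by auto
    show "\<one>\<^bsub>add_monoid Q\<^esub> \<in> \<phi> ` P" using idl_0[OF P] phi_zero by force
  next
    fix x y assume "x \<in> \<phi> ` P" "y \<in> \<phi> ` P"
    then obtain p q where "p \<in> P" "q \<in> P" "x = \<phi> p" "y = \<phi> q" by blast
    then have "p + q \<in> P" "x \<oplus> y = \<phi> (p + q)" using P idl_add idl_sub phi_add by auto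
    then show "x \<otimes>\<^bsub>add_monoid Q\<^esub> y \<in> \<phi> ` P" by simp
  next
    fix x assume "x \<in> \<phi> ` P"
    then obtain p where "p \<in> P" "x = \<phi> p" by blast
    then have "- p \<in> P" "\<ominus> x = \<phi> (- p)" using P idl_uminus idl_sub phi_uminus by auto
    then show "inv\<^bsub>add_monoid Q\<^esub> x \<in> \<phi> ` P" by (simp add: a_inv_def)
  qed
next
  fix a x assume "a \<in> \<phi> ` P" "x \<in> carrier Q"
  then obtain p s where "p \<in> P" "a = \<phi> p" "s \<in> S" "x = \<phi> s" using phi_surj by blast
  then have "x \<otimes> a = \<phi> (s * p)" "s * p \<in> P" "a \<otimes> x = \<phi> (p * s)" "p * s \<in> P"
    using P phi_mult idl_sub idl_mult idl_mult2 by auto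
  then show "x \<otimes> a \<in> \<phi> ` P" "a \<otimes> x \<in> \<phi> ` P" by auto
qed

lemma mem_image_iff:
  assumes P: "idl P" "ker \<subseteq> P" and p: "p \<in> S" shows "\<phi> p \<in> \<phi> ` P \<longleftrightarrow> p \<in> P"
proof
  assume "\<phi> p \<in> \<phi> ` P"
  then obtain q where q: "q \<in> P" "\<phi> p = \<phi> q" by blast
  then have "p - q \<in> P" using P p idl_sub phi_eq_iff by blast
  then show "p \<in> P" using idl_eqI P q by blast
qed auto

lemma image_primeideal:
  assumes P: "idl P" "ker \<subseteq> P" "1 \<notin> P"
    and prime: "\<And>f g. f \<in> S \<Longrightarrow> g \<in> S \<Longrightarrow> f * g \<in> P \<Longrightarrow> f \<in> P \<or> g \<in> P"
  shows "primeideal (\<phi> ` P) Q"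
proof (rule primeidealI)
  show "ideal (\<phi> ` P) Q" using P image_ideal by blast
  show "cring Q" by (rule Q.cring_axioms)
  show "carrier Q \<noteq> \<phi> ` P" using mem_image_iff[OF P(1,2), of 1] P(3) phi_closed[of 1] by auto
next
  fix a b assume ab: "a \<in> carrier Q" "b \<in> carrier Q" "a \<otimes> b \<in> \<phi> ` P"
  obtain f g where fg: "f \<in> S" "g \<in> S" "a = \<phi> f" "b = \<phi> g"
    using phi_surj[OF ab(1)] phi_surj[OF ab(2)] by blast
  then have "\<phi> (f * g) \<in> \<phi> ` P" using ab(3) phi_mult by simp
  then have "f * g \<in> P" using mem_image_iff[OF P(1,2), of "f * g"] fg by blast
  then show "a \<in> \<phi> ` P \<or> b \<in> \<phi> ` P" using prime[of f g] fg by blast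
qed

lemma krull_dim_ge:
  assumes P: "\<And>i. i \<le> n \<Longrightarrow> idl (P i)" "\<And>i. i \<le> n \<Longrightarrow> ker \<subseteq> P i" "\<And>i. i \<le> n \<Longrightarrow> 1 \<notin> P i"
    and prime: "\<And>i f g. i \<le> n \<Longrightarrow> f \<in> S \<Longrightarrow> g \<in> S \<Longrightarrow> f * g \<in> P i \<Longrightarrow> f \<in> P i \<or> g \<in> P i"
    and chain: "\<And>i. i < n \<Longrightarrow> P i \<subset> P (Suc i)"
  shows "enat n \<le> krull_dim Q"
  unfolding krull_dim_def
proof (rule Sup_upper, intro CollectI exI conjI allI impI)
  fix i assume i: "i < n"
  obtain p where p: "p \<in> P (Suc i)" "p \<notin> P i" using chain[OF i] by blast
  then have "\<phi> p \<notin> \<phi> ` P i" using mem_image_iff[of "P i" p] P[of i] P(1)[of "Suc i"] i idl_sub by auto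
  then show "\<phi> ` P i \<subset> \<phi> ` P (Suc i)" using p chain[OF i] by blast
qed (use P prime image_primeideal in auto)

lemma regular_sequence_lift:
  assumes xs: "regular_sequence Q xs" and M: "M \<subseteq> S" "set xs \<subseteq> \<phi> ` M"
  shows "\<exists>ys. length ys = length xs \<and> set ys \<subseteq> M \<and> reg_seq ker ys"
proof -
  have "\<forall>x\<in>set xs. \<exists>y. y \<in> M \<and> \<phi> y = x" using M by blast
  then obtain \<psi> where psi: "\<And>x. x \<in> set xs \<Longrightarrow> \<psi> x \<in> M \<and> \<phi> (\<psi> x) = x" by metis
  define ys where "ys = map \<psi> xs"
  have ys: "length ys = length xs" "set ys \<subseteq> M" using psi by (auto simp: ys_def)
  have xsQ: "set xs \<subseteq> carrier Q" using xs by (simp add: regular_sequence_def)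
  define G where "G i = genideal Q (set (take i xs))" for i
  have Gid: "ideal (G i) Q" for i
    unfolding G_def using xsQ set_take_subset[of i xs] by (intro Q.genideal_ideal) blast
  \<comment> \<open>Adjoining the first \<open>i\<close> lifts to the kernel gives the full preimage
    of the ideal generated by the first \<open>i\<close> elements; this invariant lets regularity be
    transferred from \<open>Q\<close> to \<open>S\<close>.\<close>
  have main: "reg_seq ker (take i ys) \<and> adjoins ker (take i ys) = {p \<in> S. \<phi> p \<in> G i}"
    if "i \<le> length xs" for i
    using that
  proof (induction i)
    case 0
    have "G 0 \<subseteq> {\<zero>}" unfolding G_def by (intro Q.genideal_minimal Q.zeroideal) auto
    moreover have "\<zero> \<in> G 0" using Gid[of 0] by (simp add: additive_subgroup.zero_closed ideal.axioms(1))
    ultimately have "G 0 = {\<zero>}" by blast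
    then show ?case by (auto simp: ker_def)
  next
    case (Suc i)
    define x where "x = xs ! i"
    define y where "y = ys ! i"
    have i: "i < length xs" using Suc.prems by simp
    have x: "x \<in> set xs" "x \<in> carrier Q" using i xsQ by (auto simp: x_def)
    have y: "y = \<psi> x" using i by (simp add: x_def y_def ys_def)
    have yS: "y \<in> S" "\<phi> y = x" using psi[OF x(1)] M(1) y by auto
    interpret Gi: ideal "G i" Q by (rule Gid)
    interpret Gs: ideal "G (Suc i)" Q by (rule Gid)
    define L where "L = {p \<in> S. \<phi> p \<in> G i}"
    have L: "adjoins ker (take i ys) = L" "reg_seq ker (take i ys)" using Suc by (auto simp: L_def)
    have "reg L y"
    proof (rule regI)
      fix f assume f: "f \<in> S" "y * f \<in> L"
      then have "\<phi> f \<otimes> xs ! i \<in> G i"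
        using yS phi_mult[of y f] phi_closed[of f] x Q.m_comm by (simp add: L_def x_def)
      then have "\<phi> f \<in> G i"
        using xs i f phi_closed unfolding regular_sequence_def G_def by blast
      then show "f \<in> L" using f by (simp add: L_def)
    qed
    moreover have tk: "take (Suc i) ys = take i ys @ [y]"
      using i ys by (simp add: take_Suc_conv_app_nth y_def)
    ultimately have "reg_seq ker (take (Suc i) ys)" using L by (simp add: reg_seq_append)
    moreover have "adjoin L y = {p \<in> S. \<phi> p \<in> G (Suc i)}"
    proof (intro equalityI subsetI)
      have tkx: "take (Suc i) xs = take i xs @ [x]"
        using i by (simp add: take_Suc_conv_app_nth x_def)
      have "G i \<subseteq> G (Suc i)" unfolding G_def
        using xsQ set_take_subset[of "Suc i" xs] tkx
        by (intro Q.subset_Idl_subset) auto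
      moreover have xG: "x \<in> G (Suc i)"
        using Q.genideal_self[of "set (take (Suc i) xs)"] xsQ set_take_subset[of "Suc i" xs]
        unfolding G_def tkx by auto
      ultimately show "p \<in> {p \<in> S. \<phi> p \<in> G (Suc i)}" if "p \<in> adjoin L y" for p
      proof -
        obtain l f where lf: "l \<in> S" "\<phi> l \<in> G i" "f \<in> S" "p = l + y * f"
          using \<open>p \<in> adjoin L y\<close> by (auto simp: L_def adjoin_def)
        then have "\<phi> p = \<phi> l \<oplus> x \<otimes> \<phi> f" using yS phi_add phi_mult by simp
        then show ?thesis using lf yS xG \<open>G i \<subseteq> G (Suc i)\<close> phi_closed
          by (auto intro!: Gs.a_closed Gs.I_r_closed)
      qed
      \<comment> \<open>\<open>genideal\<close> is accessible through minimality; comparison with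
        the sum of \<open>G i\<close> and a principal ideal gives its elements the shape that
        \<open>adjoin\<close> has.\<close>
      have "G (Suc i) \<subseteq> set_add Q (G i) (PIdl x)"
        unfolding G_def
      proof (rule Q.genideal_minimal)
        show "ideal (set_add Q (Idl (set (take i xs))) (PIdl x)) Q"
          using Gid[of i] Q.cgenideal_ideal[OF x(2)] Q.add_ideals by (simp add: G_def)
        have "a \<in> set_add Q (G i) (PIdl x)" if "a \<in> set (take i xs)" for a
        proof -
          have "a \<in> G i" using that Q.genideal_self[of "set (take i xs)"] xsQ set_take_subset[of i xs]
            unfolding G_def by blast
          moreover have "\<zero> \<in> PIdl x" using Q.cgenideal_ideal[OF x(2)]
            by (simp add: additive_subgroup.zero_closed ideal.axioms(1))
          moreover have "a = a \<oplus> \<zero>" using \<open>a \<in> G i\<close> Gi.Icarr by simp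
          ultimately show ?thesis unfolding set_add_def' by blast
        qed
        moreover have "x \<in> set_add Q (G i) (PIdl x)"
        proof -
          have "x = \<zero> \<oplus> x" using x by simp
          then show ?thesis using Gi.zero_closed Q.cgenideal_self[OF x(2)] unfolding set_add_def' by blast
        qed
        ultimately show "set (take (Suc i) xs) \<subseteq> set_add Q (Idl (set (take i xs))) (PIdl x)"
          unfolding tkx by (auto simp: G_def)
      qed
      fix p assume p: "p \<in> {p \<in> S. \<phi> p \<in> G (Suc i)}"
      then obtain g r where gr: "g \<in> G i" "r \<in> carrier Q" "\<phi> p = g \<oplus> r \<otimes> x"
        using \<open>G (Suc i) \<subseteq> set_add Q (G i) (PIdl x)\<close> unfolding set_add_def' cgenideal_def by blast
      obtain f where f: "f \<in> S" "r = \<phi> f" using phi_surj gr by blast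
      have "\<phi> (p - y * f) = (g \<oplus> x \<otimes> r) \<ominus> x \<otimes> r"
        using p f yS gr x Q.m_comm[of r x] by (simp add: phi_diff phi_mult)
      also have "\<dots> = g" using Gi.Icarr[OF gr(1)] x gr(2)
        by (simp add: a_minus_def Q.add.m_assoc Q.r_neg)
      finally have "p - y * f \<in> L" using gr p f yS by (simp add: L_def)
      then have "(p - y * f) + y * f \<in> adjoin L y" using f by (intro adjoinI)
      then show "p \<in> adjoin L y" by simp
    qed
    ultimately show ?case using L tk by (simp add: adjoins_snoc)
  qed
  from main[of "length xs"] have "reg_seq ker ys" using ys by simp
  then show ?thesis using ys by blast
qed

end

section \<open>The Stanley-Reisner ring as a quotient of a polynomial ring\<close>

lemma cring_polynomial_ring: "cring (polynomial_ring V :: ('v, 'k::field) mpoly ring)"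
proof -
  interpret comm_subring "poly_in V :: ('v, 'k) mpoly set" by (rule comm_subring_poly_in)
  show ?thesis
  proof (rule cringI)
    have "\<exists>y\<in>poly_in V. y + x = 0" if "x \<in> poly_in V" for x :: "('v, 'k) mpoly"
      using that by (intro bexI[of _ "- x"]) auto
    then show "abelian_group (polynomial_ring V :: ('v, 'k) mpoly ring)"
      by (intro abelian_groupI) (auto simp: polynomial_ring_def add_ac simp flip: poly_in_def)
    show "Group.comm_monoid (polynomial_ring V :: ('v, 'k) mpoly ring)"
      by (intro comm_monoidI) (auto simp: polynomial_ring_def mult_ac simp flip: poly_in_def)
  qed (auto simp: polynomial_ring_def algebra_simps)
qed

lemma polynomial_ring_simps [simp]:
  "carrier (polynomial_ring V) = poly_in V"
  "x \<oplus>\<^bsub>polynomial_ring V\<^esub> y = x + y"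
  "x \<otimes>\<^bsub>polynomial_ring V\<^esub> y = x * y"
  "\<zero>\<^bsub>polynomial_ring V\<^esub> = 0"
  "\<one>\<^bsub>polynomial_ring V\<^esub> = 1"
  by (auto simp: polynomial_ring_def poly_in_def)

lemma squarefree_monomial_eq:
  assumes "finite \<sigma>"
  shows "\<exists>e. squarefree_monomial \<sigma> = (Poly_Mapping.single e 1 :: ('v, 'k::field) mpoly) \<and>
    (\<forall>v. Poly_Mapping.lookup e v = (if v \<in> \<sigma> then 1 else 0))"
  using assms
proof (induction \<sigma> rule: finite_induct)
  case empty
  show ?case by (intro exI[of _ 0]) (simp add: squarefree_monomial_def)
next
  case (insert w \<sigma>)
  then obtain e where e: "squarefree_monomial \<sigma> = (Poly_Mapping.single e 1 :: ('v, 'k) mpoly)"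
    "\<And>v. Poly_Mapping.lookup e v = (if v \<in> \<sigma> then 1 else 0)" by blast
  have "squarefree_monomial (insert w \<sigma>) = (variable w * squarefree_monomial \<sigma> :: ('v, 'k) mpoly)"
    using insert.hyps by (simp add: squarefree_monomial_def)
  also have "\<dots> = Poly_Mapping.single (Poly_Mapping.single w 1 + e) 1"
    by (simp add: e(1) variable_def mult_single)
  finally show ?case using e(2) insert.hyps
    by (intro exI[of _ "Poly_Mapping.single w 1 + e"]) (auto simp: lookup_add lookup_single when_def)
qed

lemma ideal_polynomial_ring:
  assumes "comm_subring.idl (poly_in V) (P :: ('v, 'k::field) mpoly set)"
  shows "ideal P (polynomial_ring V)"
proof -
  interpret comm_subring "poly_in V :: ('v, 'k) mpoly set" by (rule comm_subring_poly_in)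
  interpret Q: cring "polynomial_ring V :: ('v, 'k) mpoly ring" by (rule cring_polynomial_ring)
  interpret ring_surj "poly_in V :: ('v, 'k) mpoly set" "polynomial_ring V" id
    by unfold_locales auto
  show ?thesis using image_ideal[OF assms] by simp
qed

text \<open>\<open>r\<close> substitutes 0 for the variables outside \<open>W\<close>: a product of
  monomials has its support in \<open>W\<close> only if both factors have.\<close>

lemma part_keys_mult:
  fixes p q :: "('v, 'k::field) mpoly" and W :: "'v set"
  defines "r \<equiv> part (\<lambda>a. Poly_Mapping.keys a \<subseteq> W)"
  shows "r (p * q) = r p * r q"
proof -
  define p' where "p' = part (\<lambda>a. \<not> Poly_Mapping.keys a \<subseteq> W) p"
  define q' where "q' = part (\<lambda>a. \<not> Poly_Mapping.keys a \<subseteq> W) q"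
  have p: "p = r p + p'" and q: "q = r q + q'" unfolding p'_def q'_def r_def by (rule part_split)+
  have "p * q = r p * r q + (p' * q + r p * q')"
    by (subst p, subst (1 2) q) (simp add: algebra_simps)
  then have "r (p * q) = r (r p * r q) + r (p' * q + r p * q')" by (simp add: r_def part_add)
  moreover have "r (r p * r q) = r p * r q"
  proof (rule poly_mapping_eqI)
    fix c
    have "Poly_Mapping.keys c \<subseteq> W" if "c \<in> Poly_Mapping.keys (r p * r q)"
      using that by (auto simp: r_def keys_part keys_plus_nat elim!: keys_multE)
    then show "Poly_Mapping.lookup (r (r p * r q)) c = Poly_Mapping.lookup (r p * r q) c"
      by (auto simp: r_def lookup_part in_keys_iff)
  qed
  moreover have "r (p' * q + r p * q') = 0"
  proof (rule poly_mapping_eqI)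
    fix c
    have "\<not> Poly_Mapping.keys c \<subseteq> W" if c: "c \<in> Poly_Mapping.keys (p' * q + r p * q')"
    proof -
      have "c \<in> Poly_Mapping.keys (p' * q) \<or> c \<in> Poly_Mapping.keys (r p * q')"
        using c keys_add[of "p' * q" "r p * q'"] by blast
      then have "\<exists>a b. c = a + b \<and> (a \<in> Poly_Mapping.keys p' \<or> b \<in> Poly_Mapping.keys q')"
        by (elim disjE keys_multE) blast+
      then obtain a b where ab: "c = a + b" "a \<in> Poly_Mapping.keys p' \<or> b \<in> Poly_Mapping.keys q'"
        by blast
      have "\<not> Poly_Mapping.keys a \<subseteq> W \<or> \<not> Poly_Mapping.keys b \<subseteq> W"
        using ab(2) unfolding p'_def q'_def keys_part by blast
      then show ?thesis unfolding ab(1) keys_plus_nat by blast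
    qed
    then show "Poly_Mapping.lookup (r (p' * q + r p * q')) c = Poly_Mapping.lookup 0 c"
      by (auto simp: r_def lookup_part in_keys_iff)
  qed
  ultimately show ?thesis by simp
qed

text \<open>Every monomial is divisible by the squarefree monomial of its support, so the generators
  produce all monomials whose support is a nonface.\<close>

lemma stanley_reisner_ideal_eq:
  fixes \<Gamma> :: "'v set set"
  assumes \<Gamma>: "abs_simplicial_complex \<Gamma>"
  defines "J \<equiv> {p :: ('v, 'k::field) mpoly. p \<in> poly_in (vertices \<Gamma>) \<and> (\<forall>a\<in>Poly_Mapping.keys p. Poly_Mapping.keys a \<notin> \<Gamma>)}"
  shows "stanley_reisner_ideal \<Gamma> = J" "ideal J (polynomial_ring (vertices \<Gamma>))"
proof -
  let ?W = "vertices \<Gamma>" and ?R = "polynomial_ring (vertices \<Gamma>) :: ('v, 'k) mpoly ring"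
  let ?G = "squarefree_monomial ` {\<sigma>. \<sigma> \<subseteq> ?W \<and> \<sigma> \<notin> \<Gamma>} :: ('v, 'k) mpoly set"
  interpret comm_subring "poly_in ?W :: ('v, 'k) mpoly set" by (rule comm_subring_poly_in)
  interpret R: cring ?R by (rule cring_polynomial_ring)
  have down: "\<And>\<sigma> \<tau>. \<sigma> \<in> \<Gamma> \<Longrightarrow> \<tau> \<subseteq> \<sigma> \<Longrightarrow> \<tau> \<in> \<Gamma>" and fin: "finite ?W"
    using \<Gamma> by (auto simp: abs_simplicial_complex_def)
  have "idl J"
  proof (rule idlI)
    fix a b assume "a \<in> J" "b \<in> J"
    then show "a + b \<in> J" using keys_add[of a b] by (auto simp: J_def)
  next
    fix p s :: "('v, 'k) mpoly" assume p: "p \<in> J" and s: "s \<in> poly_in ?W"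
    have "Poly_Mapping.keys c \<notin> \<Gamma>" if c: "c \<in> Poly_Mapping.keys (s * p)" for c
    proof -
      obtain a b where ab: "b \<in> Poly_Mapping.keys p" "c = a + b" using keys_multE[OF c] by metis
      then have "Poly_Mapping.keys b \<notin> \<Gamma>" using p by (auto simp: J_def)
      then show ?thesis using ab down[of "Poly_Mapping.keys c" "Poly_Mapping.keys b"]
        by (auto simp: keys_plus_nat)
    qed
    then show "s * p \<in> J" using p s by (auto simp: J_def)
  qed (auto simp: J_def)
  then show J: "ideal J ?R" by (rule ideal_polynomial_ring)
  have sq: "\<exists>e. squarefree_monomial \<sigma> = (Poly_Mapping.single e 1 :: ('v, 'k) mpoly) \<and>
    Poly_Mapping.keys e = \<sigma> \<and> (\<forall>v. Poly_Mapping.lookup e v = (if v \<in> \<sigma> then 1 else 0))" if \<sigma>: "\<sigma> \<subseteq> ?W" for \<sigma>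
  proof -
    obtain e where e: "squarefree_monomial \<sigma> = (Poly_Mapping.single e 1 :: ('v, 'k) mpoly)"
      "\<forall>v. Poly_Mapping.lookup e v = (if v \<in> \<sigma> then 1 else 0)"
      using squarefree_monomial_eq[of \<sigma>] finite_subset[OF \<sigma> fin] by blast
    then have "Poly_Mapping.keys e = \<sigma>" by (auto simp: in_keys_iff split: if_splits)
    then show ?thesis using e by blast
  qed
  have GJ: "?G \<subseteq> J"
  proof
    fix p :: "('v, 'k) mpoly" assume "p \<in> ?G"
    then obtain \<sigma> where s: "\<sigma> \<subseteq> ?W" "\<sigma> \<notin> \<Gamma>" "p = squarefree_monomial \<sigma>" by blast
    then obtain e where "p = Poly_Mapping.single e 1" "Poly_Mapping.keys e = \<sigma>" using sq by blast
    then show "p \<in> J" using s by (simp add: J_def single_in)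
  qed
  have GR: "?G \<subseteq> carrier ?R" using GJ by (auto simp: J_def)
  interpret I: ideal "genideal ?R ?G" ?R using GR by (rule R.genideal_ideal)
  show "stanley_reisner_ideal \<Gamma> = J"
  proof
    show "stanley_reisner_ideal \<Gamma> \<subseteq> J"
      unfolding stanley_reisner_ideal_def using J GJ by (rule R.genideal_minimal)
    show "J \<subseteq> stanley_reisner_ideal \<Gamma>"
    proof
      fix p assume p: "p \<in> J"
      have mono: "Poly_Mapping.single a c \<in> genideal ?R ?G"
        if ka: "Poly_Mapping.keys a \<subseteq> ?W" "Poly_Mapping.keys a \<notin> \<Gamma>" for a c
      proof -
        obtain e where e: "squarefree_monomial (Poly_Mapping.keys a) = (Poly_Mapping.single e 1 :: ('v, 'k) mpoly)"
          "\<And>v. Poly_Mapping.lookup e v = (if v \<in> Poly_Mapping.keys a then 1 else 0)" using sq[OF ka(1)] by blast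
        have a: "a = (a - e) + e"
          by (rule poly_mapping_eqI) (auto simp: lookup_add lookup_minus e(2) in_keys_iff)
        have "Poly_Mapping.keys (a - e) \<subseteq> ?W"
          using ka(1) arg_cong[OF a, of Poly_Mapping.keys] by (simp add: keys_plus_nat)
        then have "Poly_Mapping.single (a - e) c \<in> carrier ?R" by (simp add: single_in)
        moreover have "squarefree_monomial (Poly_Mapping.keys a) \<in> ?G" using ka by blast
        then have "Poly_Mapping.single e 1 \<in> genideal ?R ?G"
          using R.genideal_self[OF GR] e(1) by auto
        ultimately have "Poly_Mapping.single (a - e) c * Poly_Mapping.single e 1 \<in> genideal ?R ?G"
          using I.I_l_closed[of "Poly_Mapping.single e 1" "Poly_Mapping.single (a - e) c"] by simp
        moreover have "Poly_Mapping.single (a - e) c * Poly_Mapping.single e 1 = Poly_Mapping.single a c"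
          by (simp add: mult_single flip: a)
        ultimately show ?thesis by simp
      qed
      have sums: "sum f A \<in> genideal ?R ?G" if "\<And>a. a \<in> A \<Longrightarrow> f a \<in> genideal ?R ?G"
        for f and A :: "('v \<Rightarrow>\<^sub>0 nat) set"
        using that by (induction A rule: infinite_finite_induct)
          (use I.zero_closed I.a_closed in auto)
      have "(\<Sum>a\<in>Poly_Mapping.keys p. Poly_Mapping.single a (Poly_Mapping.lookup p a)) \<in> genideal ?R ?G"
        using p by (intro sums mono) (auto simp: J_def poly_in_def)
      then show "p \<in> stanley_reisner_ideal \<Gamma>"
        by (simp add: stanley_reisner_ideal_def poly_mapping_sum_single)
    qed
  qed
qed

context sr_ring
begin

text \<open>A face \<open>F\<close> yields a chain of \<open>card F + 1\<close> primes, so the Krull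
  dimension is at least \<open>card F\<close>. The Cohen-Macaulay property turns this into a regular
  sequence of at least that length, which is lifted to \<open>k[V]\<close>.\<close>

lemma depth_ge_cohen_macaulay:
  assumes \<Gamma>: "abs_simplicial_complex \<Gamma>" and WV: "vertices \<Gamma> \<subseteq> V"
    and cm: "cohen_macaulay TYPE('k) \<Gamma>" and F: "F \<in> \<Gamma>"
  shows "depth_ge (card F) (sri \<Gamma>)"
proof -
  let ?W = "vertices \<Gamma>" and ?R = "polynomial_ring (vertices \<Gamma>) :: ('v, 'k) mpoly ring"
  let ?I = "stanley_reisner_ideal \<Gamma> :: ('v, 'k) mpoly set"
  let ?Q = "stanley_reisner_ring \<Gamma> :: ('v, 'k) mpoly set ring"
  \<comment> \<open>The ring of \<Gamma> is defined over its own vertices; \<open>r\<close> is the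
    retraction of \<open>k[V]\<close> onto that smaller polynomial ring, so \<open>\<phi>\<close>
    kills the additional variables.\<close>
  define r :: "('v, 'k) mpoly \<Rightarrow> ('v, 'k) mpoly" where "r = part (\<lambda>a. Poly_Mapping.keys a \<subseteq> ?W)"
  define \<phi> where "\<phi> p = ?I +>\<^bsub>?R\<^esub> r p" for p
  have down: "\<And>\<sigma> \<tau>. \<sigma> \<in> \<Gamma> \<Longrightarrow> \<tau> \<subseteq> \<sigma> \<Longrightarrow> \<tau> \<in> \<Gamma>"
    using \<Gamma> by (auto simp: abs_simplicial_complex_def)
  have dc: "down_closed \<Gamma>" using down by (auto simp: down_closed_def)
  interpret R: cring ?R by (rule cring_polynomial_ring)
  note I_eq = stanley_reisner_ideal_eq[OF \<Gamma>, where 'k = 'k]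
  interpret I: ideal ?I ?R using I_eq by simp
  interpret Q: cring ?Q unfolding stanley_reisner_ring_def by (rule I.quotient_is_cring[OF R.cring_axioms])
  interpret h: ring_hom_ring ?R ?Q "(+>\<^bsub>?R\<^esub>) ?I"
    unfolding stanley_reisner_ring_def by (rule I.rcos_ring_hom_ring)
  have r_in: "r p \<in> poly_in ?W" if "p \<in> poly_in V" for p
    using that by (auto simp: r_def poly_in_def keys_part)
  have r_id: "r p = p" if "p \<in> poly_in ?W" for p
  proof (rule poly_mapping_eqI)
    show "Poly_Mapping.lookup (r p) a = Poly_Mapping.lookup p a" for a
      using that by (auto simp: r_def lookup_part poly_in_def in_keys_iff)
  qed
  interpret ring_surj "poly_in V :: ('v, 'k) mpoly set" ?Q \<phi>
  proof
    fix p q :: "('v, 'k) mpoly" assume pq: "p \<in> poly_in V" "q \<in> poly_in V"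
    show "\<phi> p \<in> carrier ?Q" using h.hom_closed[of "r p"] r_in pq by (simp add: \<phi>_def)
    show "\<phi> (p + q) = \<phi> p \<oplus>\<^bsub>?Q\<^esub> \<phi> q"
      using h.hom_add[of "r p" "r q"] r_in pq by (simp add: \<phi>_def r_def part_add)
    show "\<phi> (p * q) = \<phi> p \<otimes>\<^bsub>?Q\<^esub> \<phi> q"
      using h.hom_mult[of "r p" "r q"] r_in pq by (simp add: \<phi>_def r_def part_keys_mult)
  next
    fix x assume "x \<in> carrier ?Q"
    then obtain p where "p \<in> poly_in ?W" "x = ?I +>\<^bsub>?R\<^esub> p"
      by (auto simp: stanley_reisner_ring_def FactRing_def A_RCOSETS_def')
    then have "p \<in> poly_in V" "x = \<phi> p" using r_id poly_in_mono[OF WV] by (auto simp: \<phi>_def)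
    then show "\<exists>p\<in>poly_in V. x = \<phi> p" by blast
  qed
  have zQ: "\<zero>\<^bsub>?Q\<^esub> = ?I" by (simp add: stanley_reisner_ring_def FactRing_def)
  have ker_eq: "ker = sri \<Gamma>"
  proof -
    have "\<phi> p = \<zero>\<^bsub>?Q\<^esub> \<longleftrightarrow> p \<in> sri \<Gamma>" if p: "p \<in> poly_in V" for p
    proof -
      have "\<phi> p = \<zero>\<^bsub>?Q\<^esub> \<longleftrightarrow> r p \<in> ?I"
        using I.rcos_const_imp_mem[of "r p"] I.a_rcos_const[of "r p"] r_in[OF p] zQ
        by (auto simp: \<phi>_def)
      also have "\<dots> \<longleftrightarrow> p \<in> sri \<Gamma>"
        using p r_in[OF p] by (auto simp: I_eq(1) sri_def r_def keys_part vertices_def)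
      finally show ?thesis .
    qed
    then show ?thesis by (auto simp: ker_def sri_def)
  qed
  have FW: "F \<subseteq> ?W" using F by (auto simp: vertices_def)
  then have "finite F" using \<Gamma> by (auto simp: abs_simplicial_complex_def intro: finite_subset)
  then obtain us where us: "set us = F" "distinct us" using finite_distinct_list by blast
  have krull: "enat (card F) \<le> krull_dim ?Q"
  proof (rule krull_dim_ge)
    \<comment> \<open>The vertices of \<open>F\<close> are removed one at a time; the quotient by
      \<open>P i\<close> is the polynomial ring in the remaining ones.\<close>
    define P where "P i = sri (Pow (set (drop i us)))" for i
    fix i
    show "idl (P i)" by (simp add: P_def idl_sri down_closed_Pow)
    show "ker \<subseteq> P i" unfolding ker_eq P_def
    proof (rule sri_antimono)
      show "Pow (set (drop i us)) \<subseteq> \<Gamma>" using down[OF F] us(1) set_drop_subset[of i us] by blast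
    qed
    show "1 \<notin> P i" by (simp add: P_def sri_def)
    show "f \<in> P i \<or> g \<in> P i" if "f \<in> poly_in V" "g \<in> poly_in V" "f * g \<in> P i" for f g
      using that unfolding P_def by (rule sri_Pow_prime)
    assume i: "i < card F"
    then have i': "i < length us" using us distinct_card by fastforce
    have "drop i us = us ! i # drop (Suc i) us" using i' by (simp add: Cons_nth_drop_Suc)
    moreover have "distinct (drop i us)" using us by simp
    ultimately have "set (drop i us) = insert (us ! i) (set (drop (Suc i) us))" "us ! i \<notin> set (drop (Suc i) us)" by auto
    moreover have "us ! i \<in> V" using us(1) i' FW WV nth_mem by blast
    ultimately have "variable (us ! i) \<in> P (Suc i)" "variable (us ! i) \<notin> P i" "P i \<subseteq> P (Suc i)"
      by (auto simp: P_def sri_def variable_def poly_in_def)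
    then show "P i \<subset> P (Suc i)" by blast
  qed
  show ?thesis
  proof (cases "card F = 0")
    case True
    then show ?thesis by (simp add: depth_ge_0)
  next
    case False
    have depth: "enat (card F) \<le> ring_depth ?Q (irrelevant_ideal \<Gamma>)"
      using krull cm by (simp add: cohen_macaulay_def)
    \<comment> \<open>The depth is a supremum in \<open>enat\<close>: if no admissible sequence
      reached length \<open>card F\<close>, the supremum would be at most \<open>card F - 1\<close>,
      a true subtraction because \<open>card F\<close> is positive here.\<close>
    obtain xs where xs: "card F \<le> length xs" "set xs \<subseteq> (irrelevant_ideal \<Gamma> :: ('v, 'k) mpoly set set)"
      "regular_sequence ?Q xs"
    proof (atomize_elim, rule ccontr)
      assume no: "\<nexists>xs. card F \<le> length xs \<and> set xs \<subseteq> (irrelevant_ideal \<Gamma> :: ('v, 'k) mpoly set set) \<and> regular_sequence ?Q xs"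
      have "length xs \<le> card F - 1"
        if "set xs \<subseteq> (irrelevant_ideal \<Gamma> :: ('v, 'k) mpoly set set)" "regular_sequence ?Q xs" for xs
        using that no by force
      then have "ring_depth ?Q (irrelevant_ideal \<Gamma>) \<le> enat (card F - 1)"
        unfolding ring_depth_def by (intro Sup_least) auto
      then have "enat (card F) \<le> enat (card F - 1)" using depth by (rule order_trans[rotated])
      then show False using False by simp
    qed
    have idl_irr: "idl (irr V)"
    proof (rule idlI)
      fix a b :: "('v, 'k) mpoly" assume "a \<in> irr V" "b \<in> irr V"
      then show "a + b \<in> irr V" by (auto simp: irr_def in_keys_iff lookup_add)
    next
      fix a s :: "('v, 'k) mpoly" assume a: "a \<in> irr V" and s: "s \<in> poly_in V"
      have "0 \<notin> Poly_Mapping.keys (s * a)"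
      proof
        assume "0 \<in> Poly_Mapping.keys (s * a)"
        then obtain x y where xy: "y \<in> Poly_Mapping.keys a" "0 = x + y" by (metis keys_multE)
        have "Poly_Mapping.keys y = {}" using keys_plus_nat[of x y] xy(2) by auto
        then have "y = 0" by (metis empty_iff in_keys_iff lookup_zero poly_mapping_eqI)
        then show False using xy a by (simp add: irr_def)
      qed
      then show "s * a \<in> irr V" using a s by (simp add: irr_def)
    qed (auto simp: irr_def)
    have "irrelevant_ideal \<Gamma> \<subseteq> \<phi> ` irr V"
      unfolding irrelevant_ideal_def
    proof (rule Q.genideal_minimal[OF image_ideal[OF idl_irr]])
      have "?I +>\<^bsub>?R\<^esub> variable v = \<phi> (variable v)" if "v \<in> ?W" for v
        using that by (simp add: \<phi>_def r_id variable_in)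
      then show "(\<lambda>v. ?I +>\<^bsub>?R\<^esub> variable v) ` ?W \<subseteq> \<phi> ` irr V"
        using variable_irr WV by blast
    qed
    then have "set xs \<subseteq> \<phi> ` irr V" using xs(2) by blast
    then obtain ys where "length ys = length xs" "set ys \<subseteq> irr V" "reg_seq (sri \<Gamma>) ys"
      using regular_sequence_lift[OF xs(3), of "irr V"] ker_eq M_sub by auto
    then have "depth_ge (length xs) (sri \<Gamma>)" unfolding depth_ge_def by metis
    then show ?thesis using xs(1) depth_ge_mono by blast
  qed
qed

end

section \<open>Hilbert functions\<close>

context vector_space
begin

lemma span_finite_dim_mono:
  assumes "U \<subseteq> W" "finite F" "W \<subseteq> span F"
  shows "dim U \<le> dim W" and "subspace U \<Longrightarrow> dim U = dim W \<Longrightarrow> U = W"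
proof -
  obtain B where B: "B \<subseteq> U" "independent B" "U \<subseteq> span B" by (rule maximal_independent_subset)
  obtain C where C: "B \<subseteq> C" "C \<subseteq> W" "independent C" "W \<subseteq> span C"
    using maximal_independent_subset_extend[of B W] B assms(1) by blast
  have fin: "finite C" using independent_span_bound[OF assms(2) C(3)] C(2) assms(3) by blast
  have dims: "dim U = card B" "dim W = card C"
    using basis_card_eq_dim B C by metis+
  then show "dim U \<le> dim W" using C(1) fin by (simp add: card_mono)
  assume "subspace U" "dim U = dim W"
  then have "B = C" using dims C(1) fin by (simp add: card_subset_eq)
  then have "W \<subseteq> U" using C(4) span_minimal[OF B(1) \<open>subspace U\<close>] by blast
  then show "U = W" using assms(1) by blast
qed

text \<open>\<open>f\<close> induces an isomorphism from \<open>Y / X\<close> to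
  \<open>W / U\<close>. A basis of \<open>X\<close> is extended to \<open>Y\<close>, and the images
  of the added vectors complete a basis of \<open>U\<close> to one of \<open>W\<close>. Finite
  spanning sets are supplied because the ambient space may have infinite dimension.\<close>

lemma dim_shift:
  assumes f: "Vector_Spaces.linear scale scale f"
    and sub: "subspace U" "subspace X"
    and W: "W = {u + f y | u y. u \<in> U \<and> y \<in> Y}" and X: "X = {y \<in> Y. f y \<in> U}" and Y: "subspace Y"
    and fin: "finite F" "W \<subseteq> span F" "finite G" "Y \<subseteq> span G"
  shows "dim W + dim X = dim U + dim Y"
proof -
  interpret f: Vector_Spaces.linear scale scale f by fact
  have YX: "X \<subseteq> Y" using X by blast
  have UW: "U \<subseteq> W"
  proof
    fix u assume "u \<in> U"
    moreover have "u = u + f 0" by simp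
    ultimately show "u \<in> W" unfolding W using subspace_0[OF Y] by blast
  qed
  obtain Bx where Bx: "Bx \<subseteq> X" "independent Bx" "X \<subseteq> span Bx" by (rule maximal_independent_subset)
  obtain By where By: "Bx \<subseteq> By" "By \<subseteq> Y" "independent By" "Y \<subseteq> span By"
    using maximal_independent_subset_extend[of Bx Y] Bx YX by blast
  obtain Bu where Bu: "Bu \<subseteq> U" "independent Bu" "U \<subseteq> span Bu" by (rule maximal_independent_subset)
  have finBy: "finite By" using independent_span_bound[OF fin(3) By(3)] By(2) fin(4) by blast
  have finBu: "finite Bu" using independent_span_bound[OF fin(1) Bu(2)] Bu(1) UW fin(2) by blast
  have spU: "span Bu = U" using Bu span_minimal[OF _ sub(1)] by blast
  define C where "C = By - Bx"
  have "C' \<subseteq> C \<Longrightarrow> independent (Bu \<union> f ` C') \<and> card (Bu \<union> f ` C') = card Bu + card C'"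
    if "finite C'" for C'
    using that
  proof (induction C' rule: finite_induct)
    case empty
    then show ?case using Bu by simp
  next
    case (insert c C')
    \<comment> \<open>Otherwise \<open>f\<close> maps \<open>c - s\<close> into \<open>U\<close> for
      some \<open>s\<close> in the span of \<open>C'\<close>; then \<open>c - s\<close> lies in
      \<open>X\<close>, and \<open>c\<close> depends on the rest of the basis
      \<open>By\<close>.\<close>
    have "f c \<notin> span (Bu \<union> f ` C')"
    proof
      assume "f c \<in> span (Bu \<union> f ` C')"
      then obtain u w where uw: "u \<in> U" "w \<in> span (f ` C')" "f c = u + w"
        unfolding span_Un spU by blast
      then obtain s where s: "s \<in> span C'" "w = f s" using f.span_image[of C'] by blast
      have C'Y: "C' \<subseteq> Y" "c \<in> Y" using insert.prems By(2) by (auto simp: C_def)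
      then have "s \<in> Y" using s(1) span_minimal[OF _ Y] by blast
      then have "c - s \<in> Y" using C'Y Y subspace_diff by blast
      moreover have "f (c - s) \<in> U" using uw s by (simp add: f.diff)
      ultimately have "c - s \<in> span Bx" using X Bx by blast
      moreover have "Bx \<subseteq> By - {c}" "C' \<subseteq> By - {c}"
        using insert By(1) by (auto simp: C_def)
      ultimately have "c - s \<in> span (By - {c})" "s \<in> span (By - {c})"
        using s(1) span_mono by blast+
      then have "(c - s) + s \<in> span (By - {c})" by (rule span_add)
      then have "c \<in> span (By - {c})" by simp
      moreover have "c \<in> By" using insert.prems by (auto simp: C_def)
      ultimately show False using By(3) by (auto simp: dependent_def)
    qed
    moreover from this have "f c \<notin> Bu \<union> f ` C'" using span_base[of "f c"] by metis
    ultimately show ?case using insert finBu by (simp add: independent_insertI)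
  qed
  then have ind: "independent (Bu \<union> f ` C)" "card (Bu \<union> f ` C) = card Bu + card C"
    using finBy by (auto simp: C_def)
  have "Bu \<union> f ` C \<subseteq> W"
  proof -
    have "f c \<in> W" if "c \<in> C" for c
    proof -
      have "f c = 0 + f c" "c \<in> Y" using that By(2) by (auto simp: C_def)
      then show ?thesis unfolding W using subspace_0[OF sub(1)] by blast
    qed
    then show ?thesis using Bu(1) UW by blast
  qed
  moreover have "W \<subseteq> span (Bu \<union> f ` C)"
  proof
    fix w assume "w \<in> W"
    then obtain u y where uy: "u \<in> U" "y \<in> Y" "w = u + f y" using W by blast
    have "By = Bx \<union> C" using By(1) by (auto simp: C_def)
    then have "y \<in> span (Bx \<union> C)" using uy(2) By(4) by auto
    then obtain a b where ab: "a \<in> span Bx" "b \<in> span C" "y = a + b"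
      unfolding span_Un by blast
    have "a \<in> X" using ab(1) span_minimal[OF Bx(1) sub(2)] by blast
    then have "u + f a \<in> U" using X uy(1) subspace_add[OF sub(1)] by blast
    moreover have "f b \<in> span (f ` C)" using ab(2) f.span_image[of C] by blast
    moreover have "w = (u + f a) + f b" using uy ab by (simp add: f.add add.assoc)
    ultimately show "w \<in> span (Bu \<union> f ` C)" unfolding span_Un spU by blast
  qed
  ultimately have "dim W = card Bu + card C" using ind basis_card_eq_dim by metis
  moreover have "dim U = card Bu" "dim X = card Bx" "dim Y = card By"
    using basis_card_eq_dim Bu Bx By by metis+
  moreover have "card By = card Bx + card C"
    using By(1) finBy by (simp add: C_def card_Diff_subset card_mono finite_subset)
  ultimately show ?thesis by simp
qed

end

interpretation mpoly: vector_space "\<lambda>(c :: 'k::field) (p :: ('v, 'k) mpoly). const c * p"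
  by unfold_locales (simp_all add: distrib_left distrib_right single_add mult_single flip: mult.assoc)

definition mdeg :: "('v \<Rightarrow>\<^sub>0 nat) \<Rightarrow> nat" where
  "mdeg a = (\<Sum>v\<in>Poly_Mapping.keys a. Poly_Mapping.lookup a v)"

lemma mdeg_superset:
  assumes "finite W" "Poly_Mapping.keys a \<subseteq> W"
  shows "mdeg a = (\<Sum>v\<in>W. Poly_Mapping.lookup a v)"
  unfolding mdeg_def using assms by (intro sum.mono_neutral_left) (auto simp: in_keys_iff)

lemma mdeg_add: "mdeg (a + b) = mdeg a + mdeg b"
proof -
  let ?W = "Poly_Mapping.keys a \<union> Poly_Mapping.keys b"
  have "mdeg (a + b) = (\<Sum>v\<in>?W. Poly_Mapping.lookup (a + b) v)"
    by (intro mdeg_superset) (auto simp: keys_plus_nat)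
  also have "\<dots> = mdeg a + mdeg b"
    using mdeg_superset[of ?W a] mdeg_superset[of ?W b] by (simp add: lookup_add sum.distrib)
  finally show ?thesis .
qed

lemma mdeg_single: "mdeg (Poly_Mapping.single v n) = n"
  by (simp add: mdeg_def)

lemma card_keys_le_mdeg: "card (Poly_Mapping.keys a) \<le> mdeg a"
proof -
  have "card (Poly_Mapping.keys a) = (\<Sum>v\<in>Poly_Mapping.keys a. 1)" by simp
  also have "\<dots> \<le> mdeg a" unfolding mdeg_def by (intro sum_mono) (simp add: in_keys_iff Suc_leI)
  finally show ?thesis .
qed

context sr_ring
begin

definition mons :: "nat \<Rightarrow> ('v \<Rightarrow>\<^sub>0 nat) set" where
  "mons k = {a. Poly_Mapping.keys a \<subseteq> V \<and> mdeg a = k}"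

definition hom :: "nat \<Rightarrow> ('v, 'k) mpoly set" where
  "hom k = {p. Poly_Mapping.keys p \<subseteq> mons k}"

definition graded :: "('v, 'k) mpoly set \<Rightarrow> bool" where
  "graded L \<longleftrightarrow> (\<forall>p\<in>L. \<forall>k. part (\<lambda>a. mdeg a = k) p \<in> L)"

text \<open>For graded \<open>L\<close>, the dimension of the degree \<open>k\<close> part of
  \<open>k[V] / L\<close>, written without quotient spaces.\<close>

definition hilb :: "('v, 'k) mpoly set \<Rightarrow> nat \<Rightarrow> int" where
  "hilb L k = int (mpoly.dim (hom k)) - int (mpoly.dim (L \<inter> hom k))"

lemma finite_mons: "finite (mons k)"
proof -
  have "mons k \<subseteq> (\<lambda>f. Abs_poly_mapping (\<lambda>v. if v \<in> V then f v else 0)) ` (V \<rightarrow>\<^sub>E {..k})"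
  proof
    fix a assume a: "a \<in> mons k"
    define f where "f = restrict (Poly_Mapping.lookup a) V"
    have "Poly_Mapping.lookup a v \<le> k" if "v \<in> V" for v
    proof -
      have "k = (\<Sum>v\<in>V. Poly_Mapping.lookup a v)"
        using mdeg_superset[OF finite_V, of a] a by (simp add: mons_def)
      then show ?thesis using member_le_sum[OF that, of "Poly_Mapping.lookup a"] finite_V by simp
    qed
    then have "f \<in> V \<rightarrow>\<^sub>E {..k}" by (auto simp: f_def)
    moreover have "(\<lambda>v. if v \<in> V then f v else 0) = Poly_Mapping.lookup a"
      using a by (auto simp: f_def mons_def in_keys_iff fun_eq_iff)
    then have "a = Abs_poly_mapping (\<lambda>v. if v \<in> V then f v else 0)"
      by (simp add: lookup_inverse)
    ultimately show "a \<in> (\<lambda>f. Abs_poly_mapping (\<lambda>v. if v \<in> V then f v else 0)) ` (V \<rightarrow>\<^sub>E {..k})"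
      by blast
  qed
  then show ?thesis using finite_V by (meson finite_PiE finite_atMost finite_imageI finite_subset)
qed

lemma hom_sub: "p \<in> hom k \<Longrightarrow> p \<in> poly_in V"
  by (auto simp: hom_def mons_def poly_in_def)

lemma hom_part: "p \<in> poly_in V \<Longrightarrow> part (\<lambda>a. mdeg a = k) p \<in> hom k"
  by (auto simp: hom_def mons_def poly_in_def keys_part)

lemma part_hom: assumes "p \<in> hom k" shows "part (\<lambda>a. mdeg a = j) p = (if j = k then p else 0)"
proof (rule poly_mapping_eqI)
  fix a show "Poly_Mapping.lookup (part (\<lambda>a. mdeg a = j) p) a = Poly_Mapping.lookup (if j = k then p else 0) a"
    using assms by (auto simp: lookup_part hom_def mons_def in_keys_iff)
qed

lemma hom_mult: assumes "p \<in> hom j" "q \<in> hom k" shows "p * q \<in> hom (j + k)"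
  unfolding hom_def mem_Collect_eq
proof
  fix c assume "c \<in> Poly_Mapping.keys (p * q)"
  then obtain a b where "a \<in> Poly_Mapping.keys p" "b \<in> Poly_Mapping.keys q" "c = a + b"
    by (metis keys_multE)
  then show "c \<in> mons (j + k)" using assms by (auto simp: hom_def mons_def keys_plus_nat mdeg_add)
qed

lemma hom_power: assumes "p \<in> hom 1" shows "p ^ n \<in> hom n"
proof (induction n)
  case 0
  then show ?case by (simp add: hom_def mons_def mdeg_def)
next
  case (Suc n)
  then show ?case using hom_mult[OF assms Suc] by simp
qed

lemma part_linear_mult:
  assumes x: "x \<in> hom 1" and p: "p \<in> poly_in V"
  shows "part (\<lambda>a. mdeg a = Suc k) (x * p) = x * part (\<lambda>a. mdeg a = k) p"
    and "part (\<lambda>a. mdeg a = 0) (x * p) = 0"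
proof -
  have k: "\<exists>b \<in> Poly_Mapping.keys p. mdeg c = Suc (mdeg b) \<and> P b"
    if c: "c \<in> Poly_Mapping.keys (x * part P p)" for c P
  proof -
    obtain a b where "a \<in> Poly_Mapping.keys x" "b \<in> Poly_Mapping.keys (part P p)" "c = a + b"
      using keys_multE[OF c] by metis
    then show ?thesis
      using x by (intro bexI[of _ b]) (auto simp: hom_def mons_def mdeg_add keys_part)
  qed
  have s: "x * p = x * part P p + x * part (\<lambda>a. \<not> P a) p" for P
    by (subst part_split[of p P]) (simp add: distrib_left)
  show "part (\<lambda>a. mdeg a = Suc k) (x * p) = x * part (\<lambda>a. mdeg a = k) p"
  proof (rule poly_mapping_eqI)
    fix c
    show "Poly_Mapping.lookup (part (\<lambda>a. mdeg a = Suc k) (x * p)) c =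
      Poly_Mapping.lookup (x * part (\<lambda>a. mdeg a = k) p) c"
    proof (cases "mdeg c = Suc k")
      case True
      then have "c \<notin> Poly_Mapping.keys (x * part (\<lambda>a. mdeg a \<noteq> k) p)" using k by fastforce
      then show ?thesis using True s[of "\<lambda>a. mdeg a = k"] by (simp add: lookup_part lookup_add in_keys_iff)
    next
      case False
      then have "c \<notin> Poly_Mapping.keys (x * part (\<lambda>a. mdeg a = k) p)" using k by fastforce
      then show ?thesis using False by (simp add: lookup_part in_keys_iff)
    qed
  qed
  show "part (\<lambda>a. mdeg a = 0) (x * p) = 0"
  proof (rule poly_mapping_eqI)
    fix c
    have "part (\<lambda>_. True) p = p" by (rule poly_mapping_eqI) (simp add: lookup_part)
    then have "c \<notin> Poly_Mapping.keys (x * p)" if "mdeg c = 0" using k[of c "\<lambda>_. True"] that by auto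
    then show "Poly_Mapping.lookup (part (\<lambda>a. mdeg a = 0) (x * p)) c = Poly_Mapping.lookup 0 c"
      by (auto simp: lookup_part in_keys_iff)
  qed
qed

lemma subspace_hom: "mpoly.subspace (hom k)"
proof (rule mpoly.subspaceI)
  fix x y :: "('v, 'k) mpoly" assume "x \<in> hom k" "y \<in> hom k"
  then show "x + y \<in> hom k" using keys_add[of x y] by (auto simp: hom_def)
next
  fix c and x :: "('v, 'k) mpoly" assume x: "x \<in> hom k"
  have "Poly_Mapping.keys (const c * x) \<subseteq> Poly_Mapping.keys x"
    by (auto elim!: keys_multE split: if_splits)
  then show "const c * x \<in> hom k" using x by (auto simp: hom_def)
qed (auto simp: hom_def)

lemma subspace_idl: "idl L \<Longrightarrow> mpoly.subspace L"
  by (rule mpoly.subspaceI) (auto simp: idl_0 idl_add idl_mult const_in)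

lemma hom_span: "hom k \<subseteq> mpoly.span ((\<lambda>a. Poly_Mapping.single a 1) ` mons k)"
proof
  fix p :: "('v, 'k) mpoly" assume p: "p \<in> hom k"
  have "(\<Sum>a\<in>Poly_Mapping.keys p. const (Poly_Mapping.lookup p a) * Poly_Mapping.single a 1) \<in>
    mpoly.span ((\<lambda>a. Poly_Mapping.single a 1) ` mons k)"
    using p by (intro mpoly.span_sum mpoly.span_scale mpoly.span_base) (auto simp: hom_def)
  then show "p \<in> mpoly.span ((\<lambda>a. Poly_Mapping.single a 1) ` mons k)"
    by (simp add: mult_single poly_mapping_sum_single)
qed

lemma graded_adjoin:
  assumes L: "idl L" "graded L" and x: "x \<in> hom 1"
  shows "graded (adjoin L x)"
  unfolding graded_def
proof (intro ballI allI)
  fix p k assume "p \<in> adjoin L x"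
  then obtain l f where lf: "l \<in> L" "f \<in> poly_in V" "p = l + x * f" by (metis adjoinE)
  have l: "part (\<lambda>a. mdeg a = k) l \<in> L" using L lf by (auto simp: graded_def)
  show "part (\<lambda>a. mdeg a = k) p \<in> adjoin L x"
  proof (cases k)
    case 0
    then show ?thesis using l lf part_linear_mult(2)[OF x lf(2)] by (simp add: part_add adjoin_base)
  next
    case (Suc j)
    then have "part (\<lambda>a. mdeg a = k) p = part (\<lambda>a. mdeg a = k) l + x * part (\<lambda>a. mdeg a = j) f"
      using part_linear_mult(1)[OF x lf(2)] lf by (simp add: part_add)
    then show ?thesis using l lf by (simp add: adjoinI part_in)
  qed
qed

lemma adjoin_hom_0:
  assumes L: "idl L" "graded L" and x: "x \<in> hom 1"
  shows "adjoin L x \<inter> hom 0 = L \<inter> hom 0"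
proof (intro equalityI subsetI)
  fix p assume p: "p \<in> adjoin L x \<inter> hom 0"
  then obtain l f where lf: "l \<in> L" "f \<in> poly_in V" "p = l + x * f" by (metis IntE adjoinE)
  have "p = part (\<lambda>a. mdeg a = 0) p" using p part_hom[of p 0 0] by simp
  also have "\<dots> = part (\<lambda>a. mdeg a = 0) l" using lf part_linear_mult(2)[OF x lf(2)] by (simp add: part_add)
  finally show "p \<in> L \<inter> hom 0" using p lf L(2) by (auto simp: graded_def)
qed (auto simp: adjoin_base)

lemma adjoin_hom_Suc:
  assumes L: "idl L" "graded L" and x: "x \<in> hom 1"
  shows "adjoin L x \<inter> hom (Suc k) = {u + x * y | u y. u \<in> L \<inter> hom (Suc k) \<and> y \<in> hom k}"
proof (intro equalityI subsetI)
  fix p assume p: "p \<in> adjoin L x \<inter> hom (Suc k)"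
  then obtain l f where lf: "l \<in> L" "f \<in> poly_in V" "p = l + x * f" by (metis IntE adjoinE)
  have "p = part (\<lambda>a. mdeg a = Suc k) p" using p part_hom[of p "Suc k" "Suc k"] by simp
  also have "\<dots> = part (\<lambda>a. mdeg a = Suc k) l + x * part (\<lambda>a. mdeg a = k) f"
    using lf part_linear_mult(1)[OF x lf(2)] by (simp add: part_add)
  finally have "p = part (\<lambda>a. mdeg a = Suc k) l + x * part (\<lambda>a. mdeg a = k) f" .
  moreover have "part (\<lambda>a. mdeg a = Suc k) l \<in> L \<inter> hom (Suc k)" "part (\<lambda>a. mdeg a = k) f \<in> hom k"
    using lf L(2) idl_sub[OF L(1) lf(1)] hom_part by (auto simp: graded_def)
  ultimately show "p \<in> {u + x * y | u y. u \<in> L \<inter> hom (Suc k) \<and> y \<in> hom k}" by blast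
next
  fix p assume "p \<in> {u + x * y | u y. u \<in> L \<inter> hom (Suc k) \<and> y \<in> hom k}"
  then obtain u y where uy: "u \<in> L" "u \<in> hom (Suc k)" "y \<in> hom k" "p = u + x * y" by blast
  then have "x * y \<in> hom (Suc k)" using hom_mult[OF x, of y k] by simp
  then have "p \<in> hom (Suc k)" using uy mpoly.subspace_add[OF subspace_hom] by blast
  then show "p \<in> adjoin L x \<inter> hom (Suc k)" using uy hom_sub by (auto intro: adjoinI)
qed

text \<open>Multiplication by the regular form \<open>x\<close> makes 0 -> (R/L)(-1) -> R/L -> R/(L
  + x) -> 0 exact; \<open>dim_shift\<close> counts dimensions in each degree.\<close>

lemma hilb_adjoin:
  assumes L: "idl L" "graded L" and x: "x \<in> hom 1" and reg: "reg L x"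
  shows "hilb (adjoin L x) (Suc k) = hilb L (Suc k) - hilb L k"
    and "hilb (adjoin L x) 0 = hilb L 0"
proof -
  have fin: "finite ((\<lambda>a. Poly_Mapping.single a (1 :: 'k)) ` mons k)" for k by (simp add: finite_mons)
  have "mpoly.dim (adjoin L x \<inter> hom (Suc k)) + mpoly.dim (L \<inter> hom k) =
    mpoly.dim (L \<inter> hom (Suc k)) + mpoly.dim (hom k)"
  proof (rule mpoly.dim_shift[of "\<lambda>y. x * y", OF _ _ _ adjoin_hom_Suc[OF L x] _ subspace_hom
        fin[of "Suc k"] _ fin[of k] hom_span])
    show "Vector_Spaces.linear (\<lambda>c p. const c * p) (\<lambda>c p. const c * p) ((*) x)"
      unfolding Vector_Spaces.linear_iff by (simp add: mpoly.vector_space_axioms distrib_left mult.left_commute)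
    show "L \<inter> hom k = {y \<in> hom k. x * y \<in> L \<inter> hom (Suc k)}"
      using hom_mult[OF x, of _ k] hom_sub x reg L(1) by (auto intro: idl_mult regD)
    show "adjoin L x \<inter> hom (Suc k) \<subseteq> mpoly.span ((\<lambda>a. Poly_Mapping.single a 1) ` mons (Suc k))"
      using hom_span by blast
  qed (intro mpoly.subspace_inter subspace_hom subspace_idl[OF L(1)])+
  then show "hilb (adjoin L x) (Suc k) = hilb L (Suc k) - hilb L k" by (simp add: hilb_def)
  show "hilb (adjoin L x) 0 = hilb L 0" by (simp add: hilb_def adjoin_hom_0[OF L x])
qed

definition hilb_series :: "('v, 'k) mpoly set \<Rightarrow> real fps" where
  "hilb_series L = Abs_fps (\<lambda>k. real_of_int (hilb L k))"

lemma hilb_series_adjoins: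
  assumes "idl L" "graded L" "set xs \<subseteq> hom 1" "reg_seq L xs"
  shows "hilb_series (adjoins L xs) = hilb_series L * (1 - fps_X) ^ length xs"
  using assms
proof (induction xs arbitrary: L)
  case (Cons x xs)
  have x: "x \<in> hom 1" "reg L x" using Cons.prems by auto
  have "hilb_series (adjoin L x) = hilb_series L * (1 - fps_X)"
  proof (rule fps_ext)
    fix k
    show "fps_nth (hilb_series (adjoin L x)) k = fps_nth (hilb_series L * (1 - fps_X)) k"
      using hilb_adjoin[OF Cons.prems(1,2) x]
      by (cases k) (simp_all add: hilb_series_def right_diff_distrib)
  qed
  moreover have "hilb_series (adjoins (adjoin L x) xs) = hilb_series (adjoin L x) * (1 - fps_X) ^ length xs"
    using Cons.prems hom_sub[OF x(1)] by (intro Cons.IH) (auto simp: idl_adjoin graded_adjoin)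
  ultimately show ?case by (simp add: mult.assoc)
qed simp

lemma hom_mono_dim:
  assumes "A \<subseteq> B" "idl A" "idl B"
  shows "hilb B k \<le> hilb A k" and "hilb B k = hilb A k \<Longrightarrow> A \<inter> hom k = B \<inter> hom k"
proof -
  have fin: "finite ((\<lambda>a. Poly_Mapping.single a (1 :: 'k)) ` mons k)" by (simp add: finite_mons)
  have *: "A \<inter> hom k \<subseteq> B \<inter> hom k" "B \<inter> hom k \<subseteq> mpoly.span ((\<lambda>a. Poly_Mapping.single a 1) ` mons k)"
    using assms hom_span by blast+
  show "hilb B k \<le> hilb A k" using mpoly.span_finite_dim_mono(1)[OF *(1) fin *(2)] by (simp add: hilb_def)
  show "A \<inter> hom k = B \<inter> hom k" if "hilb B k = hilb A k"
    using mpoly.span_finite_dim_mono(2)[OF *(1) fin *(2)] that assms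
    by (simp add: hilb_def mpoly.subspace_inter subspace_hom subspace_idl)
qed

lemma graded_sri: "graded (sri E)"
  by (auto simp: graded_def sri_def part_in keys_part)

lemma dim_sri_hom: "mpoly.dim (sri E \<inter> hom k) = card {a \<in> mons k. Poly_Mapping.keys a \<notin> E}"
proof -
  let ?A = "{a \<in> mons k. Poly_Mapping.keys a \<notin> E}"
  let ?m = "\<lambda>a. Poly_Mapping.single a (1 :: 'k)"
  have inj: "inj_on ?m ?A" by (rule inj_onI) (metis keys_single one_neq_zero singleton_inject)
  have fin: "finite ?A" using finite_mons by simp
  have "mpoly.independent (?m ` ?A)"
  proof (rule mpoly.independent_if_scalars_zero)
    show "finite (?m ` ?A)" using fin by simp
    fix f and x :: "('v, 'k) mpoly"
    assume 0: "(\<Sum>x\<in>?m ` ?A. const (f x) * x) = 0" and "x \<in> ?m ` ?A"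
    then obtain a where a: "a \<in> ?A" "x = ?m a" by blast
    have "0 = Poly_Mapping.lookup (\<Sum>x\<in>?m ` ?A. const (f x) * x) a" by (simp add: 0)
    also have "\<dots> = (\<Sum>b\<in>?A. if b = a then f (?m b) else 0)"
      by (simp add: sum.reindex[OF inj] lookup_sum mult_single lookup_single when_def)
    also have "\<dots> = f x" using a fin by simp
    finally show "f x = 0" by simp
  qed
  moreover have "?m ` ?A \<subseteq> sri E \<inter> hom k"
    by (auto simp: sri_def hom_def mons_def single_in)
  moreover have "sri E \<inter> hom k \<subseteq> mpoly.span (?m ` ?A)"
  proof
    fix p assume p: "p \<in> sri E \<inter> hom k"
    have "(\<Sum>a\<in>Poly_Mapping.keys p. const (Poly_Mapping.lookup p a) * ?m a) \<in> mpoly.span (?m ` ?A)"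
      using p by (intro mpoly.span_sum mpoly.span_scale mpoly.span_base) (auto simp: hom_def sri_def)
    then show "p \<in> mpoly.span (?m ` ?A)" by (simp add: mult_single poly_mapping_sum_single)
  qed
  ultimately have "mpoly.dim (sri E \<inter> hom k) = card (?m ` ?A)"
    using mpoly.basis_card_eq_dim[of "?m ` ?A" "sri E \<inter> hom k"] by simp
  then show ?thesis using card_image[OF inj] by simp
qed

lemma hilb_diff_sri:
  "hilb (sri A) k - hilb (sri B) k =
    int (card {a \<in> mons k. Poly_Mapping.keys a \<notin> B}) - int (card {a \<in> mons k. Poly_Mapping.keys a \<notin> A})"
  by (simp add: hilb_def dim_sri_hom)

lemma lin_form_hom: "lin_form vs a \<in> hom 1"
  unfolding lin_form_def
proof (intro mpoly.subspace_sum[OF subspace_hom] mpoly.subspace_scale[OF subspace_hom])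
  fix i assume "i \<in> {..<length vs}"
  then have "vs ! i \<in> V" using vs(1) by auto
  then show "variable (vs ! i) \<in> hom 1" by (simp add: hom_def mons_def variable_def mdeg_single)
qed

end

section \<open>Generating functions\<close>

text \<open>The power series \<open>(1 - X) powr - a\<close>.\<close>

definition neg_binomial :: "real \<Rightarrow> real fps" where
  "neg_binomial a = Abs_fps (\<lambda>k. (a + real k - 1) gchoose k)"

lemma neg_binomial_nth: "fps_nth (neg_binomial a) k = (- 1) ^ k * ((- a) gchoose k)"
  by (simp add: neg_binomial_def gbinomial_minus)

lemma neg_binomial_mult: "neg_binomial a * neg_binomial b = neg_binomial (a + b)"
proof (rule fps_ext)
  fix n
  have "fps_nth (neg_binomial a * neg_binomial b) n =
    (\<Sum>i=0..n. (- 1) ^ n * (((- a) gchoose i) * ((- b) gchoose (n - i))))"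
    unfolding fps_mult_nth
  proof (intro sum.cong refl)
    fix i assume "i \<in> {0..n}"
    then have "(- 1 :: real) ^ n = (- 1) ^ i * (- 1) ^ (n - i)" by (simp flip: power_add)
    then show "fps_nth (neg_binomial a) i * fps_nth (neg_binomial b) (n - i) =
      (- 1) ^ n * (((- a) gchoose i) * ((- b) gchoose (n - i)))"
      by (simp add: neg_binomial_nth mult_ac)
  qed
  also have "\<dots> = (- 1) ^ n * (- a + - b gchoose n)"
    using gbinomial_Vandermonde[of "- a" "- b" n] by (simp add: atMost_atLeast0 flip: sum_distrib_left)
  also have "\<dots> = fps_nth (neg_binomial (a + b)) n" by (simp add: neg_binomial_nth)
  finally show "fps_nth (neg_binomial a * neg_binomial b) n = fps_nth (neg_binomial (a + b)) n" .
qed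

lemma neg_binomial_0: "neg_binomial 0 = 1"
  by (rule fps_ext) (simp add: neg_binomial_nth gbinomial_0_left)

lemma neg_binomial_minus_1: "neg_binomial (- 1) = 1 - fps_X"
proof (rule fps_ext)
  fix k
  have "(1 :: real) gchoose k = real (1 choose k)" by (metis binomial_gbinomial of_nat_1)
  then show "fps_nth (neg_binomial (- 1)) k = fps_nth (1 - fps_X) k"
    by (cases "k < 2") (auto simp: neg_binomial_nth less_2_cases_iff binomial_eq_0 fps_X_def)
qed

lemma neg_binomial_minus: "neg_binomial (- real n) = (1 - fps_X) ^ n"
proof (induction n)
  case (Suc n)
  have "neg_binomial (- real (Suc n)) = neg_binomial (- 1) * neg_binomial (- real n)"
    by (simp add: neg_binomial_mult)
  then show ?case using Suc by (simp add: neg_binomial_minus_1)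
qed (simp add: neg_binomial_0)

text \<open>The series \<open>X / (1 - X)\<close>: one vertex with an arbitrary positive exponent.
  Its power with exponent \<open>card \<sigma>\<close> counts the monomials with support exactly
  \<open>\<sigma>\<close>.\<close>

definition face_series :: "real fps" where
  "face_series = fps_X * neg_binomial 1"

lemma face_series_mult: "face_series * (1 - fps_X) = fps_X"
proof -
  have "neg_binomial 1 * (1 - fps_X) = 1"
    using neg_binomial_mult[of 1 "- 1"] by (simp add: neg_binomial_0 neg_binomial_minus_1)
  then show ?thesis by (simp add: face_series_def mult.assoc)
qed

lemma one_plus_face_series: "1 + face_series = neg_binomial 1"
proof -
  have "neg_binomial 1 * (1 - fps_X) = 1"
    using neg_binomial_mult[of 1 "- 1"] by (simp add: neg_binomial_0 neg_binomial_minus_1)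
  then show ?thesis by (simp add: face_series_def algebra_simps)
qed

lemma sum_Pow_face_series:
  "finite W \<Longrightarrow> (\<Sum>\<sigma>\<in>Pow W. face_series ^ card \<sigma>) = neg_binomial (real (card W))"
proof (induction W rule: finite_induct)
  case empty
  then show ?case by (simp add: neg_binomial_0)
next
  case (insert x W)
  have inj: "inj_on (insert x) (Pow W)" using insert.hyps by (auto simp: inj_on_def)
  have "(\<Sum>\<sigma>\<in>Pow (insert x W). face_series ^ card \<sigma>) =
    (\<Sum>\<sigma>\<in>Pow W. face_series ^ card \<sigma>) + (\<Sum>\<sigma>\<in>insert x ` Pow W. face_series ^ card \<sigma>)"
    unfolding Pow_insert using insert.hyps by (intro sum.union_disjoint) auto
  also have "(\<Sum>\<sigma>\<in>insert x ` Pow W. face_series ^ card \<sigma>) = (\<Sum>\<sigma>\<in>Pow W. face_series * face_series ^ card \<sigma>)"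
    unfolding sum.reindex[OF inj] o_def
  proof (intro sum.cong refl)
    fix \<sigma> assume "\<sigma> \<in> Pow W"
    then have "finite \<sigma>" "x \<notin> \<sigma>" using insert.hyps by (auto intro: finite_subset)
    then show "face_series ^ card (insert x \<sigma>) = face_series * face_series ^ card \<sigma>" by simp
  qed
  also have "(\<Sum>\<sigma>\<in>Pow W. face_series ^ card \<sigma>) + \<dots> = (1 + face_series) * neg_binomial (real (card W))"
    using insert.IH by (simp add: sum_distrib_left[symmetric] distrib_right)
  also have "\<dots> = neg_binomial (real (card (insert x W)))"
    using insert.hyps by (simp add: one_plus_face_series neg_binomial_mult)
  finally show ?case .
qed

context sr_ring
begin

lemma support_series:
  assumes "\<sigma> \<subseteq> V"
  shows "Abs_fps (\<lambda>k. real (card {a \<in> mons k. Poly_Mapping.keys a = \<sigma>})) = face_series ^ card \<sigma>"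
proof -
  have "finite \<sigma>" using assms finite_V finite_subset by blast
  then show ?thesis using assms
  proof (induction \<sigma> rule: finite_induct)
    case empty
    have "{a \<in> mons k. Poly_Mapping.keys a = {}} = (if k = 0 then {0} else {})" for k
    proof -
      have "a = 0" if "Poly_Mapping.keys a = {}" for a :: "'v \<Rightarrow>\<^sub>0 nat"
        using that by (metis empty_iff in_keys_iff lookup_zero poly_mapping_eqI)
      then show ?thesis by (auto simp: mons_def mdeg_def)
    qed
    then have "card {a \<in> mons k. Poly_Mapping.keys a = {}} = (if k = 0 then 1 else 0)" for k by simp
    then show ?case by (intro fps_ext) simp
  next
    case (insert v \<sigma>)
    let ?N = "\<lambda>\<tau> k. {a \<in> mons k. Poly_Mapping.keys a = \<tau>}"
    define f where "f \<tau> = Abs_fps (\<lambda>k. real (card (?N \<tau> k)))" for \<tau>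
    have fin: "finite (?N \<tau> k)" for \<tau> k using finite_mons by simp
    have zero: "?N (insert v \<sigma>) 0 = {}"
    proof -
      have "a \<notin> ?N (insert v \<sigma>) 0" for a
        using card_keys_le_mdeg[of a] insert.hyps by (auto simp: mons_def)
      then show ?thesis by blast
    qed
    \<comment> \<open>Division by the variable \<open>v\<close>: its exponent either drops to 0,
      leaving support \<open>\<sigma>\<close>, or stays positive.\<close>
    have step: "card (?N (insert v \<sigma>) (Suc k)) = card (?N \<sigma> k) + card (?N (insert v \<sigma>) k)" for k
    proof -
      let ?g = "\<lambda>a. Poly_Mapping.single v 1 + a :: 'v \<Rightarrow>\<^sub>0 nat"
      have "?N (insert v \<sigma>) (Suc k) = ?g ` (?N \<sigma> k \<union> ?N (insert v \<sigma>) k)"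
      proof (intro equalityI subsetI)
        fix a assume a: "a \<in> ?N (insert v \<sigma>) (Suc k)"
        define b where "b = a - Poly_Mapping.single v 1"
        have "v \<in> Poly_Mapping.keys a" using a by simp
        then have ab: "a = ?g b" unfolding b_def
          by (intro poly_mapping_eqI) (auto simp: lookup_add lookup_minus lookup_single when_def in_keys_iff)
        have "mdeg b = k" using a by (simp add: ab mdeg_add mdeg_single mons_def)
        moreover have "insert v (Poly_Mapping.keys b) = insert v \<sigma>" "Poly_Mapping.keys b \<subseteq> V"
          using a by (auto simp: ab keys_plus_nat mons_def)
        then have "Poly_Mapping.keys b = \<sigma> \<or> Poly_Mapping.keys b = insert v \<sigma>"
          using insert.hyps(2) by (metis insert_absorb insert_ident)
        ultimately have "b \<in> ?N \<sigma> k \<union> ?N (insert v \<sigma>) k"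
          using \<open>Poly_Mapping.keys b \<subseteq> V\<close> by (auto simp: mons_def)
        then show "a \<in> ?g ` (?N \<sigma> k \<union> ?N (insert v \<sigma>) k)" using ab by blast
      next
        fix a assume "a \<in> ?g ` (?N \<sigma> k \<union> ?N (insert v \<sigma>) k)"
        then show "a \<in> ?N (insert v \<sigma>) (Suc k)" using insert.prems
          by (auto simp: mons_def mdeg_add mdeg_single keys_plus_nat)
      qed
      moreover have "inj_on ?g (?N \<sigma> k \<union> ?N (insert v \<sigma>) k)" by (rule inj_onI) simp
      ultimately have "card (?N (insert v \<sigma>) (Suc k)) = card (?N \<sigma> k \<union> ?N (insert v \<sigma>) k)"
        by (simp add: card_image)
      also have "\<dots> = card (?N \<sigma> k) + card (?N (insert v \<sigma>) k)"
        using insert.hyps fin by (intro card_Un_disjoint) auto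
      finally show ?thesis .
    qed
    have "f (insert v \<sigma>) * (1 - fps_X) = fps_X * f \<sigma>"
    proof (rule fps_ext)
      fix k
      show "fps_nth (f (insert v \<sigma>) * (1 - fps_X)) k = fps_nth (fps_X * f \<sigma>) k"
        using arg_cong[OF zero, of card] step
        by (cases k) (simp_all add: f_def right_diff_distrib del: Collect_empty_eq)
    qed
    then have "f (insert v \<sigma>) * (1 - fps_X) * neg_binomial 1 = face_series * f \<sigma>"
      by (simp add: face_series_def mult_ac)
    moreover have "(1 - fps_X) * neg_binomial 1 = 1"
      using neg_binomial_mult[of "- 1" 1] by (simp add: neg_binomial_0 neg_binomial_minus_1)
    ultimately have "f (insert v \<sigma>) = face_series * f \<sigma>" by (simp add: mult.assoc)
    then show ?case using insert by (simp add: f_def)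
  qed
qed

text \<open>As \<open>sri (Pow V)\<close> is zero, the left side is the Hilbert series of the ideal
  \<open>sri E\<close>, whose monomials are sorted by their supports.\<close>

lemma hilb_series_diff:
  assumes "E \<subseteq> Pow V"
  shows "hilb_series (sri (Pow V)) - hilb_series (sri E) = (\<Sum>\<sigma>\<in>Pow V - E. face_series ^ card \<sigma>)"
proof (rule fps_ext)
  fix k
  let ?N = "\<lambda>\<tau>. {a \<in> mons k. Poly_Mapping.keys a = \<tau>}"
  have e: "{a \<in> mons k. \<not> Poly_Mapping.keys a \<subseteq> V} = {}" by (auto simp: mons_def)
  have "fps_nth (hilb_series (sri (Pow V)) - hilb_series (sri E)) k =
    real (card {a \<in> mons k. Poly_Mapping.keys a \<notin> E})"
    using hilb_diff_sri[of "Pow V" k E] by (simp add: hilb_series_def e flip: of_int_diff)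
  also have "{a \<in> mons k. Poly_Mapping.keys a \<notin> E} = (\<Union>\<sigma>\<in>Pow V - E. ?N \<sigma>)"
    by (auto simp: mons_def)
  also have "real (card (\<Union>\<sigma>\<in>Pow V - E. ?N \<sigma>)) = (\<Sum>\<sigma>\<in>Pow V - E. real (card (?N \<sigma>)))"
    using finite_V finite_mons by (subst card_UN_disjoint) auto
  also have "\<dots> = (\<Sum>\<sigma>\<in>Pow V - E. fps_nth (face_series ^ card \<sigma>) k)"
  proof (intro sum.cong refl)
    fix \<sigma> assume "\<sigma> \<in> Pow V - E"
    then show "real (card (?N \<sigma>)) = fps_nth (face_series ^ card \<sigma>) k"
      by (subst support_series[symmetric]) auto
  qed
  finally show "fps_nth (hilb_series (sri (Pow V)) - hilb_series (sri E)) k =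
    fps_nth (\<Sum>\<sigma>\<in>Pow V - E. face_series ^ card \<sigma>) k"
    by (simp add: fps_sum_nth)
qed

end

section \<open>The h-polynomial as a power series\<close>

definition real_series :: "int poly \<Rightarrow> real fps" where
  "real_series p = Abs_fps (\<lambda>k. real_of_int (coeff p k))"

lemma real_series_mult: "real_series (p * q) = real_series p * real_series q"
  by (rule fps_ext) (simp add: real_series_def coeff_mult fps_mult_nth atMost_atLeast0)

lemma real_series_1: "real_series 1 = 1"
  by (rule fps_ext) (simp add: real_series_def coeff_1)

lemma real_series_power: "real_series (p ^ n) = real_series p ^ n"
  by (induction n) (simp_all add: real_series_1 real_series_mult)

lemma real_series_sum: "real_series (sum p A) = (\<Sum>i\<in>A. real_series (p i))"
  by (rule fps_ext) (simp add: real_series_def coeff_sum fps_sum_nth)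

lemma real_series_smult: "real_series (smult c p) = fps_const (real_of_int c) * real_series p"
  by (rule fps_ext) (simp add: real_series_def)

lemma real_series_X: "real_series [:0, 1:] = fps_X"
  by (rule fps_ext) (simp add: real_series_def fps_X_def coeff_pCons split: nat.split)

lemma real_series_1_minus_X: "real_series [:1, - 1:] = 1 - fps_X"
  by (rule fps_ext) (simp add: real_series_def fps_X_def coeff_pCons split: nat.split)

text \<open>\<open>X ^ k * (1 - X) ^ (d - k)\<close> equals
  \<open>(1 - X) ^ d * face_series ^ k\<close>, so the sum over sizes becomes a sum over faces;
  \<open>le\<close> ensures that the sizes 0 to \<open>d\<close> exhaust them.\<close>

lemma real_series_rel_h_poly:
  assumes fin: "finite \<Delta>" and d: "rel_dim \<Delta> \<Gamma> = int d - 1"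
    and le: "\<And>\<sigma>. \<sigma> \<in> \<Delta> - \<Gamma> \<Longrightarrow> card \<sigma> \<le> d"
  shows "real_series (rel_h_poly \<Delta> \<Gamma>) = (1 - fps_X) ^ d * (\<Sum>\<sigma>\<in>\<Delta> - \<Gamma>. face_series ^ card \<sigma>)"
proof -
  let ?F = "\<lambda>k. {\<sigma> \<in> \<Delta> - \<Gamma>. card \<sigma> = k}"
  have "rel_h_poly \<Delta> \<Gamma> = (\<Sum>k = 0..d. smult (int (card (?F k))) ([:0, 1:] ^ k * [:1, - 1:] ^ (d - k)))"
    by (simp add: rel_h_poly_def Let_def d rel_face_number_def face_dim_def)
  then have "real_series (rel_h_poly \<Delta> \<Gamma>) =
    (\<Sum>k = 0..d. fps_const (real (card (?F k))) * (fps_X ^ k * (1 - fps_X) ^ (d - k)))"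
    by (simp add: real_series_sum real_series_smult real_series_mult real_series_power
        real_series_X real_series_1_minus_X)
  also have "\<dots> = (\<Sum>k = 0..d. (1 - fps_X) ^ d * (\<Sum>\<sigma>\<in>?F k. face_series ^ card \<sigma>))"
  proof (intro sum.cong refl)
    fix k assume k: "k \<in> {0..d}"
    have "(1 - fps_X :: real fps) ^ d = (1 - fps_X) ^ k * (1 - fps_X) ^ (d - k)"
      using k by (simp flip: power_add)
    moreover have "(face_series * (1 - fps_X)) ^ k = fps_X ^ k" by (simp add: face_series_mult)
    ultimately have "fps_X ^ k * (1 - fps_X) ^ (d - k) = (1 - fps_X) ^ d * face_series ^ k"
      by (simp add: power_mult_distrib mult_ac)
    moreover have "(\<Sum>\<sigma>\<in>?F k. face_series ^ card \<sigma>) = fps_const (real (card (?F k))) * face_series ^ k"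
      by (simp add: fps_of_nat)
    ultimately show "fps_const (real (card (?F k))) * (fps_X ^ k * (1 - fps_X) ^ (d - k)) =
      (1 - fps_X) ^ d * (\<Sum>\<sigma>\<in>?F k. face_series ^ card \<sigma>)" by (simp only: mult_ac)
  qed
  also have "\<dots> = (1 - fps_X) ^ d * (\<Sum>k = 0..d. \<Sum>\<sigma>\<in>?F k. face_series ^ card \<sigma>)"
    by (simp add: sum_distrib_left)
  also have "(\<Sum>k = 0..d. \<Sum>\<sigma>\<in>?F k. face_series ^ card \<sigma>) = (\<Sum>\<sigma>\<in>\<Delta> - \<Gamma>. face_series ^ card \<sigma>)"
    using fin le by (intro sum.group) auto
  finally show ?thesis .
qed

section \<open>Difference between bound and h-number as a dimension\<close>

lemma (in comm_subring) adjoins_decompose: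
  assumes "idl L" "set xs \<subseteq> S" "p \<in> adjoins L xs"
  shows "\<exists>l\<in>L. \<exists>y\<in>adjoins {0} xs. p = l + y"
  using assms
proof (induction xs arbitrary: L)
  case (Cons x xs)
  have "idl {0}" by (rule idlI) auto
  then have id: "idl (adjoin {0} x)" "idl (adjoins (adjoin {0} x) xs)" "idl (adjoin L x)"
    using Cons.prems by (auto simp: idl_adjoins idl_adjoin)
  obtain l' y' where ly: "l' \<in> adjoin L x" "y' \<in> adjoins {0} xs" "p = l' + y'"
    using Cons.IH[OF id(3)] Cons.prems by auto
  obtain l f where lf: "l \<in> L" "f \<in> S" "l' = l + x * f" using ly(1) by (metis adjoinE)
  have "x * f \<in> adjoins (adjoin {0} x) xs"
    using adjoinI[of 0 "{0}" f x] lf(2) by (intro adjoins_base) simp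
  moreover have "y' \<in> adjoins (adjoin {0} x) xs"
    using ly(2) adjoins_mono[of "{0}" "adjoin {0} x" xs] adjoin_base[of 0 "{0}"] by auto
  ultimately have "x * f + y' \<in> adjoins (adjoin {0} x) xs" using idl_add[OF id(2)] by blast
  moreover have "p = l + (x * f + y')" using ly(3) lf(3) by (simp add: add.assoc)
  ultimately show ?case using lf(1) by auto
qed auto

lemma face_series_coeff:
  "k < c \<Longrightarrow> fps_nth (face_series ^ c * (1 - fps_X) ^ d) k = 0"
  "k = c \<Longrightarrow> fps_nth (face_series ^ c * (1 - fps_X) ^ d) k = 1"
proof -
  have e: "face_series ^ c * (1 - fps_X) ^ d = fps_X ^ c * (neg_binomial 1 ^ c * (1 - fps_X) ^ d)"
    by (simp add: face_series_def power_mult_distrib mult_ac)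
  have "fps_nth (neg_binomial 1 ^ c * (1 - fps_X) ^ d) 0 = 1"
    by (simp add: neg_binomial_nth fps_nth_power_0)
  then show "k < c \<Longrightarrow> fps_nth (face_series ^ c * (1 - fps_X) ^ d) k = 0"
    "k = c \<Longrightarrow> fps_nth (face_series ^ c * (1 - fps_X) ^ d) k = 1"
    by (simp_all add: e fps_X_power_mult_nth)
qed

context sr_ring
begin

lemma graded_adjoins:
  "idl L \<Longrightarrow> graded L \<Longrightarrow> set xs \<subseteq> hom 1 \<Longrightarrow> graded (adjoins L xs)"
proof (induction xs arbitrary: L)
  case (Cons x xs)
  then show ?case using hom_sub[of x 1] by (auto simp: graded_adjoin idl_adjoin)
qed simp

text \<open>\<open>(1 - X) ^ d\<close> times the Hilbert series of the ideal \<open>sri E\<close>,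
  expressed by nonfaces alone.\<close>

definition deficiency :: "'v set set \<Rightarrow> nat \<Rightarrow> real fps" where
  "deficiency E d = (\<Sum>\<sigma>\<in>Pow V - E. face_series ^ card \<sigma>) * (1 - fps_X) ^ d"

context
  fixes E :: "'v set set" and d :: nat and xs :: "('v, 'k) mpoly list" and x :: "('v, 'k) mpoly"
  assumes E: "down_closed E" "E \<subseteq> Pow V"
    and hom: "set xs \<subseteq> hom 1" "x \<in> hom 1" "length xs = d"
    and regs: "reg_seq (sri E) xs" "reg_seq (sri (Pow V)) xs"
begin

text \<open>Each regular linear form multiplies a Hilbert series by \<open>1 - X\<close>, for
  \<open>sri E\<close> and for the zero ideal \<open>sri (Pow V)\<close> alike. What remains after
  \<open>d\<close> forms is the dimension of the image of \<open>sri E\<close> modulo the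
  forms.\<close>

lemma deficiency_eq_dim:
  "fps_nth (deficiency E d) k = of_int (hilb (adjoins (sri (Pow V)) xs) k - hilb (adjoins (sri E) xs) k)"
proof -
  have "deficiency E d = (hilb_series (sri (Pow V)) - hilb_series (sri E)) * (1 - fps_X) ^ d"
    using hilb_series_diff[OF E(2)] by (simp add: deficiency_def)
  also have "\<dots> = hilb_series (adjoins (sri (Pow V)) xs) - hilb_series (adjoins (sri E) xs)"
    using hilb_series_adjoins[of "sri (Pow V)" xs] hilb_series_adjoins[of "sri E" xs] E hom regs
    by (simp add: idl_sri down_closed_Pow graded_sri left_diff_distrib)
  finally show ?thesis by (simp add: hilb_series_def)
qed

lemma xs_sub: "set xs \<subseteq> poly_in V"
  using hom hom_sub by blast

lemma adjoins_ideals: "idl (adjoins (sri (Pow V)) xs)" "idl (adjoins (sri E) xs)"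
  using E xs_sub by (simp_all add: idl_adjoins idl_sri down_closed_Pow)

lemma adjoins_sub: "adjoins (sri (Pow V)) xs \<subseteq> adjoins (sri E) xs"
  by (intro adjoins_mono sri_antimono E)

lemma deficiency_nonneg: "0 \<le> fps_nth (deficiency E d) k"
  using hom_mono_dim(1)[OF adjoins_sub adjoins_ideals, of k] by (simp add: deficiency_eq_dim)

text \<open>Up to the smallest size of a nonface, the monomials of degree \<open>k\<close> with
  support outside \<open>E\<close> are squarefree, and \<open>(1 - X) ^ d\<close> enters only
  through its constant term 1.\<close>

lemma deficiency_nth_low:
  assumes "\<And>\<sigma>. \<sigma> \<in> Pow V - E \<Longrightarrow> k \<le> card \<sigma>"
  shows "fps_nth (deficiency E d) k = real (card {\<sigma> \<in> Pow V - E. card \<sigma> = k})"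
proof -
  have "fps_nth (deficiency E d) k =
    (\<Sum>\<sigma>\<in>Pow V - E. fps_nth (face_series ^ card \<sigma> * (1 - fps_X) ^ d) k)"
    by (simp add: deficiency_def sum_distrib_right fps_sum_nth)
  also have "\<dots> = (\<Sum>\<sigma>\<in>Pow V - E. if card \<sigma> = k then 1 else 0)"
  proof (intro sum.cong refl)
    fix \<sigma> assume "\<sigma> \<in> Pow V - E"
    then have "k < card \<sigma> \<or> k = card \<sigma>" using assms le_less by blast
    then show "fps_nth (face_series ^ card \<sigma> * (1 - fps_X) ^ d) k = (if card \<sigma> = k then 1 else 0)"
      using face_series_coeff[of k "card \<sigma>" d] by auto
  qed
  also have "\<dots> = real (card {\<sigma> \<in> Pow V - E. card \<sigma> = k})"
    using finite_V by (simp add: sum.If_cases Int_def)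
  finally show ?thesis .
qed

text \<open>If a nonface of minimal size \<open>j \<le> k\<close> exists, then some \<open>p\<close> of degree \<open>j\<close> in the ideal of \<open>E\<close>
  is not in the ideal of the linear forms \<open>xs\<close>; multiplying with powers of the next regular linear
  form \<open>x\<close> produces such an element in degree \<open>k\<close>.\<close>

lemma deficiency_eq_0_iff:
  assumes x: "E \<noteq> Pow V \<Longrightarrow> reg (adjoins (sri (Pow V)) xs) x"
  shows "fps_nth (deficiency E d) k = 0 \<longleftrightarrow> (\<forall>\<sigma>\<in>Pow V - E. k < card \<sigma>)"
proof
  assume *: "\<forall>\<sigma>\<in>Pow V - E. k < card \<sigma>"
  then have "card {\<sigma> \<in> Pow V - E. card \<sigma> = k} = 0" by (intro card_eq_0_iff[THEN iffD2]) auto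
  moreover have "fps_nth (deficiency E d) k = real (card {\<sigma> \<in> Pow V - E. card \<sigma> = k})"
    by (rule deficiency_nth_low) (use * in \<open>blast intro: less_imp_le\<close>)
  ultimately show "fps_nth (deficiency E d) k = 0" by (simp only: of_nat_0)
next
  assume 0: "fps_nth (deficiency E d) k = 0"
  let ?A = "adjoins (sri (Pow V)) xs" and ?B = "adjoins (sri E) xs"
  have A: "idl ?A" "graded ?A"
    using adjoins_ideals graded_adjoins[of "sri (Pow V)" xs] hom
    by (auto simp: idl_sri down_closed_Pow graded_sri)
  show "\<forall>\<sigma>\<in>Pow V - E. k < card \<sigma>"
  proof (rule ccontr)
    assume "\<not> (\<forall>\<sigma>\<in>Pow V - E. k < card \<sigma>)"
    then obtain \<sigma>\<^sub>0 where s0: "\<sigma>\<^sub>0 \<in> Pow V - E" "card \<sigma>\<^sub>0 \<le> k" by (meson not_le)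
    define j where "j = Min (card ` (Pow V - E))"
    have fin: "finite (card ` (Pow V - E))" using finite_V by simp
    have j: "j \<in> card ` (Pow V - E)" "\<And>\<sigma>. \<sigma> \<in> Pow V - E \<Longrightarrow> j \<le> card \<sigma>"
      using Min_in[OF fin] Min_le[OF fin] s0(1) unfolding j_def by blast+
    have jk: "j \<le> k" using j(2)[OF s0(1)] s0(2) by simp
    have "{\<sigma> \<in> Pow V - E. card \<sigma> = j} \<noteq> {}" using j(1) by auto
    then have "fps_nth (deficiency E d) j > 0"
      using deficiency_nth_low[of j] j(2) finite_V by (simp add: card_gt_0_iff)
    then have ne: "?A \<inter> hom j \<noteq> ?B \<inter> hom j" by (auto simp: deficiency_eq_dim hilb_def)
    \<comment> \<open>\<open>?A\<close> is the ideal of the forms, and \<open>?B\<close> is its sum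
      with \<open>sri E\<close>; taking parts of degree \<open>j\<close> shows that a difference in
      this degree is already visible on \<open>sri E\<close>.\<close>
    have "\<exists>p \<in> sri E \<inter> hom j. p \<notin> ?A"
    proof (rule ccontr)
      assume "\<not> ?thesis"
      then have EA: "sri E \<inter> hom j \<subseteq> ?A" by blast
      have "b \<in> ?A" if b: "b \<in> ?B" "b \<in> hom j" for b
      proof -
        obtain e y where ey: "e \<in> sri E" "y \<in> adjoins {0} xs" "b = e + y"
          using adjoins_decompose[OF idl_sri[OF E(1)] xs_sub b(1)] by blast
        have y: "y \<in> ?A" using ey(2) by (simp add: sri_Pow_V)
        have "b = part (\<lambda>a. mdeg a = j) b" using part_hom[OF b(2), of j] by simp
        also have "\<dots> = part (\<lambda>a. mdeg a = j) e + part (\<lambda>a. mdeg a = j) y" by (simp add: ey(3) part_add)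
        finally have "b = part (\<lambda>a. mdeg a = j) e + part (\<lambda>a. mdeg a = j) y" .
        moreover have "part (\<lambda>a. mdeg a = j) e \<in> sri E \<inter> hom j"
          using ey(1) graded_sri[of E] hom_part by (auto simp: graded_def sri_def)
        moreover have "part (\<lambda>a. mdeg a = j) y \<in> ?A" using A(2) y by (auto simp: graded_def)
        ultimately show ?thesis using EA idl_add[OF A(1)] by auto
      qed
      then show False using ne adjoins_sub by blast
    qed
    then obtain p where p: "p \<in> sri E" "p \<in> hom j" "p \<notin> ?A" by blast
    have xS: "x \<in> poly_in V" using hom hom_sub by blast
    have "x ^ (k - j) * p \<in> ?B"
      using p(1) xS idl_mult[OF idl_sri[OF E(1)]] by (simp add: adjoins_base)
    moreover have "x ^ (k - j) * p \<in> hom k" using hom_mult[OF hom_power[OF hom(2)] p(2), of "k - j"] jk by simp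
    \<comment> \<open>A vanishing coefficient means equal dimensions in degree \<open>k\<close>, and
      nested subspaces of equal finite dimension coincide.\<close>
    moreover have "?A \<inter> hom k = ?B \<inter> hom k"
      using hom_mono_dim(2)[OF adjoins_sub adjoins_ideals, of k] 0 by (simp add: deficiency_eq_dim)
    ultimately have "x ^ (k - j) * p \<in> ?A" by blast
    moreover have "E \<noteq> Pow V" using s0 by auto
    ultimately show False using reg_power[OF x xS hom_sub[OF p(2)]] p(3) by blast
  qed
qed

end

end

section \<open>Face counts and the final assembly\<close>

lemma complex_dim_faces:
  assumes "abs_simplicial_complex \<Delta>" "complex_dim \<Delta> = e"
  shows "\<exists>F\<in>\<Delta>. int (card F) = e + 1" "\<And>\<sigma>. \<sigma> \<in> \<Delta> \<Longrightarrow> int (card \<sigma>) \<le> e + 1"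
proof -
  have "\<Delta> \<subseteq> Pow (vertices \<Delta>)" by (auto simp: vertices_def)
  then have fin: "finite (face_dim ` \<Delta>)" and ne: "face_dim ` \<Delta> \<noteq> {}"
    using assms(1) by (auto simp: abs_simplicial_complex_def intro: finite_subset)
  have e: "e = Max (face_dim ` \<Delta>)" using assms(2) by (simp add: complex_dim_def rel_dim_def)
  show "\<exists>F\<in>\<Delta>. int (card F) = e + 1" using Max_in[OF fin ne] by (auto simp: e face_dim_def)
  show "int (card \<sigma>) \<le> e + 1" if "\<sigma> \<in> \<Delta>" for \<sigma>
    using Max_ge[OF fin, of "face_dim \<sigma>"] that by (simp add: e face_dim_def)
qed

lemma face_number_0:
  assumes "abs_simplicial_complex \<Delta>"
  shows "face_number \<Delta> 0 = card (vertices \<Delta>)"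
proof -
  have "{\<sigma> \<in> \<Delta> - {}. face_dim \<sigma> = 0} = (\<lambda>v. {v}) ` vertices \<Delta>"
    using assms by (auto simp: face_dim_def card_1_singleton_iff vertices_def abs_simplicial_complex_def)
  then show ?thesis by (simp add: face_number_def rel_face_number_def card_image)
qed

text \<open>The empty face is the only one shared by different simplices; it is taken out of each
  and added back once. This is the origin of the term with factor \<open>m - 1\<close> in the
  bound.\<close>

lemma sum_union_Pow_face_series:
  assumes "finite I" "I \<noteq> {}" "\<And>i. i \<in> I \<Longrightarrow> finite (W i)"
    "\<And>i j. i \<in> I \<Longrightarrow> j \<in> I \<Longrightarrow> i \<noteq> j \<Longrightarrow> W i \<inter> W j = {}"
  shows "(\<Sum>\<sigma>\<in>(\<Union>i\<in>I. Pow (W i)). face_series ^ card \<sigma>) =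
    1 + (\<Sum>i\<in>I. neg_binomial (real (card (W i))) - 1)"
proof -
  let ?P = "\<lambda>i. Pow (W i) - {{}}"
  have e: "(\<Union>i\<in>I. Pow (W i)) = insert {} (\<Union>i\<in>I. ?P i)" using assms(2) by auto
  have "finite (\<Union>i\<in>I. ?P i)" "{} \<notin> (\<Union>i\<in>I. ?P i)" using assms(1,3) by auto
  from sum.insert[OF this, of "\<lambda>\<sigma>. face_series ^ card \<sigma>"]
  have "(\<Sum>\<sigma>\<in>(\<Union>i\<in>I. Pow (W i)). face_series ^ card \<sigma>) = 1 + (\<Sum>\<sigma>\<in>(\<Union>i\<in>I. ?P i). face_series ^ card \<sigma>)"
    unfolding e by (simp only: card.empty power_0)
  also have "(\<Sum>\<sigma>\<in>(\<Union>i\<in>I. ?P i). face_series ^ card \<sigma>) = (\<Sum>i\<in>I. \<Sum>\<sigma>\<in>?P i. face_series ^ card \<sigma>)"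
  proof (rule sum.UNION_disjoint)
    show "\<forall>i\<in>I. \<forall>j\<in>I. i \<noteq> j \<longrightarrow> ?P i \<inter> ?P j = {}" using assms(4) by blast
  qed (use assms in auto)
  also have "\<dots> = (\<Sum>i\<in>I. neg_binomial (real (card (W i))) - 1)"
  proof (intro sum.cong refl)
    fix i assume "i \<in> I"
    then have "finite (W i)" using assms(3) by blast
    then show "(\<Sum>\<sigma>\<in>?P i. face_series ^ card \<sigma>) = neg_binomial (real (card (W i))) - 1"
      using sum_Pow_face_series[of "W i"] sum.remove[of "Pow (W i)" "{}" "\<lambda>\<sigma>. face_series ^ card \<sigma>"]
      by (simp add: eq_diff_eq add.commute)
  qed
  finally show ?thesis .
qed

text \<open>By hypothesis \<open>G\<close>, the faces of the union split into those of
  \<open>\<Delta> - G\<close> and those of the simplices. Multiplication by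
  \<open>(1 - X) ^ d\<close>, which is \<open>neg_binomial (- real d)\<close>, shifts every argument
  by \<open>- real d\<close>; hence the \<open>- d\<close> in all binomials of the bound.\<close>

lemma (in sr_ring) deficiency_series:
  fixes \<Delta> :: "'v set set" and W :: "nat \<Rightarrow> 'v set"
  assumes fin: "finite \<Delta>" and d: "rel_dim \<Delta> G = int d - 1"
    and le: "\<And>\<sigma>. \<sigma> \<in> \<Delta> \<Longrightarrow> card \<sigma> \<le> d"
    and I: "finite I" "I \<noteq> {}" and W: "\<And>i. i \<in> I \<Longrightarrow> W i \<subseteq> V" and \<Delta>: "\<Delta> \<subseteq> Pow V"
    and disj: "\<And>i j. i \<in> I \<Longrightarrow> j \<in> I \<Longrightarrow> i \<noteq> j \<Longrightarrow> W i \<inter> W j = {}"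
    and G: "\<Delta> \<inter> (\<Union>i\<in>I. Pow (W i)) = G"
  shows "deficiency (\<Delta> \<union> (\<Union>i\<in>I. Pow (W i))) d =
    neg_binomial (real (card V) - real d) - (\<Sum>i\<in>I. neg_binomial (real (card (W i)) - real d))
    + of_nat (card I) * neg_binomial (- real d) - neg_binomial (- real d) - real_series (rel_h_poly \<Delta> G)"
proof -
  let ?U = "\<Union>i\<in>I. Pow (W i)" and ?s = "\<lambda>\<sigma>. face_series ^ card (\<sigma> :: 'v set)"
  have E: "\<Delta> \<union> ?U \<subseteq> Pow V" using W \<Delta> by auto
  have finW: "finite (W i)" if "i \<in> I" for i using finite_subset[OF W[OF that] finite_V] .
  have finU: "finite ?U" using I finW by auto
  have "sum ?s (\<Delta> \<union> ?U) = sum ?s ((\<Delta> - G) \<union> ?U)" using G by (intro arg_cong[of _ _ "sum ?s"]) blast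
  also have "\<dots> = sum ?s (\<Delta> - G) + sum ?s ?U"
    using fin finU G by (intro sum.union_disjoint) auto
  also have "sum ?s ?U = 1 + (\<Sum>i\<in>I. neg_binomial (real (card (W i))) - 1)"
    using I finW disj by (intro sum_union_Pow_face_series) auto
  finally have s: "sum ?s (Pow V - (\<Delta> \<union> ?U)) = neg_binomial (real (card V)) -
      (sum ?s (\<Delta> - G) + (1 + (\<Sum>i\<in>I. neg_binomial (real (card (W i))) - 1)))"
    using sum_diff[of "Pow V" "\<Delta> \<union> ?U" ?s] finite_V E sum_Pow_face_series[OF finite_V] by simp
  have h: "real_series (rel_h_poly \<Delta> G) = neg_binomial (- real d) * sum ?s (\<Delta> - G)"
    using real_series_rel_h_poly[OF fin d] le by (simp add: neg_binomial_minus)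
  have nb: "neg_binomial (- real d) * neg_binomial b = neg_binomial (b - real d)" for b
    by (simp add: neg_binomial_mult)
  have "deficiency (\<Delta> \<union> ?U) d = neg_binomial (- real d) * (neg_binomial (real (card V)) -
      (sum ?s (\<Delta> - G) + (1 + (\<Sum>i\<in>I. neg_binomial (real (card (W i))) - 1))))"
    unfolding deficiency_def s by (simp add: neg_binomial_minus mult.commute)
  also have "\<dots> = neg_binomial (real (card V) - real d) - real_series (rel_h_poly \<Delta> G)
     - neg_binomial (- real d) - (\<Sum>i\<in>I. neg_binomial (real (card (W i)) - real d) - neg_binomial (- real d))"
    by (simp add: right_diff_distrib distrib_left nb h sum_distrib_left diff_diff_eq)
  finally show ?thesis by (simp add: sum_subtractf)
qed

theorem theorem4p14:
  fixes \<Delta> :: "'v set set" and \<Gamma> :: "nat \<Rightarrow> 'v set set" and d m k :: nat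
  assumes "infinite (UNIV :: 'k::field set)"
    and "m \<ge> 1"
    and "abs_simplicial_complex \<Delta>"
    and "complex_dim \<Delta> = int d - 1"
    and "cohen_macaulay TYPE('k) \<Delta>"
    and "\<And>i. i \<in> {1..m} \<Longrightarrow> full_subcomplex (\<Gamma> i) \<Delta>"
    and "\<And>i. i \<in> {1..m} \<Longrightarrow> complex_dim (\<Gamma> i) = int d - 2"
    and "\<And>i. i \<in> {1..m} \<Longrightarrow> cohen_macaulay TYPE('k) (\<Gamma> i)"
    and "\<And>i j. i \<in> {1..m} \<Longrightarrow> j \<in> {1..m} \<Longrightarrow> i \<noteq> j \<Longrightarrow> \<Gamma> i \<inter> \<Gamma> j = {{}}"
    and "k \<le> d"
  shows "real_of_int (rel_h_number \<Delta> (\<Union>i\<in>{1..m}. \<Gamma> i) k) \<le>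
           ((real (face_number \<Delta> 0) - real d + real k - 1) gchoose k)
           - (\<Sum>i = 1..m. ((real (face_number (\<Gamma> i) 0) - real d + real k - 1) gchoose k))
           + (real m - 1) * ((- real d + real k - 1) gchoose k)
       \<and> (real_of_int (rel_h_number \<Delta> (\<Union>i\<in>{1..m}. \<Gamma> i) k) =
           ((real (face_number \<Delta> 0) - real d + real k - 1) gchoose k)
           - (\<Sum>i = 1..m. ((real (face_number (\<Gamma> i) 0) - real d + real k - 1) gchoose k))
           + (real m - 1) * ((- real d + real k - 1) gchoose k)
         \<longleftrightarrow>
         (\<forall>\<sigma>. \<sigma> \<subseteq> vertices \<Delta> \<and> \<sigma> \<notin> \<Delta> \<and> face_dim \<sigma> < int k \<longrightarrow>
              (\<exists>i\<in>{1..m}. \<sigma> \<subseteq> vertices (\<Gamma> i))))"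
proof -
  define I where "I = {1..m}"
  define V where "V = vertices \<Delta>"
  define W where "W i = vertices (\<Gamma> i)" for i
  define G where "G = (\<Union>i\<in>I. \<Gamma> i)"
  define U where "U = (\<Union>i\<in>I. Pow (W i))"
  have finV: "finite V" using assms(3) by (simp add: abs_simplicial_complex_def V_def)
  have down: "\<tau> \<in> \<Delta>" if "\<sigma> \<in> \<Delta>" "\<tau> \<subseteq> \<sigma>" for \<sigma> \<tau>
    using assms(3) that by (auto simp: abs_simplicial_complex_def)
  have \<Delta>V: "\<Delta> \<subseteq> Pow V" by (auto simp: V_def vertices_def)
  have fin\<Delta>: "finite \<Delta>" using \<Delta>V finV by (simp add: finite_subset)
  have \<Gamma>: "abs_simplicial_complex (\<Gamma> i)" "\<Gamma> i \<subseteq> \<Delta>" if "i \<in> I" for i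
    using assms(6) that by (auto simp: full_subcomplex_def I_def)
  have full: "\<Delta> \<inter> Pow (W i) = \<Gamma> i" if "i \<in> I" for i
  proof
    have *: "full_subcomplex (\<Gamma> i) \<Delta>" using assms(6) that unfolding I_def by blast
    show "\<Delta> \<inter> Pow (W i) \<subseteq> \<Gamma> i" using * unfolding full_subcomplex_def W_def by blast
    show "\<Gamma> i \<subseteq> \<Delta> \<inter> Pow (W i)"
      using * unfolding full_subcomplex_def W_def vertices_def by blast
  qed
  have WV: "W i \<subseteq> V" if "i \<in> I" for i using \<Gamma>(2)[OF that] by (auto simp: W_def V_def vertices_def)
  \<comment> \<open>Disjoint complexes still share the empty face; a common vertex would give a
    common singleton.\<close>
  have disj: "W i \<inter> W j = {}" if "i \<in> I" "j \<in> I" "i \<noteq> j" for i j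
  proof -
    have "{v} \<in> \<Gamma> i" if "v \<in> W i" "i \<in> I" for v i
      using \<Gamma>(1)[OF that(2)] that(1) by (auto simp: abs_simplicial_complex_def W_def vertices_def)
    then have "{v} \<in> \<Gamma> i \<inter> \<Gamma> j" if "v \<in> W i \<inter> W j" for v
      using that \<open>i \<in> I\<close> \<open>j \<in> I\<close> by blast
    moreover have "\<Gamma> i \<inter> \<Gamma> j = {{}}" using assms(9)[of i j] that by (simp add: I_def)
    ultimately show ?thesis by auto
  qed
  have U: "\<Delta> \<inter> U = G" using full unfolding U_def G_def by blast
  obtain F where F: "F \<in> \<Delta>" "card F = d" using complex_dim_faces(1)[OF assms(3,4)] by auto
  have le: "card \<sigma> \<le> d" if "\<sigma> \<in> \<Delta>" for \<sigma> using complex_dim_faces(2)[OF assms(3,4) that] by simp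
  have "\<exists>F\<in>\<Gamma> i. int (card F) = int d - 1" if "i \<in> I" for i
    using complex_dim_faces(1)[OF \<Gamma>(1)[OF that]] assms(7) that by (simp add: I_def)
  then obtain F' where F': "\<And>i. i \<in> I \<Longrightarrow> F' i \<in> \<Gamma> i \<and> int (card (F' i)) = int d - 1" by metis
  have le': "int (card \<sigma>) \<le> int d - 1" if "i \<in> I" "\<sigma> \<in> \<Gamma> i" for i \<sigma>
    using complex_dim_faces(2)[OF \<Gamma>(1)[OF that(1)] _ that(2)] assms(7) that(1) by (simp add: I_def)
  have I: "finite I" "I \<noteq> {}" using assms(2) by (auto simp: I_def)
  have d1: "1 \<le> d" using F' I(2) by fastforce
  have rd: "rel_dim \<Delta> G = int d - 1"
  proof -
    \<comment> \<open>Faces of the \<open>\<Gamma> i\<close> have at most \<open>d - 1\<close>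
      elements, so a largest face of \<Delta> survives in the relative complex, and its h-polynomial
      is formed with the same \<open>d\<close>.\<close>
    have "F \<notin> G" using F le' by (force simp: G_def)
    then have "int d - 1 \<in> face_dim ` (\<Delta> - G)" using F by (force simp: face_dim_def)
    moreover have "face_dim \<sigma> \<le> int d - 1" if "\<sigma> \<in> \<Delta>" for \<sigma>
      using le[OF that] by (simp add: face_dim_def)
    ultimately show ?thesis unfolding rel_dim_def using fin\<Delta> by (intro Max_eqI) auto
  qed
  have dn: "d \<le> card V" using F \<Delta>V finV card_mono by blast
  obtain vs where vs: "set vs = V" "distinct vs" using finite_distinct_list[OF finV] by blast
  interpret sr_ring V vs "TYPE('k)" using vs assms(1) by unfold_locales
  have dc\<Delta>: "down_closed \<Delta>" using down by (auto simp: down_closed_def)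
  have dc\<Gamma>: "down_closed (\<Gamma> i)" if "i \<in> I" for i
    using \<Gamma>(1)[OF that] by (auto simp: abs_simplicial_complex_def down_closed_def)
  \<comment> \<open>Prescribed depths: \<open>d\<close> for \<Delta> and for the simplices with at
    least \<open>d\<close> vertices, \<open>d - 1\<close> for the \<open>\<Gamma> i\<close>, and one
    more form for \<open>k[V]\<close> itself, for the equality case. The minimum respects that
    \<open>k[V]\<close> has only depth \<open>card V\<close>.\<close>
  define \<I> where "\<I> = {(d, sri \<Delta>), (min (card V) (d + 1), sri (Pow V))} \<union>
    (\<lambda>i. (d - 1, sri (\<Gamma> i))) ` I \<union> (\<lambda>i. (d, sri (Pow (W i)))) ` {i \<in> I. d \<le> card (W i)}"
  have "idl (snd L) \<and> depth_ge (fst L) (snd L)" if "L \<in> \<I>" for L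
  proof -
    have "depth_ge d (sri \<Delta>)"
      using depth_ge_cohen_macaulay[OF assms(3) _ assms(5) F(1)] F(2) by (simp add: V_def)
    moreover have "depth_ge (min (card V) (d + 1)) (sri (Pow V))"
      using depth_sri_Pow[of V] depth_ge_mono by auto
    moreover have "depth_ge (d - 1) (sri (\<Gamma> i))" if "i \<in> I" for i
    proof -
      have "depth_ge (card (F' i)) (sri (\<Gamma> i))"
        using depth_ge_cohen_macaulay[OF \<Gamma>(1)[OF that]] WV[OF that] assms(8) F'[OF that] that
        by (simp add: I_def W_def)
      moreover have "card (F' i) + 1 = d" using F'[OF that] by linarith
      then have "card (F' i) = d - 1" by simp
      ultimately show ?thesis by simp
    qed
    moreover have "depth_ge d (sri (Pow (W i)))" if "i \<in> I" "d \<le> card (W i)" for i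
      using depth_sri_Pow[OF WV[OF that(1)]] depth_ge_mono that(2) by blast
    ultimately show ?thesis using that dc\<Delta> dc\<Gamma> by (auto simp: \<I>_def idl_sri down_closed_Pow)
  qed
  moreover have "finite \<I>" using I by (simp add: \<I>_def)
  ultimately obtain xs where xs: "length xs = d + 1" "set xs \<subseteq> range (lin_form vs)"
    "\<And>L. L \<in> \<I> \<Longrightarrow> reg_seq (snd L) (take (fst L) xs)"
    using common_reg_seq[of \<I> snd fst "d + 1"] by blast
  have hom1: "set xs \<subseteq> hom 1" using xs(2) lin_form_hom by blast
  have xsS: "set (take d xs) \<subseteq> poly_in V" using hom1 hom_sub set_take_subset by fast
  define E where "E j = \<Delta> \<union> (\<Union>i\<in>{1..j}. Pow (W i))" for j
  have "down_closed (\<Union>i\<in>{1..j}. Pow (W i))" for j unfolding down_closed_def by blast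
  then have dcE: "down_closed (E j)" for j unfolding E_def using dc\<Delta> down_closed_Un by blast
  have regE: "reg_seq (sri (E j)) (take d xs)" if "j \<le> m" for j
    using that
  proof (induction j)
    case 0
    then show ?case using xs(3)[of "(d, sri \<Delta>)"] by (simp add: \<I>_def E_def)
  next
    case (Suc j)
    have iI: "Suc j \<in> I" using Suc.prems by (simp add: I_def)
    have ES: "E (Suc j) = E j \<union> Pow (W (Suc j))" by (auto simp: E_def atLeastAtMostSuc_conv)
    show ?case
    proof (cases "d \<le> card (W (Suc j))")
      case True
      have "Pow (W i) \<inter> Pow (W (Suc j)) \<subseteq> \<Gamma> (Suc j)" if "i \<in> {1..j}" for i
      proof -
        have "i \<in> I" "i \<noteq> Suc j" using that Suc.prems by (auto simp: I_def)
        then have "Pow (W i) \<inter> Pow (W (Suc j)) \<subseteq> {{}}" using disj[OF _ iI] by blast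
        moreover have "{} \<in> \<Gamma> (Suc j)" using \<Gamma>(1)[OF iI] by (simp add: abs_simplicial_complex_def)
        ultimately show ?thesis by blast
      qed
      then have "E j \<inter> Pow (W (Suc j)) = \<Gamma> (Suc j)" using full[OF iI] unfolding E_def by blast
      then have "ideal_sum (sri (E j)) (sri (Pow (W (Suc j)))) = sri (\<Gamma> (Suc j))" by (simp add: sri_sum)
      \<comment> \<open>The form left out in \<open>reg_seq_Int\<close> is the one not covered by
        the depth \<open>d - 1\<close> of \<open>\<Gamma> (Suc j)\<close>.\<close>
      moreover have "butlast (take d xs) = take (d - 1) xs" using xs(1) by (simp add: butlast_take)
      ultimately have "reg_seq (ideal_sum (sri (E j)) (sri (Pow (W (Suc j))))) (butlast (take d xs))"
        using xs(3)[of "(d - 1, sri (\<Gamma> (Suc j)))"] iI by (auto simp: \<I>_def)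
      moreover have "reg_seq (sri (Pow (W (Suc j)))) (take d xs)"
        using xs(3)[of "(d, sri (Pow (W (Suc j))))"] iI True by (auto simp: \<I>_def)
      ultimately have "reg_seq (sri (E j) \<inter> sri (Pow (W (Suc j)))) (take d xs)"
        using Suc xsS dcE by (intro reg_seq_Int) (auto simp: idl_sri down_closed_Pow)
      then show ?thesis by (simp add: ES sri_Int)
    next
      case False
      \<comment> \<open>\<open>\<Gamma> (Suc j)\<close> has a face with \<open>d - 1\<close>
        vertices, and here there are no further vertices: the simplex is already a face of
        \<Delta>.\<close>
      have F'W: "F' (Suc j) \<subseteq> W (Suc j)" using F'[OF iI] by (auto simp: W_def vertices_def)
      moreover have "finite (W (Suc j))" using WV[OF iI] finV finite_subset by blast
      moreover have "card (W (Suc j)) \<le> card (F' (Suc j))" using False F'[OF iI] by simp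
      ultimately have "F' (Suc j) = W (Suc j)" using card_seteq by blast
      then have "W (Suc j) \<in> \<Delta>" using F'[OF iI] \<Gamma>(2)[OF iI] by auto
      then have "Pow (W (Suc j)) \<subseteq> E j" using down unfolding E_def by blast
      then have "E (Suc j) = E j" using ES by blast
      then show ?thesis using Suc by simp
    qed
  qed
  have EU: "E m = \<Delta> \<union> U" by (simp add: E_def U_def I_def)
  have EV: "E m \<subseteq> Pow V" unfolding EU U_def using \<Delta>V WV by blast
  have regV: "reg_seq (sri (Pow V)) (take (min (card V) (d + 1)) xs)"
    using xs(3)[of "(min (card V) (d + 1), sri (Pow V))"] by (simp add: \<I>_def)
  then have regVd: "reg_seq (sri (Pow V)) (take d xs)"
    using reg_seq_take[OF regV, of d] dn by (simp add: min_def split: if_splits)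
  have xs_split: "xs = take d xs @ [xs ! d]" using xs(1) take_Suc_conv_app_nth[of d xs] by simp
  \<comment> \<open>If \<open>card V = d\<close>, a face of size \<open>d\<close> is all of
    \<open>V\<close> and \<Delta> is the full simplex. Otherwise \<open>card V\<close> exceeds
    \<open>d\<close>, and \<open>k[V]\<close> has room for the extra form.\<close>
  have last: "reg (adjoins (sri (Pow V)) (take d xs)) (xs ! d)" if "E m \<noteq> Pow V"
  proof -
    have "card V \<noteq> d"
    proof
      assume "card V = d"
      then have "F = V" using F \<Delta>V finV card_subset_eq[of V F] by blast
      then have "Pow V \<subseteq> \<Delta>" using F(1) down by blast
      then show False using that EV by (auto simp: E_def)
    qed
    then have "min (card V) (d + 1) = length xs" using dn xs(1) by simp
    then have "reg_seq (sri (Pow V)) (take d xs @ [xs ! d])" using regV xs_split by simp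
    then show ?thesis by (simp add: reg_seq_append)
  qed
  have x: "xs ! d \<in> hom 1" "set (take d xs) \<subseteq> hom 1" "length (take d xs) = d"
    using hom1 xs(1) set_take_subset[of d xs] nth_mem[of d xs] by auto
  note D = dcE[of m] EV x(2,1,3) regE[OF order_refl] regVd
  let ?bound = "((real (face_number \<Delta> 0) - real d + real k - 1) gchoose k)
           - (\<Sum>i = 1..m. ((real (face_number (\<Gamma> i) 0) - real d + real k - 1) gchoose k))
           + (real m - 1) * ((- real d + real k - 1) gchoose k)"
  have "fps_nth (deficiency (\<Delta> \<union> U) d) k = ?bound - real_of_int (rel_h_number \<Delta> G k)"
  proof -
    have "(\<Sum>i = 1..m. ((real (face_number (\<Gamma> i) 0) - real d + real k - 1) gchoose k)) =
      (\<Sum>i\<in>I. ((real (card (W i)) - real d + real k - 1) gchoose k))"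
      unfolding I_def using face_number_0[OF \<Gamma>(1)] by (intro sum.cong) (auto simp: I_def W_def)
    moreover have "card I = m" by (simp add: I_def)
    moreover have "fps_nth (of_nat m * f) k = real m * fps_nth f k" for f :: "real fps"
      by (simp flip: fps_of_nat)
    moreover have "face_number \<Delta> 0 = card V" using face_number_0[OF assms(3)] by (simp add: V_def)
    moreover have "deficiency (\<Delta> \<union> U) d =
      neg_binomial (real (card V) - real d) - (\<Sum>i\<in>I. neg_binomial (real (card (W i)) - real d))
      + of_nat (card I) * neg_binomial (- real d) - neg_binomial (- real d) - real_series (rel_h_poly \<Delta> G)"
      unfolding U_def
      by (rule deficiency_series) (use fin\<Delta> rd le I WV \<Delta>V disj U in \<open>simp_all add: U_def\<close>)
    ultimately show ?thesis
      by (simp add: neg_binomial_def real_series_def rel_h_number_def fps_sum_nth left_diff_distrib)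
  qed
  then have eq: "?bound - real_of_int (rel_h_number \<Delta> G k) = fps_nth (deficiency (E m) d) k"
    by (simp add: EU)
  \<comment> \<open>Dimension is size minus one, so dimension below \<open>k\<close> means at most
    \<open>k\<close> vertices, with size \<open>k\<close> included.\<close>
  have fd: "face_dim \<sigma> < int k \<longleftrightarrow> \<not> k < card \<sigma>" for \<sigma> :: "'v set"
    by (auto simp: face_dim_def)
  have "fps_nth (deficiency (E m) d) k = 0 \<longleftrightarrow> (\<forall>\<sigma>\<in>Pow V - E m. k < card \<sigma>)"
    by (rule deficiency_eq_0_iff[OF D last])
  also have "\<dots> \<longleftrightarrow> (\<forall>\<sigma>. \<sigma> \<subseteq> vertices \<Delta> \<and> \<sigma> \<notin> \<Delta> \<and> face_dim \<sigma> < int k \<longrightarrow>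
              (\<exists>i\<in>{1..m}. \<sigma> \<subseteq> vertices (\<Gamma> i)))"
    unfolding EU U_def I_def V_def W_def fd by blast
  finally have zero: "fps_nth (deficiency (E m) d) k = 0 \<longleftrightarrow>
      (\<forall>\<sigma>. \<sigma> \<subseteq> vertices \<Delta> \<and> \<sigma> \<notin> \<Delta> \<and> face_dim \<sigma> < int k \<longrightarrow>
        (\<exists>i\<in>{1..m}. \<sigma> \<subseteq> vertices (\<Gamma> i)))" .
  have "real_of_int (rel_h_number \<Delta> G k) \<le> ?bound"
    using deficiency_nonneg[OF D, of k] eq by linarith
  moreover have "real_of_int (rel_h_number \<Delta> G k) = ?bound \<longleftrightarrow> fps_nth (deficiency (E m) d) k = 0"
    using eq by auto
  ultimately show ?thesis unfolding zero G_def I_def by blast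
qed

end
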